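(* Let $D\ge 0$ be an integer, and let $N$, $E_N$, $\mathcal X_D$, the map $\epsilon:\mathcal X_D\to E_N$, the subspaces $\langle B\rangle\subset E_N$ (for $B\in\mathcal X_D$), the relation $\le_D$, and the subsets $\mathcal X_D^t$, $\mathcal X_D^{t,\pm}$, $\mathcal X_D^{\pm}$, $\mathcal E_D^t$, $\mathcal E_D^{t,\pm}$, $\mathcal E_D^{\pm}$ be as defined in the context. Then: (a) There is a unique bijection $\epsilon':\mathcal X_D\to E_N$ such that $\epsilon'(B)\in\langle B\rangle$ for every $B\in\mathcal X_D$. (b) $\epsilon'(B)=\epsilon(B)$ for every $B\in\mathcal X_D$. (In particular $\epsilon$ is a bijection, so that the relation $\le_D$, whose definition involves $\epsilon^{-1}$, makes sense.) (c) The relation $\le_D$ is a partial order on $E_N$. (d) If $D$ is even, then for every $t\in 2\mathbb Z$ the map $\epsilon$ restricts to a bijection $\mathcal X_D^t\to\mathcal E_D^t$. If $D$ is odd, then for every $t\in2\mathbb Z$ the map $\epsilon$ restricts to bijections $\mathcal X_D^{t,+}\to\mathcal E_D^{t,+}$ and $\mathcal X_D^{t,-}\to\mathcal E_D^{t,-}$, and it restricts to bijections $\mathcal X_D^{+}\to\mathcal E_D^{+}$ and $\mathcal X_D^{-}\to\mathcal E_D^{-}$.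
   Context: Notation: $[i,j]=\{z\in\mathbb Z: i\le z\le j\}$ (empty if $i>j$); $F$ is the field with two elements. $D\ge0$ is an integer; $N=D+1$ if $D$ is even and $N=D+2$ if $D$ is odd (so $N$ is odd). The set of all subsets of $[1,N]$ is viewed as an $F$-vector space, with sum $A+B=(A\cup B)-(A\cap B)$; $E_N$ is the subspace of subsets of even cardinality. ${}^2E_N$ is the set of $2$-element subsets of $[1,N]$. An element $\{i,j\}\in{}^2E_N$ is written $ij$ where the order is chosen so that $i<j$ if $i-j$ is odd, and $i>j$ if $i-j$ is even. For such $ij$ put $\lfloor i,j\rfloor=[i,j]$ if $i<j$ ($i-j$ odd) and $\lfloor i,j\rfloor=[i,N]\cup[1,j]$ if $i>j$ ($i-j$ even); then $\lfloor i,j\rfloor\in E_N$. $\mathcal P_N$ is the set of all (possibly empty) sets $B$ of pairwise disjoint elements of ${}^2E_N$. For $B\in\mathcal P_N$: $\mathrm{supp}(B)\subset[1,N]$ is the union of the members of $B$; $B^1$ is the set of $ij\in B$ with $i-j$ odd; $B^0$ is the set of $ij\in B$ with $i-j$ even (so $i>j$); if $B^0\neq\emptyset$, $i_B$ is the largest $i$ such that $ij\in B^0$ for some $j$. Subset $Pr_D\subset\mathcal P_N$. If $D=0$: $Pr_D=\{\emptyset\}$. If $D$ is even, $D\ge2$: $Pr_D$ consists of $\emptyset$; of $Q_D^t=\{\{D+1,1\},\{D,2\},\dots,\{D+2-t,t\}\}$ for even $t\in[2,D/2]$; and of $Q_D^{-t}=\{\{D+1,1\},\{D,2\},\dots,\{D+3-t,t-1\}\}$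 for even $t\in[2,(D+2)/2]$. If $D$ is odd: $Pr_D$ consists of $\emptyset$; of $\{\{D+1,D+2\}\}$; of $\{\{D+1,2\},\{D,3\},\dots,\{D+3-t,t\}\}$ for even $t\in[2,(D+1)/2]$; of $\{\{D,1\},\{D-1,2\},\dots,\{D+2-t,t-1\}\}$ for even $t\in[2,(D+1)/2]$; of $\{\{D+2,1\},\{D+1,2\},\dots,\{D+4-t,t-1\}\}$ for even $t\in[2,(D+3)/2]$; and of $\{\{D+1,D+2\},\{D,1\},\{D-1,2\},\dots,\{D+1-t,t\}\}$ for even $t\in[2,(D-1)/2]$. For $N\ge3$ and $k\in[1,D]$ let $\iota_k:[1,N-2]\to[1,N]$, $\iota_k(i)=i$ for $i\le k-1$, $\iota_k(i)=i+2$ for $i\ge k$. Define $I_k:\mathcal P_{N-2}\to\mathcal P_N$ by $I_k(B')=\{\{\iota_k(i),\iota_k(j)\}:\{i,j\}\in B'\}\cup\{\{k,k+1\}\}$. Subset $\mathcal X_D\subset\mathcal P_N$, by induction on $D$: $\mathcal X_0=\{\emptyset\}$; $\mathcal X_1=Pr_1\cup\{\{\{1,2\}\}\}$; for $D\ge2$, $\mathcal X_D=Pr_D\cup\bigcup_{k\in[1,D]}I_k(\mathcal X_{D-2})$. Pieces of $\mathcal X_D$. If $D$ is even, for $t\in2\mathbb Z$: $\mathcal X_D^t$ is the set of $B\in\mathcal X_D$ with $|B^0|=t$ if $t\ge0$, $|B^0|=-t-1$ if $t<0$. If $D$ is odd: $\mathcal X_D^+=\{B\in\mathcal X_D:N\notin\mathrm{supp}(B)\}$,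 $\mathcal X_D^-=\{B\in\mathcal X_D:N\in\mathrm{supp}(B)\}$; for $t\in2\mathbb Z$, $\mathcal X_D^{t,+}$ is the set of $B\in\mathcal X_D^+$ such that: $|B^0|=0$ (if $t=0$); $|B^0|=t-1$ and $i_B$ is even (if $t>0$); $|B^0|=-t-1$ and $i_B$ is odd (if $t<0$); and $\mathcal X_D^{t,-}$ is the set of $B\in\mathcal X_D^-$ such that: $|B^0|=0$ (if $t=0$); $|B^0|=t$ and $i_B\ne N$ (if $t>0$); $|B^0|=-t-1$ and $i_B=N$ (if $t<0$). The element $u_B$. Let $D$ be odd and $B\in\mathcal X_D$ with $B^0\ne\emptyset$, $N\notin\mathrm{supp}(B)$. Then there is a unique sequence $i_1<i_2<\dots<i_{2s}$ ($s\ge1$) with $B^0=\{i_{2s}i_1,i_{2s-1}i_2,\dots,i_{s+1}i_s\}$, and $i_B=i_{2s}$. Let $\mathcal J=[i_{2s}+1,N-1]$ if $i_{2s}$ is odd, $\mathcal J=[1,i_1-1]$ if $i_{2s}$ is even. It is known that there is a unique sequence $a_1<b_1<a_2<b_2<\dots<a_m<b_m$ ($m\ge 0$) with all $a_rb_r\in B^1$ such that $\mathcal J$ is the disjoint union of $[a_1,b_1],\dots,[a_m,b_m]$ and of a one-element set; $u_B$ denotes the unique element of that one-element set. The map $\epsilon$. For $B\in\mathcal X_D$ define $\underline B\in E_N$: $\underline B=[u_B,N]$ if $D$ is odd and $B\in\mathcal X_D^{t,+}$ for some even $t<0$; $\underline B=\{N\}\cup[1,u_B]$ if $D$ is odd and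 $B\in\mathcal X_D^{t,+}$ for some even $t>0$; $\underline B=\emptyset$ in all other cases (in particular whenever $D$ is even). Define $\epsilon:\mathcal X_D\to E_N$ by $\epsilon(B)=\sum_{ij\in B}\lfloor i,j\rfloor+\underline B$ (sum in $E_N$). For $B\in\mathcal X_D$, $\langle B\rangle$ is the $F$-subspace of $E_N$ spanned by the vectors $\{i,j\}\in E_N$, $ij\in B$. The relation $\le_D$ on $E_N$ is the transitive relation generated by the relation for which $X,X'\in E_N$ are related if $X\in\langle\epsilon^{-1}(X')\rangle$. For $X\in E_N$ let $\gamma(X)=|X\cap2\mathbb Z|-|X\cap(2\mathbb Z+1)|$, an even integer. If $D$ is even and $t\in2\mathbb Z$: $\mathcal E_D^t=\{X\in E_N:\gamma(X)=t\}$. If $D$ is odd: $\mathcal E_D^+=\{X\in E_N:N\notin X\}$, $\mathcal E_D^-=\{X\in E_N:N\in X\}$, and for $t\in2\mathbb Z$, $\mathcal E_D^{t,\pm}=\{X\in\mathcal E_D^{\pm}:\gamma(X)=t\}$. *)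

theory Defs
  imports Complex_Main "HOL-Library.FuncSet" "HOL-Library.Z2"
begin

definition NN :: "nat \<Rightarrow> nat" where
  "NN D = (if even D then D + 1 else D + 2)"


section \<open>Sets of naturals as vectors over the field with two elements\<close>

definition vadd :: "nat set \<Rightarrow> nat set \<Rightarrow> nat set" where
  "vadd A B = (A \<union> B) - (A \<inter> B)"

definition vscale :: "bit \<Rightarrow> nat set \<Rightarrow> nat set" where
  "vscale c A = (if c = 0 then {} else A)"

interpretation vadd: comm_monoid_set vadd "{}"
  by standard (auto simp: vadd_def)

text \<open>The finite sum of a family of vectors is the big operator of this commutative monoid.\<close>

definition vsum :: "('a \<Rightarrow> nat set) \<Rightarrow> 'a set \<Rightarrow> nat set" where
  "vsum = comm_monoid_set.F vadd {}"

definition vsubspace :: "nat set set \<Rightarrow> bool" where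
  "vsubspace V \<longleftrightarrow> {} \<in> V \<and> (\<forall>A\<in>V. \<forall>B\<in>V. vadd A B \<in> V) \<and> (\<forall>c. \<forall>A\<in>V. vscale c A \<in> V)"

definition EE :: "nat \<Rightarrow> nat set set" where
  "EE N = {X. X \<subseteq> {1..N} \<and> even (card X)}"

text \<open>The members of \<^term>\<open>B\<close> are two-element sets \<open>{i,j}\<close>, hence are themselves the
  spanning vectors.\<close>

definition vspan :: "nat set set \<Rightarrow> nat set set" where
  "vspan B = vsubspace hull B"


section \<open>Two-element subsets\<close>

definition E2 :: "nat \<Rightarrow> nat set set" where
  "E2 N = {p. p \<subseteq> {1..N} \<and> card p = 2}"

text \<open>A two-element set \<open>{i,j}\<close> is written \<open>ij\<close> with \<open>i < j\<close> if \<open>i - j\<close> is odd and \<open>i > j\<close> if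
  \<open>i - j\<close> is even; \<open>first p\<close> and \<open>second p\<close> are these \<open>i\<close> and \<open>j\<close>.\<close>

definition first :: "nat set \<Rightarrow> nat" where
  "first p = (if odd (Max p - Min p) then Min p else Max p)"

definition second :: "nat set \<Rightarrow> nat" where
  "second p = (if odd (Max p - Min p) then Max p else Min p)"

lemma first_second_iff:
  fixes i j :: nat
  assumes "i \<noteq> j"
  shows "first {i, j} = i \<and> second {i, j} = j
    \<longleftrightarrow> (if odd (int i - int j) then i < j else j < i)"
  using assms by (auto simp: first_def second_def max_def min_def)

definition floor2 :: "nat \<Rightarrow> nat set \<Rightarrow> nat set" where
  "floor2 N p = (if first p < second p then {first p..second p}
                 else {first p..N} \<union> {1..second p})"

definition PP :: "nat \<Rightarrow> nat set set set" where
  "PP N = {B. B \<subseteq> E2 N \<and> pairwise disjnt B}"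

definition supp :: "nat set set \<Rightarrow> nat set" where
  "supp B = \<Union>B"

definition odd_part :: "nat set set \<Rightarrow> nat set set" where  \<comment> \<open>\<open>B\<^sup>1\<close>\<close>
  "odd_part B = {p \<in> B. odd (int (first p) - int (second p))}"

definition even_part :: "nat set set \<Rightarrow> nat set set" where  \<comment> \<open>\<open>B\<^sup>0\<close>\<close>
  "even_part B = {p \<in> B. even (int (first p) - int (second p))}"

definition i_max :: "nat set set \<Rightarrow> nat" where  \<comment> \<open>\<open>i\<^sub>B\<close>, for \<open>B\<^sup>0\<close> nonempty\<close>
  "i_max B = Max (first ` even_part B)"


section \<open>The collection \<open>\<X>\<^sub>D\<close>\<close>

text \<open>\<open>nest c a b\<close> is \<open>{{c - a, a}, {c - a - 1, a + 1}, \<dots>, {c - b, b}}\<close>.\<close>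

definition nest :: "nat \<Rightarrow> nat \<Rightarrow> nat \<Rightarrow> nat set set" where
  "nest c a b = (\<lambda>r. {c - r, r}) ` {a..b}"

definition Pr :: "nat \<Rightarrow> nat set set set" where
  "Pr D =
    (if D = 0 then {{}}
     else if even D then
       {{}}
       \<union> {nest (D + 2) 1 t | t. even t \<and> t \<in> {2..D div 2}}
       \<union> {nest (D + 2) 1 (t - 1) | t. even t \<and> t \<in> {2..(D + 2) div 2}}
     else
       {{}}
       \<union> {{{D + 1, D + 2}}}
       \<union> {nest (D + 3) 2 t | t. even t \<and> t \<in> {2..(D + 1) div 2}}
       \<union> {nest (D + 1) 1 (t - 1) | t. even t \<and> t \<in> {2..(D + 1) div 2}}
       \<union> {nest (D + 3) 1 (t - 1) | t. even t \<and> t \<in> {2..(D + 3) div 2}}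
       \<union> {insert {D + 1, D + 2} (nest (D + 1) 1 t) | t. even t \<and> t \<in> {2..(D - 1) div 2}})"

definition iota :: "nat \<Rightarrow> nat \<Rightarrow> nat" where
  "iota k i = (if i < k then i else i + 2)"

definition II :: "nat \<Rightarrow> nat set set \<Rightarrow> nat set set" where
  "II k B = (\<lambda>p. iota k ` p) ` B \<union> {{k, k + 1}}"

fun XX :: "nat \<Rightarrow> nat set set set" where
  "XX 0 = {{}}"
| "XX (Suc 0) = Pr 1 \<union> {{{1, 2}}}"
| "XX (Suc (Suc D)) = Pr (D + 2) \<union> (\<Union>k\<in>{1..D + 2}. II k ` XX D)"


lemma nest_in_PP:
  assumes "1 \<le> a" "2 * b < c" "c \<le> N + a"
  shows "nest c a b \<in> PP N"
  using assms
  by (auto simp: nest_def PP_def E2_def pairwise_def disjnt_def card_insert_if doubleton_eq_iff)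

lemma Pr_subset_PP: "Pr D \<subseteq> PP (NN D)"
proof -
  have e: "{} \<in> PP N" for N by (simp add: PP_def)
  have i: "insert {D + 1, D + 2} (nest (D + 1) 1 t) \<in> PP (D + 2)" if "2 * t < D + 1" for D t
    using that
    by (auto simp: nest_def PP_def E2_def pairwise_def disjnt_def card_insert_if doubleton_eq_iff)
  have j: "{{D + 1, D + 2}} \<in> PP (D + 2)" for D
    by (auto simp: PP_def E2_def)
  show ?thesis
    by (auto simp: Pr_def NN_def e intro!: nest_in_PP i[simplified] j[simplified] elim!: oddE evenE)
qed

lemma II_in_PP:
  assumes B: "B \<in> PP N" and k: "k \<in> {1..N + 1}"
  shows "II k B \<in> PP (N + 2)"
proof -
  have inj: "inj (iota k)" by (auto simp: inj_def iota_def split: if_splits)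
  have range: "iota k x \<noteq> k" "iota k x \<noteq> Suc k" "k \<noteq> iota k x" "Suc k \<noteq> iota k x" for x by (auto simp: iota_def)
  have "iota k ` p \<in> E2 (N + 2)" if "p \<in> B" for p
  proof -
    have p: "p \<subseteq> {1..N}" "card p = 2" using that B by (auto simp: PP_def E2_def)
    have "card (iota k ` p) = 2"
      using p card_image[OF inj_on_subset[OF inj subset_UNIV]] by metis
    moreover have "iota k ` p \<subseteq> {1..N + 2}" using p by (force simp: iota_def)
    ultimately show ?thesis by (simp add: E2_def)
  qed
  moreover have "{k, k + 1} \<in> E2 (N + 2)" using k by (auto simp: E2_def)
  moreover have "pairwise disjnt ((`) (iota k) ` B)"
  proof (rule pairwise_imageI)
    fix p q assume "p \<in> B" "q \<in> B" "p \<noteq> q"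
    then have "disjnt p q" using B by (auto simp: PP_def pairwise_def)
    then show "disjnt (iota k ` p) (iota k ` q)" using inj by (auto simp: disjnt_def inj_def)
  qed
  moreover have "disjnt (iota k ` p) {k, k + 1}" "disjnt {k, k + 1} (iota k ` p)" for p
    using range by (auto simp: disjnt_def)
  ultimately show ?thesis
    by (simp add: PP_def II_def pairwise_insert image_subset_iff) blast
qed

lemma XX_subset_PP: "XX D \<subseteq> PP (NN D)"
proof (induction D rule: XX.induct)
  case 1
  then show ?case by (simp add: PP_def)
next
  case 2
  then show ?case using Pr_subset_PP[of 1] by (auto simp: PP_def E2_def NN_def)
next
  case (3 D)
  have n: "NN (D + 2) = NN D + 2" and "D + 2 \<le> NN D + 1" by (auto simp: NN_def)
  then show ?case using 3 II_in_PP[of _ "NN D"] Pr_subset_PP[of "D + 2"] by fastforce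
qed


section \<open>The pieces of \<open>\<X>\<^sub>D\<close>\<close>

text \<open>In this section and the next one, the index \<open>t\<close> is meant to be even; \<open>Xeven\<close> and
  \<open>Eeven\<close> are used for even \<open>D\<close> only, the signed pieces for odd \<open>D\<close> only.\<close>

definition Xeven :: "nat \<Rightarrow> int \<Rightarrow> nat set set set" where
  "Xeven D t = {B \<in> XX D. int (card (even_part B)) = (if t \<ge> 0 then t else - t - 1)}"

definition Xplus :: "nat \<Rightarrow> nat set set set" where
  "Xplus D = {B \<in> XX D. NN D \<notin> supp B}"

definition Xminus :: "nat \<Rightarrow> nat set set set" where
  "Xminus D = {B \<in> XX D. NN D \<in> supp B}"

definition Xplus_piece :: "nat \<Rightarrow> int \<Rightarrow> nat set set set" where
  "Xplus_piece D t = {B \<in> Xplus D.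
     if t = 0 then card (even_part B) = 0
     else if t > 0 then int (card (even_part B)) = t - 1 \<and> even (i_max B)
     else int (card (even_part B)) = - t - 1 \<and> odd (i_max B)}"

definition Xminus_piece :: "nat \<Rightarrow> int \<Rightarrow> nat set set set" where
  "Xminus_piece D t = {B \<in> Xminus D.
     if t = 0 then card (even_part B) = 0
     else if t > 0 then int (card (even_part B)) = t \<and> i_max B \<noteq> NN D
     else int (card (even_part B)) = - t - 1 \<and> i_max B = NN D}"


section \<open>The pieces of \<open>E\<^sub>N\<close>\<close>

definition gamma :: "nat set \<Rightarrow> int" where
  "gamma X = int (card {x \<in> X. even x}) - int (card {x \<in> X. odd x})"

definition Eeven :: "nat \<Rightarrow> int \<Rightarrow> nat set set" where
  "Eeven D t = {X \<in> EE (NN D). gamma X = t}"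

definition Eplus :: "nat \<Rightarrow> nat set set" where
  "Eplus D = {X \<in> EE (NN D). NN D \<notin> X}"

definition Eminus :: "nat \<Rightarrow> nat set set" where
  "Eminus D = {X \<in> EE (NN D). NN D \<in> X}"

definition Eplus_piece :: "nat \<Rightarrow> int \<Rightarrow> nat set set" where
  "Eplus_piece D t = {X \<in> Eplus D. gamma X = t}"

definition Eminus_piece :: "nat \<Rightarrow> int \<Rightarrow> nat set set" where
  "Eminus_piece D t = {X \<in> Eminus D. gamma X = t}"


section \<open>The map \<open>\<epsilon>\<close>\<close>

text \<open>\<open>is_u D B u\<close>: there are sequences \<open>i\<^sub>1 < \<dots> < i\<^sub>2\<^sub>s\<close> with \<open>s \<ge> 1\<close> and
  \<open>B\<^sup>0 = {i\<^sub>2\<^sub>s i\<^sub>1, \<dots>, i\<^sub>s\<^sub>+\<^sub>1 i\<^sub>s}\<close>, and \<open>a\<^sub>1 < b\<^sub>1 < \<dots> < a\<^sub>m < b\<^sub>m\<close> with all \<open>a\<^sub>r b\<^sub>r\<close> in \<open>B\<^sup>1\<close>,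
  such that the interval \<open>\<J>\<close> determined by the first sequence is the disjoint union of the
  \<open>[a\<^sub>r, b\<^sub>r]\<close> and \<open>{u}\<close>. The sequences are functions of which only the values on \<open>[1, 2s]\<close>,
  resp. \<open>[1, m]\<close>, matter.\<close>

definition is_u :: "nat \<Rightarrow> nat set set \<Rightarrow> nat \<Rightarrow> bool" where
  "is_u D B u \<longleftrightarrow>
    (\<exists>(s::nat) (i::nat \<Rightarrow> nat) (m::nat) (a::nat \<Rightarrow> nat) (b::nat \<Rightarrow> nat).
       s \<ge> 1 \<and> strict_mono_on {1..2 * s} i \<and>
       even_part B = (\<lambda>r. {i (2 * s + 1 - r), i r}) ` {1..s} \<and>
       (\<forall>r\<in>{1..m}. a r < b r \<and> {a r, b r} \<in> odd_part B) \<and>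
       (\<forall>r\<in>{1..<m}. b r < a (r + 1)) \<and>
       u \<notin> (\<Union>r\<in>{1..m}. {a r..b r}) \<and>
       (if odd (i (2 * s)) then {i (2 * s) + 1..NN D - 1} else {1..i 1 - 1})
         = (\<Union>r\<in>{1..m}. {a r..b r}) \<union> {u})"

definition u_of :: "nat \<Rightarrow> nat set set \<Rightarrow> nat" where
  "u_of D B = (THE u. is_u D B u)"

definition underline :: "nat \<Rightarrow> nat set set \<Rightarrow> nat set" where
  "underline D B =
    (if odd D \<and> (\<exists>t. even t \<and> t < 0 \<and> B \<in> Xplus_piece D t) then {u_of D B..NN D}
     else if odd D \<and> (\<exists>t. even t \<and> t > 0 \<and> B \<in> Xplus_piece D t) then {NN D} \<union> {1..u_of D B}
     else {})"

definition eps :: "nat \<Rightarrow> nat set set \<Rightarrow> nat set" where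
  "eps D B = vadd (vsum (floor2 (NN D)) B) (underline D B)"


section \<open>The relation \<open>\<le>\<^sub>D\<close>\<close>

definition leD :: "nat \<Rightarrow> (nat set \<times> nat set) set" where
  "leD D = {(X, X'). X \<in> EE (NN D) \<and> X' \<in> EE (NN D)
                    \<and> X \<in> vspan (inv_into (XX D) (eps D) X')}\<^sup>+"

end

(*
For even D, encode X as a +-1 path of odd length N, with step x up iff (x even <-> x in X). Let d(k) be
the number of pairs ij in B whose interval [i,j] (taken cyclically if i > j) crosses from k-1 to k. Each X in <B>
satisfies |height X k| <= 2 d(k) + 1 for the centred height, with equality for all k only if X = eps B. So
eps B is the unique element of <B> of maximal weight, the weight of X being the sum of |height X k| over k;
uniqueness of eps' and antisymmetry of the order follow. Inserting {k,k+1} creates a strict local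
maximum of d, every strict local maximum of |height X| can be removed by undoing such an insertion,
and the paths without one are those coming from Pr_D; this gives bijectivity by induction. The path ends at
height 2 gamma + 1, which gives the pieces.

Odd D reduces to D + 1, which has the same N: the elements of X_D are the B in X_(D+1) from which the
pair containing N is dropped if N is not in eps B, and u_B is the former partner of N.
*)
theory Submission
  imports Defs
begin

text \<open>The bound \<open>2 * depth + 1\<close> is sharper than a count of contributions. A
  chosen pair changes \<open>height X k\<close> by 0, or by 4 or -4 if its interval crosses into
  \<open>k\<close>, so a termwise estimate gives only 4 times the depth plus 1. The sharp bound
  comes from the recursion: an insertion at \<open>l\<close> triples the position \<open>l\<close>;
  the outer copies keep their height, and the middle one is at distance 2 from them whether or not
  the new pair is chosen, while the depth there grows by 1. The term \<open>(- 1) ^ k\<close> keeps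
  all heights odd and fixes their class modulo 4, so nothing is lost in passing to absolute values.
  As N is odd, the heights at 1 and N + 1 are opposite; hence |height| is a function on the cycle,
  and the pairs of even difference are those whose interval passes through the cut between N and 1.
  For odd D the dropped pair does not occur in the vector, so the smaller span still contains the
  element of maximal weight.\<close>

section \<open>Sums and spans of pairwise disjoint pairs\<close>

lemma mem_vsum:
  assumes "finite A"
  shows "x \<in> vsum f A \<longleftrightarrow> odd (card {a \<in> A. x \<in> f a})"
  using assms
proof (induction A rule: finite_induct)
  case empty
  then show ?case by (simp add: vsum_def)
next
  case (insert a A)
  have eq: "{b \<in> insert a A. x \<in> f b} =
      (if x \<in> f a then insert a {b \<in> A. x \<in> f b} else {b \<in> A. x \<in> f b})"
    by auto
  have "vsum f (insert a A) = vadd (f a) (vsum f A)"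
    using insert.hyps by (simp add: vsum_def)
  then have "x \<in> vsum f (insert a A) \<longleftrightarrow> (x \<in> f a \<longleftrightarrow> x \<notin> vsum f A)"
    by (auto simp: vadd_def)
  then show ?case
    unfolding eq using insert.hyps insert.IH by simp
qed

text \<open>Disjointness makes a sum of members equal to their union, and the symmetric difference
  of two such unions is the union over the symmetric difference of the subfamilies. So the unions
  already form a subspace.\<close>

lemma vspan_disjoint:
  assumes "finite B" "pairwise disjnt B"
  shows "vspan B = Union ` Pow B"
proof
  have sym_diff: "vadd (\<Union>P) (\<Union>Q) = \<Union>((P - Q) \<union> (Q - P))" if "P \<subseteq> B" "Q \<subseteq> B" for P Q
  proof -
    have uniq: "p = q" if "p \<in> P \<union> Q" "q \<in> P \<union> Q" "x \<in> p" "x \<in> q" for p q x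
    proof -
      have "p \<in> B" "q \<in> B" using that(1,2) \<open>P \<subseteq> B\<close> \<open>Q \<subseteq> B\<close> by auto
      then show ?thesis using assms(2) that(3,4) by (auto simp: pairwise_def disjnt_def)
    qed
    show ?thesis
    proof (rule set_eqI)
      fix x
      show "x \<in> vadd (\<Union>P) (\<Union>Q) \<longleftrightarrow> x \<in> \<Union>((P - Q) \<union> (Q - P))"
      proof (cases "\<exists>p \<in> P \<union> Q. x \<in> p")
        case True
        then obtain p where p: "p \<in> P \<union> Q" "x \<in> p" by blast
        then have "x \<in> \<Union>S \<longleftrightarrow> p \<in> S" if "S \<subseteq> P \<union> Q" for S
          using uniq that by blast
        from this[of P] this[of Q] this[of "(P - Q) \<union> (Q - P)"] show ?thesis
          by (auto simp: vadd_def)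
      qed (auto simp: vadd_def)
    qed
  qed
  have "vsubspace (Union ` Pow B)"
    unfolding vsubspace_def
  proof (intro conjI ballI allI)
    show "{} \<in> Union ` Pow B" by blast
    fix X Y assume "X \<in> Union ` Pow B" "Y \<in> Union ` Pow B"
    then obtain P Q where PQ: "P \<subseteq> B" "Q \<subseteq> B" and XY: "X = \<Union>P" "Y = \<Union>Q"
      by blast
    show "vadd X Y \<in> Union ` Pow B"
      unfolding XY sym_diff[OF PQ] using PQ by (intro imageI) auto
  next
    fix c X assume "X \<in> Union ` Pow B"
    then show "vscale c X \<in> Union ` Pow B" by (auto simp: vscale_def)
  qed
  moreover have "p \<in> Union ` Pow B" if "p \<in> B" for p
    using that by (intro image_eqI[of _ _ "{p}"]) auto
  ultimately show "vspan B \<subseteq> Union ` Pow B"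
    unfolding vspan_def by (intro hull_minimal subsetI)
next
  have "\<Union>P \<in> V" if "finite P" "P \<subseteq> B" "vsubspace V" "B \<subseteq> V" for P V
    using that
  proof (induction P rule: finite_induct)
    case empty
    then show ?case by (simp add: vsubspace_def)
  next
    case (insert p P)
    have "p \<inter> \<Union>P = {}"
      using insert.hyps insert.prems(1) assms(2)
      by (force simp: pairwise_def disjnt_def)
    then have "\<Union>(insert p P) = vadd p (\<Union>P)" by (auto simp: vadd_def)
    then show ?case using insert unfolding vsubspace_def by auto
  qed
  then show "Union ` Pow B \<subseteq> vspan B"
    unfolding vspan_def hull_def using assms(1) by (auto intro: finite_subset)
qed

lemma PP_D:
  assumes "B \<in> PP N"
  shows "finite B" "pairwise disjnt B" "B \<subseteq> E2 N"
proof -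
  have "finite (E2 N)" by (rule finite_subset[of _ "Pow {1..N}"]) (auto simp: E2_def)
  then show "finite B" "pairwise disjnt B" "B \<subseteq> E2 N"
    using assms finite_subset by (auto simp: PP_def)
qed

lemma PP_unique:
  assumes "B \<in> PP N" "p \<in> B" "q \<in> B" "x \<in> p" "x \<in> q"
  shows "p = q"
  using PP_D(2)[OF assms(1)] assms by (auto simp: pairwise_def disjnt_def)

lemma E2_cases:
  assumes "p \<in> E2 N"
  obtains a b where "p = {a, b}" "a < b" "1 \<le> a" "b \<le> N"
proof -
  obtain x y where xy: "p = {x, y}" "x \<noteq> y" using assms by (auto simp: E2_def card_2_iff)
  then have "{x, y} \<subseteq> {1..N}" using assms by (simp add: E2_def)
  then have "x < y \<Longrightarrow> ?thesis" "y < x \<Longrightarrow> ?thesis"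
    using xy that[of x y] that[of y x] by auto
  then show ?thesis using xy(2) by linarith
qed

lemma EE_finite: "X \<in> EE N \<Longrightarrow> finite X"
  by (auto simp: EE_def intro: finite_subset)

lemma vspan_PP: "B \<in> PP N \<Longrightarrow> vspan B = Union ` Pow B"
  by (simp add: PP_D vspan_disjoint)

lemma Union_in_EE:
  assumes "B \<in> PP N" "P \<subseteq> B"
  shows "\<Union>P \<in> EE N"
proof -
  have fin: "finite P" and sub: "P \<subseteq> E2 N" using assms PP_D finite_subset by blast+
  have "card (\<Union>P) = sum card P"
  proof (rule card_Union_disjoint)
    show "pairwise disjnt P" using pairwise_subset[OF PP_D(2)[OF assms(1)] assms(2)] .
    show "finite p" if "p \<in> P" for p
      using that sub finite_subset[of p "{1..N}"] by (auto simp: E2_def)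
  qed
  also have "\<dots> = 2 * card P" using sub by (auto simp: E2_def subset_iff)
  finally show ?thesis using sub by (auto simp: EE_def E2_def)
qed

text \<open>\<open>covers p k\<close>: the interval \<open>floor2 N p\<close> of the cycle contains the step from \<open>k - 1\<close> to \<open>k\<close>.\<close>

definition covers :: "nat set \<Rightarrow> nat \<Rightarrow> bool" where
  "covers p k \<longleftrightarrow> (odd (Max p - Min p) \<longleftrightarrow> Min p < k \<and> k \<le> Max p)"

definition depth :: "nat set set \<Rightarrow> nat \<Rightarrow> nat" where
  "depth B k = card {p \<in> B. covers p k}"

lemma covers_pair:
  assumes "a < b"
  shows "covers {a, b} k \<longleftrightarrow> (odd (b - a) \<longleftrightarrow> a < k \<and> k \<le> b)"
  using assms by (simp add: covers_def max_def min_def)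

lemma first_second_pair:
  fixes a b :: nat
  assumes "a < b"
  shows "first {a, b} = (if odd (b - a) then a else b)" "second {a, b} = (if odd (b - a) then b else a)"
  using assms by (auto simp: first_def second_def max_def min_def)

text \<open>\<open>covers\<close> speaks of steps and therefore misses exactly the first endpoint of
  the interval; membership in \<open>p\<close> adds it.\<close>

lemma floor2_conv_covers:
  assumes "p \<in> E2 N"
  shows "floor2 N p = {x \<in> {1..N}. x \<in> p \<or> covers p x}"
proof -
  obtain a b where "p = {a, b}" "a < b" "1 \<le> a" "b \<le> N" using assms by (rule E2_cases)
  then show ?thesis by (auto simp: floor2_def first_second_pair covers_pair split: if_splits)
qed

lemma odd_part_pair:
  assumes "p \<in> E2 N"
  shows "odd (int (first p) - int (second p)) \<longleftrightarrow> odd (Max p - Min p)"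
proof -
  obtain a b where "p = {a, b}" "a < b" using assms by (rule E2_cases)
  then show ?thesis by (auto simp: first_second_pair max_def min_def of_nat_diff)
qed


lemma odd_part_PP: "B \<in> PP N \<Longrightarrow> odd_part B = {p \<in> B. odd (Max p - Min p)}"
  using PP_D(3) odd_part_pair by (fastforce simp: odd_part_def)

lemma even_part_PP: "B \<in> PP N \<Longrightarrow> even_part B = {p \<in> B. even (Max p - Min p)}"
  using PP_D(3) odd_part_pair by (fastforce simp: even_part_def)

section \<open>Insertion of a pair of neighbours\<close>

text \<open>Removing \<open>l\<close> and \<open>l + 1\<close> identifies the steps into \<open>l\<close>, \<open>l + 1\<close> and \<open>l + 2\<close>.\<close>

definition collapse :: "nat \<Rightarrow> nat \<Rightarrow> nat" where
  "collapse l k = (if k \<le> l then k else if k = l + 1 then l else k - 2)"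

text \<open>\<open>collapse l\<close> is adjoint to \<open>iota l\<close>. Depths and signed sums
  see a point only through its parity and its comparison with \<open>k\<close>, so this equivalence
  transports both through an insertion.\<close>

lemma iota_less_iff: "iota l x < k \<longleftrightarrow> x < collapse l k"
  by (auto simp: iota_def collapse_def)

lemma iota_ge_iff: "k \<le> iota l x \<longleftrightarrow> collapse l k \<le> x"
  by (metis iota_less_iff linorder_not_less)

lemma strict_mono_iota: "strict_mono (iota l)"
  by (auto simp: strict_mono_def iota_def)

lemma inj_iota: "inj (iota l)"
  by (rule strict_mono_imp_inj_on[OF strict_mono_iota])

lemma even_iota [simp]: "even (iota l x) \<longleftrightarrow> even x"
  by (auto simp: iota_def)

lemma iota_neq [simp]: "iota l x \<noteq> l" "iota l x \<noteq> Suc l" "l \<noteq> iota l x" "Suc l \<noteq> iota l x"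
  by (auto simp: iota_def)

lemma collapse_iota [simp]: "collapse l (iota l x) = x"
  by (auto simp: iota_def collapse_def)

lemma collapse_self [simp]: "collapse l l = l" "collapse l (Suc l) = l"
  by (auto simp: collapse_def)

lemma not_new_iff_iota: "x \<noteq> l \<and> x \<noteq> Suc l \<longleftrightarrow> (\<exists>y. x = iota l y)"
proof
  assume "x \<noteq> l \<and> x \<noteq> Suc l"
  then have "x = iota l (collapse l x)" by (auto simp: iota_def collapse_def)
  then show "\<exists>y. x = iota l y" ..
qed auto

lemma covers_iota:
  assumes "p \<in> E2 N"
  shows "covers (iota l ` p) k \<longleftrightarrow> covers p (collapse l k)"
    and "odd (Max (iota l ` p) - Min (iota l ` p)) \<longleftrightarrow> odd (Max p - Min p)"
proof -
  obtain a b where p: "p = {a, b}" "a < b" using assms by (rule E2_cases)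
  have lt: "iota l a < iota l b" using p(2) strict_mono_iota by (simp add: strict_mono_def)
  have par: "odd (iota l b - iota l a) \<longleftrightarrow> odd (b - a)"
    using lt p(2) by (simp add: even_diff_nat)
  show "odd (Max (iota l ` p) - Min (iota l ` p)) \<longleftrightarrow> odd (Max p - Min p)"
    using par p lt by (simp add: max_def min_def)
  show "covers (iota l ` p) k \<longleftrightarrow> covers p (collapse l k)"
    using p lt by (simp add: covers_pair par iota_less_iff iota_ge_iff)
qed

lemma covers_new: "covers {l, Suc l} k \<longleftrightarrow> k = Suc l"
  by (auto simp: covers_pair)

lemma not_new_mem_iota_image: "l \<notin> iota l ` p" "Suc l \<notin> iota l ` p"
  by auto

lemma new_notin_image: "{l, Suc l} \<notin> (\<lambda>p. iota l ` p) ` B"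
  using not_new_mem_iota_image[of l] by (metis imageE insertI1)

lemma inj_on_iota_image: "inj_on (\<lambda>p. iota l ` p) B"
  using inj_iota by (auto simp: inj_on_def inj_image_eq_iff)

lemma II_alt: "II l B = insert {l, Suc l} ((\<lambda>p. iota l ` p) ` B)"
  by (simp add: II_def)

text \<open>The predicate is arbitrary because two counts use it: the depth, and the number of
  intervals containing a point.\<close>

lemma card_filter_II:
  assumes "B \<in> PP N"
  shows "card {p \<in> II l B. Q p} = card {p \<in> B. Q (iota l ` p)} + (if Q {l, Suc l} then 1 else 0)"
proof -
  have "card {p \<in> (\<lambda>p. iota l ` p) ` B. Q p} = card ((\<lambda>p. iota l ` p) ` {p \<in> B. Q (iota l ` p)})"
    by (rule arg_cong[of _ _ card]) auto
  also have "\<dots> = card {p \<in> B. Q (iota l ` p)}"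
    by (intro card_image inj_on_iota_image)
  finally have img: "card {p \<in> (\<lambda>p. iota l ` p) ` B. Q p} = card {p \<in> B. Q (iota l ` p)}" .
  have eq: "{p \<in> II l B. Q p} = (if Q {l, Suc l}
      then insert {l, Suc l} {p \<in> (\<lambda>p. iota l ` p) ` B. Q p} else {p \<in> (\<lambda>p. iota l ` p) ` B. Q p})"
    by (auto simp: II_alt)
  show ?thesis
    using img new_notin_image[of l B] PP_D(1)[OF assms] by (simp add: eq)
qed

lemma depth_II:
  assumes "B \<in> PP N"
  shows "depth (II l B) k = depth B (collapse l k) + (if k = Suc l then 1 else 0)"
proof -
  have "{p \<in> B. covers (iota l ` p) k} = {p \<in> B. covers p (collapse l k)}"
    using covers_iota(1) PP_D(3)[OF assms] by auto
  then show ?thesis using card_filter_II[OF assms] by (simp add: depth_def covers_new)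
qed

text \<open>Used to make a prescribed insertion the outermost one and, for odd \<open>D\<close>, to
  move an insertion at the last place inwards.\<close>

lemma II_commute:
  assumes "l + 2 \<le> m"
  shows "II m (II l B) = II l (II (m - 2) B)"
proof -
  have "iota m (iota l x) = iota l (iota (m - 2) x)" for x
    using assms by (auto simp: iota_def)
  moreover have "iota m l = l" "iota m (Suc l) = Suc l"
    "iota l (m - 2) = m" "iota l (Suc (m - 2)) = Suc m"
    using assms by (auto simp: iota_def)
  ultimately show ?thesis by (auto simp: II_alt image_image insert_commute)
qed

section \<open>The even case: recursive structure\<close>

lemma nest_empty [simp]: "nest c 1 0 = {}" "nest c (Suc 0) 0 = {}"
  by (simp_all add: nest_def)

text \<open>The two families of the definition are the nests with an even and with an odd number of
  pairs; indexing by the number of pairs merges them.\<close>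

lemma Pr_even:
  assumes "even D"
  shows "Pr D = (\<lambda>n. nest (D + 2) 1 n) ` {..D div 2}"
proof (cases "D = 0")
  case True
  then show ?thesis by (simp add: Pr_def)
next
  case False
  have A: "{nest (D + 2) 1 t | t. even t \<and> t \<in> {2..D div 2}}
      = (\<lambda>n. nest (D + 2) 1 n) ` {n. even n \<and> 0 < n \<and> n \<le> D div 2}"
    by (force elim!: evenE)
  have B: "{nest (D + 2) 1 (t - 1) | t. even t \<and> t \<in> {2..(D + 2) div 2}}
      = (\<lambda>n. nest (D + 2) 1 n) ` {n. odd n \<and> n \<le> D div 2}" (is "?L = ?R")
  proof
    show "?L \<subseteq> ?R" by (force elim!: evenE)
    show "?R \<subseteq> ?L"
    proof
      fix S assume "S \<in> ?R"
      then obtain n where "S = nest (D + 2) 1 n" "odd n" "n \<le> D div 2" by auto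
      then show "S \<in> ?L" by (auto intro!: exI[of _ "Suc n"] elim: oddE)
    qed
  qed
  have "{..D div 2} = {0} \<union> {n. even n \<and> 0 < n \<and> n \<le> D div 2} \<union> {n. odd n \<and> n \<le> D div 2}"
    by auto
  then show ?thesis
    using False assms unfolding Pr_def A B by (simp add: image_Un)
qed

lemma XX_Suc_Suc: "XX (D + 2) = Pr (D + 2) \<union> (\<Union>k\<in>{1..D + 2}. II k ` XX D)"
  by simp

lemma XX_even_cases:
  assumes "B \<in> XX D" "even D"
  obtains (nest) n where "n \<le> D div 2" "B = nest (D + 2) 1 n"
  | (insert) D' k B' where "D = D' + 2" "even D'" "B' \<in> XX D'" "k \<in> {1..D' + 2}" "B = II k B'"
proof (cases "B \<in> Pr D")
  case True
  then show ?thesis using Pr_even[OF assms(2)] nest by auto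
next
  case False
  moreover have "B \<in> Pr D" if "D = 0" using that assms(1) by (simp add: Pr_def)
  ultimately have "D \<noteq> 0" by blast
  then obtain D' where D': "D = D' + 2"
    using assms(2) by (metis One_nat_def add_2_eq_Suc' even_Suc nat.exhaust numeral_2_eq_2 odd_one)
  then obtain k B' where "k \<in> {1..D' + 2}" "B' \<in> XX D'" "B = II k B'"
    using False assms(1) unfolding XX_Suc_Suc D' by blast
  then show ?thesis using insert[of D'] D' assms(2) by simp
qed

lemma XX_even_induct [consumes 2, case_names nest insert]:
  assumes "B \<in> XX D" "even D"
    and nest: "\<And>D n. even D \<Longrightarrow> n \<le> D div 2 \<Longrightarrow> P D (nest (D + 2) 1 n)"
    and insert: "\<And>D k B. even D \<Longrightarrow> B \<in> XX D \<Longrightarrow> k \<in> {1..D + 2} \<Longrightarrow> P D B \<Longrightarrow> P (D + 2) (II k B)"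
  shows "P D B"
  using assms(1,2)
proof (induction D arbitrary: B rule: less_induct)
  case (less D)
  from less.prems show ?case
  proof (cases rule: XX_even_cases)
    case (nest n)
    then show ?thesis using assms(3) less.prems by blast
  next
    case (insert D' k B')
    then show ?thesis using assms(4)[of D' B' k] less.IH[of D' B'] by simp
  qed
qed

lemma nest_in_XX: "even D \<Longrightarrow> n \<le> D div 2 \<Longrightarrow> nest (D + 2) 1 n \<in> XX D"
  using Pr_even[of D] by (cases D rule: XX.cases) (auto simp: Pr_def)

lemma II_in_XX: "B \<in> XX D \<Longrightarrow> k \<in> {1..D + 2} \<Longrightarrow> II k B \<in> XX (D + 2)"
  unfolding XX_Suc_Suc by blast

lemma XX_even_PP: "even D \<Longrightarrow> B \<in> XX D \<Longrightarrow> B \<in> PP (D + 1)"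
  using XX_subset_PP[of D] by (auto simp: NN_def)

section \<open>Centred heights\<close>

text \<open>Read \<open>X \<subseteq> {1..N}\<close>, \<open>N\<close> odd, as a path from 0 whose step \<open>x\<close> goes up iff
  \<open>even x \<longleftrightarrow> x \<in> X\<close>. Then \<open>height X k\<close> is twice the height reached after \<open>k - 1\<close> steps minus the
  final height.\<close>

definition signed_sum :: "nat set \<Rightarrow> nat \<Rightarrow> int" where
  "signed_sum X k = (\<Sum>x\<in>X. (if x < k then 1 else - 1) * (- 1) ^ x)"

definition height :: "nat set \<Rightarrow> nat \<Rightarrow> int" where
  "height X k = 2 * signed_sum X k + (- 1) ^ k"

lemma minus_one_power_cases: "(- 1 :: int) ^ k = (if even k then 1 else - 1)"
  by simp

lemma signed_sum_Suc:
  assumes "finite X"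
  shows "signed_sum X (Suc k) = signed_sum X k + (if k \<in> X then 2 * (- 1) ^ k else 0)"
proof -
  have "signed_sum X (Suc k) - signed_sum X k
      = (\<Sum>x\<in>X. ((if x < Suc k then 1 else - 1) - (if x < k then 1 else - 1)) * (- 1) ^ x)"
    by (simp add: signed_sum_def sum_subtractf left_diff_distrib)
  also have "\<dots> = (\<Sum>x\<in>X. if x = k then 2 * (- 1) ^ k else 0)"
    by (rule sum.cong) auto
  also have "\<dots> = (if k \<in> X then 2 * (- 1) ^ k else 0)"
    using assms by simp
  finally show ?thesis by simp
qed

lemma height_Suc:
  assumes "finite X"
  shows "height X (Suc k) = height X k + 2 * (- 1) ^ k * (if k \<in> X then 1 else - 1)"
  using assms by (simp add: height_def signed_sum_Suc)

lemma height_step: "finite X \<Longrightarrow> \<bar>height X (Suc k) - height X k\<bar> = 2"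
  by (simp add: height_Suc abs_mult)

lemma signed_sum_Un:
  assumes "finite X" "finite Y" "X \<inter> Y = {}"
  shows "signed_sum (X \<union> Y) k = signed_sum X k + signed_sum Y k"
  using assms by (simp add: signed_sum_def sum.union_disjoint)

lemma signed_sum_iota: "signed_sum (iota l ` X) k = signed_sum X (collapse l k)"
proof -
  have "(- 1 :: int) ^ iota l x = (- 1) ^ x" for x
    by (simp add: minus_one_power_cases)
  then show ?thesis
    by (simp add: signed_sum_def sum.reindex[OF inj_on_subset[OF inj_iota subset_UNIV]]
        iota_less_iff)
qed

lemma signed_sum_new: "signed_sum {l, Suc l} k = (if k = Suc l then 2 * (- 1) ^ l else 0)"
  by (auto simp: signed_sum_def)

lemma even_collapse: "k \<noteq> Suc l \<Longrightarrow> even (collapse l k) \<longleftrightarrow> even k"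
  by (auto simp: collapse_def)

text \<open>The middle position has the other parity than \<open>l\<close>. Omitting the new pair
  leaves the signed sum alone, and the flipped term \<open>(- 1) ^ k\<close> moves the height by 2;
  including the pair (\<open>height_iota_new\<close>) adds 4 in the opposite direction, a net move
  by 2 the other way.\<close>

lemma height_iota:
  "height (iota l ` X) k = (if k = Suc l then height X l - 2 * (- 1) ^ l else height X (collapse l k))"
  by (auto simp: height_def signed_sum_iota minus_one_power_cases even_collapse)

lemma height_iota_new:
  assumes "finite X"
  shows "height (iota l ` X \<union> {l, Suc l}) k
    = (if k = Suc l then height X l + 2 * (- 1) ^ l else height X (collapse l k))"
proof -
  have "signed_sum (iota l ` X \<union> {l, Suc l}) k = signed_sum (iota l ` X) k + signed_sum {l, Suc l} k"
    using assms by (intro signed_sum_Un) auto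
  then show ?thesis
    by (auto simp: height_def signed_sum_iota signed_sum_new minus_one_power_cases even_collapse)
qed

lemma even_signed_sum: "even (signed_sum X k) \<longleftrightarrow> even (card X)" if "finite X"
proof -
  have "even (signed_sum X k) \<longleftrightarrow> even (card {x \<in> X. odd ((if x < k then 1 else - 1) * (- 1 :: int) ^ x)})"
    unfolding signed_sum_def using that by (rule even_sum_iff)
  also have "{x \<in> X. odd ((if x < k then 1 else - 1) * (- 1 :: int) ^ x)} = X" by auto
  finally show ?thesis .
qed

lemma height_mod4:
  assumes "finite X" "even (card X)"
  shows "4 dvd height X k - (- 1) ^ k"
  using even_signed_sum[OF assms(1), of k] assms(2) by (auto simp: height_def elim: evenE)

lemma odd_height: "odd (height X k)"
  by (simp add: height_def)

text \<open>The class of \<open>height X k\<close> modulo 4 is known, so its sign can be recovered from its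
  absolute value.\<close>

lemma height_eqI:
  assumes X: "finite X" "even (card X)" and Y: "finite Y" "even (card Y)"
    and "\<bar>height X k\<bar> = \<bar>height Y k\<bar>"
  shows "height X k = height Y k"
proof (rule ccontr)
  assume "height X k \<noteq> height Y k"
  then have "height Y k = - height X k" using assms(5) by linarith
  then have "4 dvd 2 * height X k"
    using dvd_diff[OF height_mod4[OF X, of k] height_mod4[OF Y, of k]] by simp
  then show False using odd_height[of X k] by presburger
qed

text \<open>By \<open>height_eqI\<close> the heights themselves agree, and the step from
  \<open>k\<close> to \<open>k + 1\<close> tells whether \<open>k\<close> is in the set; N steps
  need N + 1 positions.\<close>

lemma EE_eqI:
  assumes X: "X \<in> EE N" and Y: "Y \<in> EE N"
    and eq: "\<And>k. k \<in> {1..N + 1} \<Longrightarrow> \<bar>height X k\<bar> = \<bar>height Y k\<bar>"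
  shows "X = Y"
proof -
  have fin: "finite X" "finite Y" "even (card X)" "even (card Y)"
    using EE_finite[OF X] EE_finite[OF Y] X Y by (auto simp: EE_def)
  have h: "height X k = height Y k" if "k \<in> {1..N + 1}" for k
    using height_eqI fin eq[OF that] by blast
  have "k \<in> X \<longleftrightarrow> k \<in> Y" if "k \<in> {1..N}" for k
  proof -
    have "2 * (- 1) ^ k * (if k \<in> X then 1 else - 1 :: int) = 2 * (- 1) ^ k * (if k \<in> Y then 1 else - 1)"
      using h[of k] h[of "Suc k"] that height_Suc[OF fin(1), of k] height_Suc[OF fin(2), of k]
      by simp
    then have "(if k \<in> X then 1 else - 1 :: int) = (if k \<in> Y then 1 else - 1)"
      by (subst (asm) mult_cancel_left) simp
    then show ?thesis by (metis one_neq_neg_one)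
  qed
  moreover have "X \<subseteq> {1..N}" "Y \<subseteq> {1..N}" using X Y by (auto simp: EE_def)
  ultimately show ?thesis by blast
qed

lemma signed_sum_gamma:
  assumes "X \<subseteq> {1..N}"
  shows "signed_sum X (Suc N) = gamma X" "signed_sum X 1 = - gamma X"
proof -
  have fin: "finite X" using assms finite_subset by blast
  have split: "X = {x \<in> X. even x} \<union> {x \<in> X. odd x}" by blast
  have E: "(\<Sum>x\<in>X. (- 1) ^ x) = gamma X"
    unfolding gamma_def by (subst split, subst sum.union_disjoint) (use fin in auto)
  have "signed_sum X (Suc N) = (\<Sum>x\<in>X. (- 1) ^ x)" "signed_sum X 1 = (\<Sum>x\<in>X. - ((- 1) ^ x))"
    unfolding signed_sum_def using assms by (auto intro!: sum.cong)
  then show "signed_sum X (Suc N) = gamma X" "signed_sum X 1 = - gamma X"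
    by (simp_all add: E sum_negf)
qed

text \<open>Odd \<open>N\<close> gives the correction terms at the two ends opposite signs, as the
  signed sums have already; thus |height| agrees on both sides of the cut.\<close>

lemma height_ends:
  assumes "X \<in> EE N" "odd N"
  shows "height X 1 = - (2 * gamma X + 1)" "height X (Suc N) = 2 * gamma X + 1"
  using assms signed_sum_gamma[of X N] by (auto simp: height_def EE_def)

lemma even_gamma:
  assumes "X \<in> EE N"
  shows "even (gamma X)"
  using assms signed_sum_gamma(1)[of X N] even_signed_sum[of X "Suc N"] EE_finite[OF assms]
  by (auto simp: EE_def)

text \<open>The endpoints either lie on the same side of \<open>k\<close> with opposite parities or
  on different sides with equal parity; both times the two terms cancel.\<close>

lemma signed_sum_uncovered:
  assumes "p \<in> E2 N" "\<not> covers p k"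
  shows "signed_sum p k = 0"
proof -
  obtain a b where p: "p = {a, b}" "a < b" using assms(1) by (rule E2_cases)
  then have "even (b - a) \<longleftrightarrow> (even a \<longleftrightarrow> even b)" by (auto simp: even_diff_nat)
  then show ?thesis using assms(2) p
    by (auto simp: signed_sum_def covers_pair minus_one_power_cases)
qed

lemma signed_sum_vspan:
  assumes "B \<in> PP N" "X \<in> vspan B" "depth B k = 0"
  shows "signed_sum X k = 0"
proof -
  obtain P where P: "P \<subseteq> B" "X = \<Union>P" using assms vspan_PP by auto
  have sub: "P \<subseteq> E2 N" and fin: "finite P" using P PP_D[OF assms(1)] finite_subset by blast+
  have disj: "pairwise disjnt P" using pairwise_subset[OF PP_D(2)[OF assms(1)] P(1)] .
  have "signed_sum X k = sum (\<lambda>p. signed_sum p k) P"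
    unfolding signed_sum_def P(2)
  proof (rule sum.Union_disjoint[unfolded comp_def])
    show "\<forall>p\<in>P. finite p"
      using sub finite_subset[of _ "{1..N}"] by (auto simp: E2_def)
    show "\<forall>p\<in>P. \<forall>q\<in>P. p \<noteq> q \<longrightarrow> p \<inter> q = {}"
      using disj by (auto simp: pairwise_def disjnt_def)
  qed
  also have "\<dots> = 0"
  proof (rule sum.neutral, rule ballI)
    fix p assume "p \<in> P"
    moreover have "\<not> covers p k"
      using assms(3) P(1) \<open>p \<in> P\<close> PP_D(1)[OF assms(1)] by (auto simp: depth_def)
    ultimately show "signed_sum p k = 0" using sub signed_sum_uncovered by blast
  qed
  finally show ?thesis .
qed

section \<open>Structure of the even collections\<close>

lemma pair_conv_nest:
  assumes "r < c - r"
  shows "covers {c - r, r} k \<longleftrightarrow> (odd c \<longleftrightarrow> r < k \<and> k \<le> c - r)"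
proof -
  have "odd (c - r - r) \<longleftrightarrow> odd c" using assms by (simp add: even_diff_nat) presburger
  then show ?thesis using covers_pair[OF assms, of k] by (simp add: insert_commute)
qed

lemma nest_inj: "2 * (n :: nat) < c \<Longrightarrow> inj_on (\<lambda>r. {c - r, r}) {1..n}"
  by (auto simp: inj_on_def doubleton_eq_iff)

lemma card_filter_nest:
  assumes "2 * n < c"
  shows "card {p \<in> nest c 1 n. Q p} = card {r \<in> {1..n}. Q {c - r, r}}"
proof -
  have "{p \<in> nest c 1 n. Q p} = (\<lambda>r. {c - r, r}) ` {r \<in> {1..n}. Q {c - r, r}}"
    by (auto simp: nest_def)
  moreover have "inj_on (\<lambda>r. {c - r, r}) {r \<in> {1..n}. Q {c - r, r}}"
    by (rule inj_on_subset[OF nest_inj[OF assms]]) auto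
  ultimately show ?thesis by (simp only: card_image)
qed

text \<open>The truncated differences are the two flanks of a valley n, n-1, ..., 0, ..., 0, 1, ...,
  n; at most one of them is nonzero at a given \<open>k\<close>.\<close>

lemma depth_nest:
  assumes "even D" "n \<le> D div 2" "1 \<le> k" "k \<le> D + 2"
  shows "depth (nest (D + 2) 1 n) k = (n + 1 - k) + (k + n - (D + 2))"
proof -
  have "{r \<in> {1..n}. covers {D + 2 - r, r} k} = {k..n} \<union> {D + 3 - k..n}"
    using assms by (auto simp: pair_conv_nest)
  then have "depth (nest (D + 2) 1 n) k = card ({k..n} \<union> {D + 3 - k..n})"
    unfolding depth_def using assms by (subst card_filter_nest) auto
  also have "\<dots> = (n + 1 - k) + (k + n - (D + 2))"
  proof (cases "k \<le> n")
    case True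
    then have "{k..n} \<union> {D + 3 - k..n} = {k..n}" using assms by auto
    then show ?thesis using True assms by simp
  next
    case False
    then have "{k..n} \<union> {D + 3 - k..n} = {D + 3 - k..n}" using assms by auto
    then show ?thesis using False assms by simp
  qed
  finally show ?thesis .
qed

text \<open>The arcs on the cycle do not cross, their intervals contain only paired points, and no
  endpoint of an even pair lies inside an odd interval. The first two clauses put the sum of the
  intervals into the span; the third one locates \<open>u_of\<close> relative to the even part when
  \<open>D\<close> is odd.\<close>

definition laminar :: "nat \<Rightarrow> nat set set \<Rightarrow> bool" where
  "laminar N B \<longleftrightarrow>
     (\<forall>p\<in>B. \<forall>q\<in>B. p \<noteq> q \<longrightarrow> (\<forall>x\<in>p. \<forall>y\<in>p. covers q x \<longleftrightarrow> covers q y)) \<and>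
     (\<forall>q\<in>B. \<forall>x\<in>{1..N}. covers q x \<longrightarrow> x \<in> supp B) \<and>
     (\<forall>p\<in>B. \<forall>q\<in>B. even (Max p - Min p) \<longrightarrow> odd (Max q - Min q) \<longrightarrow> (\<forall>x\<in>p. \<not> covers q x))"

lemma nest_PP: "even D \<Longrightarrow> n \<le> D div 2 \<Longrightarrow> nest (D + 2) 1 n \<in> PP (D + 1)"
  by (rule nest_in_PP) auto

lemma even_pair_nest:
  fixes c r :: nat
  assumes "r < c - r" "even c"
  shows "even (Max {c - r, r} - Min {c - r, r})"
proof -
  have "c - r - r = c - 2 * r" by simp
  then have "even (c - r - r)" using assms by simp
  then show ?thesis using assms(1) by (simp add: max_def min_def)
qed

lemma laminar_nest:
  assumes "even D" "n \<le> D div 2"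
  shows "laminar (D + 1) (nest (D + 2) 1 n)"
proof -
  have sup: "supp (nest (D + 2) 1 n) = {1..n} \<union> {D + 2 - n..D + 1}"
  proof
    show "supp (nest (D + 2) 1 n) \<subseteq> {1..n} \<union> {D + 2 - n..D + 1}"
      using assms by (auto simp: supp_def nest_def)
    show "{1..n} \<union> {D + 2 - n..D + 1} \<subseteq> supp (nest (D + 2) 1 n)"
    proof
      fix x assume "x \<in> {1..n} \<union> {D + 2 - n..D + 1}"
      then have "x \<in> {D + 2 - r, r} \<and> r \<in> {1..n}"
        if "r = (if x \<le> n then x else D + 2 - x)" for r
        using that assms by auto
      then show "x \<in> supp (nest (D + 2) 1 n)" unfolding supp_def nest_def by blast
    qed
  qed
  have ev: "even (Max p - Min p)" if p: "p \<in> nest (D + 2) 1 n" for p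
  proof -
    obtain r where r: "r \<in> {1..n}" "p = {D + 2 - r, r}" using p unfolding nest_def by blast
    then have "r < D + 2 - r" using assms by auto
    then show ?thesis unfolding r(2) by (rule even_pair_nest) (use assms in simp)
  qed
  have cov: "covers {D + 2 - r, r} k \<longleftrightarrow> k \<le> r \<or> D + 2 - r < k" if "r \<in> {1..n}" for r k
    using that assms by (subst pair_conv_nest) auto
  have "covers q x \<longleftrightarrow> covers q y"
    if "p \<in> nest (D + 2) 1 n" "q \<in> nest (D + 2) 1 n" "p \<noteq> q" "x \<in> p" "y \<in> p" for p q x y
  proof -
    obtain r s where rs: "p = {D + 2 - r, r}" "q = {D + 2 - s, s}" "r \<in> {1..n}" "s \<in> {1..n}"
      using \<open>p \<in> _\<close> \<open>q \<in> _\<close> unfolding nest_def by blast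
    have "r \<noteq> s" using rs \<open>p \<noteq> q\<close> by blast
    moreover have "x = r \<or> x = D + 2 - r" "y = r \<or> y = D + 2 - r" using that(4,5) rs(1) by auto
    moreover have "2 * r < D + 2" "2 * s < D + 2" using rs assms by auto
    ultimately show ?thesis unfolding rs(2) cov[OF rs(4)] by linarith
  qed
  moreover have "x \<in> supp (nest (D + 2) 1 n)"
    if "q \<in> nest (D + 2) 1 n" "x \<in> {1..D + 1}" "covers q x" for q x
    using that cov unfolding sup by (auto simp: nest_def)
  ultimately show ?thesis unfolding laminar_def using ev by blast
qed

lemma supp_II: "supp (II l B) = insert l (insert (Suc l) (iota l ` supp B))"
  by (auto simp: supp_def II_alt)

lemma laminar_II:
  assumes "B \<in> PP N" "laminar N B" "l \<in> {1..N + 1}"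
  shows "laminar (N + 2) (II l B)"
proof -
  have cov: "covers (iota l ` q) k \<longleftrightarrow> covers q (collapse l k)"
    and par: "odd (Max (iota l ` q) - Min (iota l ` q)) \<longleftrightarrow> odd (Max q - Min q)" if "q \<in> B" for q k
    using that PP_D(3)[OF assms(1)] covers_iota by blast+
  have pn: "odd (Max {l, Suc l} - Min {l, Suc l})" by simp
  have 1: "covers q x \<longleftrightarrow> covers q y"
    if pq: "p \<in> II l B" "q \<in> II l B" "p \<noteq> q" "x \<in> p" "y \<in> p" for p q x y
  proof (cases "q = {l, Suc l}")
    case True
    then obtain p' where "p' \<in> B" "p = iota l ` p'" using pq(1,3) by (auto simp: II_alt)
    then show ?thesis using pq(4,5) True by (auto simp: covers_new)
  next
    case False
    then obtain q' where q': "q' \<in> B" "q = iota l ` q'" using pq by (auto simp: II_alt)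
    show ?thesis
    proof (cases "p = {l, Suc l}")
      case True
      \<comment> \<open>Both new points collapse to the same old position \<open>l\<close>.\<close>
      then show ?thesis using pq q' by (auto simp: cov)
    next
      case False
      then obtain p' where p': "p' \<in> B" "p = iota l ` p'" using pq by (auto simp: II_alt)
      then obtain x' y' where xy: "x = iota l x'" "y = iota l y'" "x' \<in> p'" "y' \<in> p'"
        using pq(4,5) by blast
      have "p' \<noteq> q'" using pq(3) p' q' by auto
      then have "covers q' x' \<longleftrightarrow> covers q' y'"
        using p' q' xy assms(2) unfolding laminar_def by blast
      then show ?thesis unfolding q'(2) xy cov[OF q'(1)] by simp
    qed
  qed
  have 2: "x \<in> supp (II l B)" if *: "q \<in> II l B" "x \<in> {1..N + 2}" "covers q x" for q x
  proof (cases "x = l \<or> x = Suc l \<or> q = {l, Suc l}")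
    case True
    then show ?thesis using * by (auto simp: supp_II covers_new)
  next
    case False
    then obtain q' where q': "q' \<in> B" "q = iota l ` q'" using * by (auto simp: II_alt)
    obtain y where y: "x = iota l y" using False not_new_iff_iota by blast
    have "y \<in> {1..N}" using *(2) assms(3) False y by (auto simp: iota_def split: if_splits)
    moreover have "covers q' y" using *(3) q' y by (simp add: cov)
    ultimately show ?thesis using q' y assms(2) unfolding laminar_def supp_II by blast
  qed
  have 3: "\<not> covers q x"
    if *: "p \<in> II l B" "q \<in> II l B" "even (Max p - Min p)" "odd (Max q - Min q)" "x \<in> p" for p q x
  proof -
    have "p \<noteq> {l, Suc l}" using *(3) by auto
    then obtain p' where p': "p' \<in> B" "p = iota l ` p'" using * by (auto simp: II_alt)
    then obtain y where y: "x = iota l y" "y \<in> p'" using * by auto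
    show ?thesis
    proof (cases "q = {l, Suc l}")
      case True
      then show ?thesis using y by (simp add: covers_new)
    next
      case False
      then obtain q' where q': "q' \<in> B" "q = iota l ` q'" using * by (auto simp: II_alt)
      have "even (Max p' - Min p')" "odd (Max q' - Min q')"
        using *(3,4) par p' q' by blast+
      then have "\<not> covers q' y" using p'(1) q'(1) y(2) assms(2) unfolding laminar_def by blast
      then show ?thesis unfolding q'(2) y(1) cov[OF q'(1)] by simp
    qed
  qed
  show ?thesis unfolding laminar_def using 1 2 3 by blast
qed

lemma XX_even_laminar:
  assumes "B \<in> XX D" "even D"
  shows "laminar (D + 1) B"
  using assms
proof (induction rule: XX_even_induct)
  case (nest D n)
  then show ?case by (rule laminar_nest)
next
  case (insert D k B)
  then show ?case using laminar_II[of B "D + 1" k] XX_even_PP[of D B] by simp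
qed

text \<open>\<open>i\<close> is the sequence \<open>i\<^sub>1 < \<dots> < i\<^sub>2\<^sub>n\<close> of the definition of \<open>u\<^sub>B\<close>.\<close>

definition even_nest :: "(nat \<Rightarrow> nat) \<Rightarrow> nat \<Rightarrow> nat set set \<Rightarrow> bool" where
  "even_nest i n B \<longleftrightarrow> strict_mono_on {1..2 * n} i \<and>
     even_part B = (\<lambda>r. {i (2 * n + 1 - r), i r}) ` {1..n} \<and>
     (\<forall>r\<in>{1..n}. (even (i r) \<longleftrightarrow> even r) \<and> (even (i (2 * n + 1 - r)) \<longleftrightarrow> even r))"

text \<open>The sequence lists the endpoints 1, ..., n followed by D + 2 - n, ..., D + 1. As
  \<open>D\<close> is even, the partner D + 2 - r of r has the parity of r.\<close>

lemma even_nest_nest: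
  assumes "even D" "n \<le> D div 2"
  shows "even_nest (\<lambda>r. if r \<le> n then r else D + 1 + r - 2 * n) n (nest (D + 2) 1 n)"
    (is "even_nest ?i n ?B")
proof -
  have ev: "even (Max p - Min p)" if p: "p \<in> ?B" for p
  proof -
    obtain r where r: "r \<in> {1..n}" "p = {D + 2 - r, r}" using p unfolding nest_def by blast
    then have "r < D + 2 - r" using assms by auto
    then show ?thesis unfolding r(2) by (rule even_pair_nest) (use assms in simp)
  qed
  have top: "?i (2 * n + 1 - r) = D + 2 - r" if "r \<in> {1..n}" for r
    using that assms by auto
  have "even_part ?B = ?B"
    using even_part_PP[OF nest_PP[OF assms]] ev by auto
  also have "\<dots> = (\<lambda>r. {?i (2 * n + 1 - r), ?i r}) ` {1..n}"
    unfolding nest_def by (intro image_cong refl) (use top in auto)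
  finally have 1: "even_part ?B = (\<lambda>r. {?i (2 * n + 1 - r), ?i r}) ` {1..n}" .
  have 2: "strict_mono_on {1..2 * n} ?i"
    using assms by (auto simp: strict_mono_on_def)
  have 3: "(even (?i r) \<longleftrightarrow> even r) \<and> (even (?i (2 * n + 1 - r)) \<longleftrightarrow> even r)" if "r \<in> {1..n}" for r
    unfolding top[OF that] using that assms by (auto simp: even_diff_nat)
  show ?thesis unfolding even_nest_def using 1 2 3 by blast
qed

lemma even_part_II:
  assumes "B \<in> PP N" "l \<in> {1..N + 1}"
  shows "even_part (II l B) = (\<lambda>p. iota l ` p) ` even_part B"
proof -
  have par: "odd (Max (iota l ` q) - Min (iota l ` q)) \<longleftrightarrow> odd (Max q - Min q)" if "q \<in> B" for q
    using that PP_D(3)[OF assms(1)] covers_iota by blast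
  have pn: "odd (Max {l, Suc l} - Min {l, Suc l})" by simp
  have "even_part (II l B) = {p \<in> II l B. even (Max p - Min p)}"
    using even_part_PP[OF II_in_PP[OF assms]] .
  also have "\<dots> = (\<lambda>p. iota l ` p) ` {p \<in> B. even (Max p - Min p)}"
    using par pn unfolding II_alt by blast
  finally show ?thesis using even_part_PP[OF assms(1)] by simp
qed

text \<open>The new pair has odd difference and so never enters the even part, while
  \<open>iota l\<close> keeps order and parity of the old points.\<close>

lemma even_nest_II:
  assumes "B \<in> PP N" "l \<in> {1..N + 1}" "even_nest i n B"
  shows "even_nest (iota l \<circ> i) n (II l B)"
  using assms(3) strict_mono_iota[of l]
  unfolding even_nest_def even_part_II[OF assms(1,2)]
  by (auto simp: image_image strict_mono_on_def strict_mono_def)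

lemma XX_even_nest:
  assumes "B \<in> XX D" "even D"
  shows "\<exists>i n. even_nest i n B"
  using assms
proof (induction rule: XX_even_induct)
  case (nest D n)
  then show ?case using even_nest_nest by blast
next
  case (insert D k B)
  then show ?case using even_nest_II[of B "D + 1" k] XX_even_PP[of D B] by auto
qed

lemma even_nest_card:
  assumes "even_nest i n B"
  shows "card (even_part B) = n"
proof -
  have inj: "inj_on i {1..2 * n}"
    using assms strict_mono_on_imp_inj_on by (auto simp: even_nest_def)
  have "inj_on (\<lambda>r. {i (2 * n + 1 - r), i r}) {1..n}"
  proof (rule inj_onI)
    fix r s assume rs: "r \<in> {1..n}" "s \<in> {1..n}" "{i (2 * n + 1 - r), i r} = {i (2 * n + 1 - s), i s}"
    then have "i r = i s \<or> i r = i (2 * n + 1 - s)" by (auto simp: doubleton_eq_iff)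
    then have "r = s \<or> r = 2 * n + 1 - s"
      using inj_onD[OF inj, of r s] inj_onD[OF inj, of r "2 * n + 1 - s"] rs(1,2) by fastforce
    then show "r = s" using rs(1,2) by auto
  qed
  then show ?thesis using assms by (simp add: even_nest_def card_image)
qed

section \<open>The map in the even case\<close>

abbreviation floor_sum :: "nat \<Rightarrow> nat set set \<Rightarrow> nat set" where
  "floor_sum N \<equiv> vsum (floor2 N)"

lemma eps_even: "even D \<Longrightarrow> eps D B = floor_sum (D + 1) B"
  by (simp add: eps_def underline_def vadd_def NN_def)

lemma mem_floor_sum:
  assumes "B \<in> PP N"
  shows "x \<in> floor_sum N B \<longleftrightarrow> x \<in> {1..N} \<and> odd (card {p \<in> B. x \<in> p \<or> covers p x})"
proof (cases "x \<in> {1..N}")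
  case True
  then have "{p \<in> B. x \<in> floor2 N p} = {p \<in> B. x \<in> p \<or> covers p x}"
    using PP_D(3)[OF assms] by (auto simp: floor2_conv_covers)
  then show ?thesis using True PP_D(1)[OF assms] by (simp add: mem_vsum)
next
  case False
  then have "{p \<in> B. x \<in> floor2 N p} = {}"
    using PP_D(3)[OF assms] by (auto simp: floor2_conv_covers)
  then show ?thesis using False PP_D(1)[OF assms] by (simp only: mem_vsum) simp
qed

text \<open>Each new point lies in the interval of the new pair and in \<open>depth B l\<close>
  transported intervals, whence the parity condition.\<close>

lemma floor_sum_II:
  assumes "B \<in> PP N" "l \<in> {1..N + 1}"
  shows "floor_sum (N + 2) (II l B)
    = iota l ` floor_sum N B \<union> (if even (depth B l) then {l, Suc l} else {})"
proof (rule set_eqI)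
  fix x
  have cov: "covers (iota l ` p) k \<longleftrightarrow> covers p (collapse l k)" if "p \<in> B" for p k
    using that PP_D(3)[OF assms(1)] covers_iota by blast
  have mem: "x \<in> floor_sum (N + 2) (II l B) \<longleftrightarrow>
      x \<in> {1..N + 2} \<and> odd (card {p \<in> B. x \<in> iota l ` p \<or> covers p (collapse l x)}
        + (if x = l \<or> x = Suc l then 1 else 0))"
    unfolding mem_floor_sum[OF II_in_PP[OF assms]] card_filter_II[OF assms(1)]
    using cov by (auto simp: covers_new cong: conj_cong)
  show "x \<in> floor_sum (N + 2) (II l B) \<longleftrightarrow>
      x \<in> iota l ` floor_sum N B \<union> (if even (depth B l) then {l, Suc l} else {})"
  proof (cases "x = l \<or> x = Suc l")
    case True
    then have "{p \<in> B. x \<in> iota l ` p \<or> covers p (collapse l x)} = {p \<in> B. covers p l}"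
      by auto
    then show ?thesis unfolding mem using True assms(2) by (auto simp: depth_def)
  next
    case False
    then obtain y where y: "x = iota l y" using not_new_iff_iota by blast
    have "{p \<in> B. x \<in> iota l ` p \<or> covers p (collapse l x)} = {p \<in> B. y \<in> p \<or> covers p y}"
      using y inj_iota by (auto simp: inj_def)
    moreover have "x \<in> {1..N + 2} \<longleftrightarrow> y \<in> {1..N}"
      using y assms(2) by (auto simp: iota_def split: if_splits)
    ultimately have "x \<in> floor_sum (N + 2) (II l B) \<longleftrightarrow> y \<in> floor_sum N B"
      unfolding mem mem_floor_sum[OF assms(1)] using False by simp
    moreover have "x \<in> iota l ` S \<longleftrightarrow> y \<in> S" for S
      using y inj_iota by (auto simp: inj_def)
    ultimately show ?thesis using False by simp
  qed
qed

text \<open>At an endpoint of \<open>p\<close> the pair \<open>p\<close> itself counts once, and by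
  noncrossing every other interval contains both endpoints or neither. So the sum contains a pair
  entirely or not at all, and it has no unpaired points.\<close>

lemma floor_sum_in_vspan:
  assumes "B \<in> PP N" "laminar N B"
  shows "floor_sum N B \<in> vspan B"
proof -
  define X where "X = floor_sum N B"
  have pair: "x \<in> X \<longleftrightarrow> y \<in> X" if "p \<in> B" "x \<in> p" "y \<in> p" for p x y
  proof -
    have "{q \<in> B. z \<in> q \<or> covers q z} = insert p {q \<in> B - {p}. covers q z}" if "z \<in> p" for z
    proof -
      have "z \<in> q \<longleftrightarrow> q = p" if "q \<in> B" for q
        using PP_unique[OF assms(1) that \<open>p \<in> B\<close>] \<open>z \<in> p\<close> by blast
      then show ?thesis using \<open>p \<in> B\<close> by auto
    qed
    moreover have "{q \<in> B - {p}. covers q x} = {q \<in> B - {p}. covers q y}"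
      using assms(2) that unfolding laminar_def by blast
    moreover have "p \<subseteq> {1..N}" using that PP_D(3)[OF assms(1)] by (auto simp: E2_def)
    ultimately have "{q \<in> B. x \<in> q \<or> covers q x} = {q \<in> B. y \<in> q \<or> covers q y}"
      and "x \<in> {1..N}" "y \<in> {1..N}"
      using that by (simp, blast, blast)
    then show ?thesis by (simp only: X_def mem_floor_sum[OF assms(1)])
  qed
  have "X \<subseteq> supp B"
  proof
    fix x assume "x \<in> X"
    then have x: "x \<in> {1..N}" "odd (card {p \<in> B. x \<in> p \<or> covers p x})"
      by (simp_all add: X_def mem_floor_sum[OF assms(1)])
    then have "{p \<in> B. x \<in> p \<or> covers p x} \<noteq> {}" by (metis card.empty even_zero)
    then show "x \<in> supp B" using x(1) assms(2) by (auto simp: laminar_def supp_def)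
  qed
  then have "X = \<Union>{p \<in> B. p \<subseteq> X}" using pair unfolding supp_def by blast
  then show ?thesis unfolding vspan_PP[OF assms(1)] X_def by blast
qed

lemma XX_even_floor_sum_in_vspan:
  "B \<in> XX D \<Longrightarrow> even D \<Longrightarrow> floor_sum (D + 1) B \<in> vspan B"
  by (simp only: floor_sum_in_vspan XX_even_PP XX_even_laminar)

lemma vspan_subset_EE:
  assumes "B \<in> PP N" "X \<in> vspan B"
  shows "X \<in> EE N"
  using assms(2) Union_in_EE[OF assms(1)] unfolding vspan_PP[OF assms(1)] by blast

section \<open>Heights of the images and of all vectors in the span\<close>

lemma height_nest_left:
  assumes fin: "finite X" and mid: "height X (n + 1) = (- 1) ^ (n + 1)"
    and mem: "\<And>x. x \<in> {1..n} \<Longrightarrow> x \<in> X \<longleftrightarrow> even (n - x)"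
    and "k \<le> n + 1" "1 \<le> k"
  shows "height X k = (- 1) ^ (n + 1) * (2 * int (n + 1 - k) + 1)"
  using assms(4,5)
proof (induction k rule: inc_induct)
  case base
  then show ?case using mid by simp
next
  case (step k)
  have "height X k = height X (Suc k) - 2 * (- 1) ^ k * (if k \<in> X then 1 else - 1)"
    using height_Suc[OF fin] by simp
  \<comment> \<open>Membership alternates and compensates the alternating sign, so all steps on this
    flank go in the same direction.\<close>
  moreover have "(- 1 :: int) ^ k * (if k \<in> X then 1 else - 1) = (- 1) ^ n"
    using mem[of k] step.hyps step.prems by (auto simp: even_diff_nat)
  ultimately have "height X k = height X (Suc k) - 2 * (- 1) ^ n"
    by (simp add: mult.assoc)
  moreover have "int (n + 1 - k) = int (n + 1 - Suc k) + 1" using step.hyps by simp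
  ultimately show ?case using step.IH step.prems by (simp add: algebra_simps)
qed

lemma height_nest_right:
  assumes fin: "finite X" and mid: "height X m = (- 1) ^ m"
    and mem: "\<And>x. x \<ge> m \<Longrightarrow> x < M \<Longrightarrow> x \<in> X \<longleftrightarrow> even (x - m)"
    and "m \<le> k" "k \<le> M"
  shows "height X k = (- 1) ^ m * (2 * int (k - m) + 1)"
  using assms(4,5)
proof (induction k rule: dec_induct)
  case base
  then show ?case using mid by simp
next
  case (step k)
  have "(- 1 :: int) ^ k * (if k \<in> X then 1 else - 1) = (- 1) ^ m"
    using mem[of k] step.hyps step.prems by (auto simp: even_diff_nat)
  then have "height X (Suc k) = height X k + 2 * (- 1) ^ m"
    using height_Suc[OF fin, of k] by (simp add: mult.assoc)
  moreover have "int (Suc k - m) = int (k - m) + 1" using step.hyps by simp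
  ultimately show ?case using step by (simp add: algebra_simps)
qed

lemma height_floor_sum_nest:
  assumes D: "even D" "n \<le> D div 2" and k: "1 \<le> k" "k \<le> D + 2"
  defines "B \<equiv> nest (D + 2) 1 n"
  shows "height (floor_sum (D + 1) B) k = (- 1) ^ (k + depth B k) * (2 * int (depth B k) + 1)"
proof -
  define X where "X = floor_sum (D + 1) B"
  have PP: "B \<in> PP (D + 1)" and lam: "laminar (D + 1) B"
    unfolding B_def using nest_PP laminar_nest D by blast+
  have vspan: "X \<in> vspan B" unfolding X_def using floor_sum_in_vspan[OF PP lam] .
  then have fin: "finite X" using EE_finite vspan_subset_EE[OF PP] by blast
  have n: "2 * n < D + 2" using D by auto
  have card: "card {p \<in> B. x \<in> p \<or> covers p x} = card {r \<in> {1..n}. x \<le> r \<or> D + 2 - r \<le> x}" for x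
  proof -
    have "x \<in> {D + 2 - r, r} \<or> covers {D + 2 - r, r} x \<longleftrightarrow> x \<le> r \<or> D + 2 - r \<le> x"
      if "r \<in> {1..n}" for r
      using that n D by (subst pair_conv_nest) auto
    then show ?thesis unfolding B_def card_filter_nest[OF n] by (metis (no_types, lifting))
  qed
  have left: "x \<in> X \<longleftrightarrow> even (n - x)" if "x \<in> {1..n}" for x
  proof -
    have "{r \<in> {1..n}. x \<le> r \<or> D + 2 - r \<le> x} = {x..n}" using that n by auto
    then show ?thesis unfolding X_def mem_floor_sum[OF PP] card
      using that n by (simp add: Suc_diff_le)
  qed
  have right: "x \<in> X \<longleftrightarrow> even (x - (D + 2 - n))" if "x \<ge> D + 2 - n" "x < D + 2" for x
  proof -
    have "{r \<in> {1..n}. x \<le> r \<or> D + 2 - r \<le> x} = {D + 2 - x..n}" using that n by auto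
    moreover have "Suc n - (D + 2 - x) = Suc (x - (D + 2 - n))" using that n by auto
    moreover have "1 \<le> x" using that n by linarith
    ultimately show ?thesis unfolding X_def mem_floor_sum[OF PP] card using that n by simp
  qed
  have depth: "depth B j = (n + 1 - j) + (j + n - (D + 2))" if "1 \<le> j" "j \<le> D + 2" for j
    unfolding B_def using depth_nest D that by blast
  \<comment> \<open>No pair crosses these positions, so only the correction term is left.\<close>
  have mid: "height X j = (- 1) ^ j" if "n + 1 \<le> j" "j \<le> D + 2 - n" for j
    using signed_sum_vspan[OF PP vspan, of j] depth[of j] that n by (simp add: height_def)
  consider "k \<le> n + 1" | "n + 1 \<le> k" "k \<le> D + 2 - n" | "D + 2 - n \<le> k" by linarith
  then show ?thesis
  proof cases
    case 1
    then have "depth B k = n + 1 - k" using depth k n by auto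
    moreover have "height X k = (- 1) ^ (n + 1) * (2 * int (n + 1 - k) + 1)"
      using height_nest_left[OF fin mid left 1 k(1)] n by simp
    moreover have "k + (n + 1 - k) = n + 1" using 1 by simp
    ultimately show ?thesis by (simp only: X_def)
  next
    case 2
    then have "depth B k = 0" using depth k n by auto
    then show ?thesis using mid[OF 2] by (simp add: X_def)
  next
    case 3
    then have d: "depth B k = k - (D + 2 - n)" using depth k n by auto
    have "height X k = (- 1) ^ (D + 2 - n) * (2 * int (k - (D + 2 - n)) + 1)"
      using height_nest_right[OF fin mid right 3 k(2)] n by simp
    moreover have "even (k + (k - (D + 2 - n))) \<longleftrightarrow> even (D + 2 - n)"
      using 3 by (auto simp: even_diff_nat)
    ultimately show ?thesis by (simp only: X_def d minus_one_power_cases)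
  qed
qed

text \<open>The sign carries the induction: the new pair enters the sum iff the depth at
  \<open>l\<close> is even, and then the step into the middle position leads away from zero in
  either case.\<close>

lemma height_floor_sum:
  assumes "B \<in> XX D" "even D" "k \<in> {1..D + 2}"
  shows "height (floor_sum (D + 1) B) k = (- 1) ^ (k + depth B k) * (2 * int (depth B k) + 1)"
  using assms
proof (induction arbitrary: k rule: XX_even_induct)
  case (nest D n)
  then show ?case using height_floor_sum_nest by simp
next
  case (insert D l B)
  have PP: "B \<in> PP (D + 1)" and l: "l \<in> {1..D + 1 + 1}"
    using insert.hyps XX_even_PP by auto
  define X where "X = floor_sum (D + 1) B"
  have fin: "finite X"
    using XX_even_floor_sum_in_vspan[of B D] vspan_subset_EE[OF PP] EE_finite insert.hyps
    unfolding X_def by blast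
  have X': "floor_sum (D + 2 + 1) (II l B) = iota l ` X \<union> (if even (depth B l) then {l, Suc l} else {})"
    using floor_sum_II[OF PP l] by (simp add: X_def)
  have IH: "height X j = (- 1) ^ (j + depth B j) * (2 * int (depth B j) + 1)" if "j \<in> {1..D + 2}" for j
    using insert.IH that by (simp only: X_def)
  show ?case
  proof (cases "k = Suc l")
    case True
    have "height (floor_sum (D + 2 + 1) (II l B)) k
        = height X l + (if even (depth B l) then 2 else - 2) * (- 1) ^ l"
      unfolding X' using True height_iota_new[OF fin, of l k] height_iota[of l X k] by auto
    also have "\<dots> = (- 1) ^ (Suc l + Suc (depth B l)) * (2 * int (Suc (depth B l)) + 1)"
      using IH[of l] insert.hyps by (simp add: minus_one_power_cases)
    finally show ?thesis using depth_II[OF PP, of l k] True by simp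
  next
    case False
    have "collapse l k \<in> {1..D + 2}" using insert.hyps insert.prems False by (auto simp: collapse_def)
    then have "height (floor_sum (D + 2 + 1) (II l B)) k
        = (- 1) ^ (collapse l k + depth B (collapse l k)) * (2 * int (depth B (collapse l k)) + 1)"
      unfolding X' using False height_iota_new[OF fin, of l k] height_iota[of l X k] IH by auto
    then show ?thesis
      using False depth_II[OF PP, of l k] even_collapse[OF False] by (simp add: minus_one_power_cases)
  qed
qed

lemma vspan_II:
  assumes "B \<in> PP N" "l \<in> {1..N + 1}" "X \<in> vspan (II l B)"
  obtains Y where "Y \<in> vspan B" "X = iota l ` Y \<or> X = iota l ` Y \<union> {l, Suc l}"
proof -
  obtain P where P: "P \<subseteq> II l B" "X = \<Union>P"
    using assms(3) vspan_PP[OF II_in_PP[OF assms(1,2)]] by auto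
  define Q where "Q = {p \<in> B. iota l ` p \<in> P}"
  have "P - {{l, Suc l}} = (\<lambda>p. iota l ` p) ` Q"
  proof
    show "P - {{l, Suc l}} \<subseteq> (\<lambda>p. iota l ` p) ` Q"
    proof
      fix p assume p: "p \<in> P - {{l, Suc l}}"
      then have "p \<in> (\<lambda>p. iota l ` p) ` B" using P(1) unfolding II_alt by blast
      then obtain q where "q \<in> B" "p = iota l ` q" by blast
      then show "p \<in> (\<lambda>p. iota l ` p) ` Q" using p unfolding Q_def by simp
    qed
    show "(\<lambda>p. iota l ` p) ` Q \<subseteq> P - {{l, Suc l}}"
      using new_notin_image[of l Q] unfolding Q_def by auto
  qed
  then have "P = (\<lambda>p. iota l ` p) ` Q \<or> P = insert {l, Suc l} ((\<lambda>p. iota l ` p) ` Q)"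
    by (metis Diff_empty Diff_insert0 insert_Diff)
  then have "X = iota l ` (\<Union>Q) \<or> X = iota l ` (\<Union>Q) \<union> {l, Suc l}"
    unfolding P(2) by auto
  moreover have "\<Union>Q \<in> vspan B" unfolding vspan_PP[OF assms(1)] Q_def by blast
  ultimately show ?thesis using that by blast
qed

lemma abs_height_le_Suc: "finite X \<Longrightarrow> \<bar>height X k\<bar> \<le> \<bar>height X (Suc k)\<bar> + 2"
  using height_step[of X k] by linarith

lemma abs_height_Suc_le: "finite X \<Longrightarrow> \<bar>height X (Suc k)\<bar> \<le> \<bar>height X k\<bar> + 2"
  using height_step[of X k] by linarith

text \<open>For a nest the heights in the flat middle are 1 or -1, and on the flanks it suffices
  that each step changes the height by 2. An insertion adds one position, at distance 2 from an old
  height, where the depth has grown by 1.\<close>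

lemma height_bound:
  assumes "B \<in> XX D" "even D" "X \<in> vspan B" "k \<in> {1..D + 2}"
  shows "\<bar>height X k\<bar> \<le> 2 * int (depth B k) + 1"
  using assms
proof (induction arbitrary: X k rule: XX_even_induct)
  case (nest D n)
  have PP: "nest (D + 2) 1 n \<in> PP (D + 1)" using nest_PP nest.hyps by blast
  have fin: "finite X" using EE_finite vspan_subset_EE[OF PP nest.prems(1)] by blast
  have depth: "depth (nest (D + 2) 1 n) j = (n + 1 - j) + (j + n - (D + 2))"
    if "j \<in> {1..D + 2}" for j
    using depth_nest nest.hyps that by simp
  have n: "2 * n < D + 2" using nest.hyps by auto
  have mid: "\<bar>height X j\<bar> = 1" if "n + 1 \<le> j" "j \<le> D + 2 - n" for j
    using signed_sum_vspan[OF PP nest.prems(1), of j] depth[of j] that n by (simp add: height_def)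
  have left: "\<bar>height X j\<bar> \<le> 2 * int (n + 1 - j) + 1" if "j \<le> n + 1" for j
    using that
  proof (induction j rule: inc_induct)
    case base
    then show ?case using mid[of "n + 1"] n by simp
  next
    case (step j)
    then show ?case using abs_height_le_Suc[OF fin, of j] by simp
  qed
  have right: "\<bar>height X j\<bar> \<le> 2 * int (j - (D + 2 - n)) + 1" if "D + 2 - n \<le> j" for j
    using that
  proof (induction j rule: dec_induct)
    case base
    then show ?case using mid[of "D + 2 - n"] n by simp
  next
    case (step j)
    then show ?case using abs_height_Suc_le[OF fin, of j] by (simp add: Suc_diff_le)
  qed
  consider "k \<le> n + 1" | "n + 1 \<le> k" "k \<le> D + 2 - n" | "D + 2 - n \<le> k" by linarith
  then show ?case
  proof cases
    case 1
    then show ?thesis using left[OF 1] depth[OF nest.prems(2)] n by simp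
  next
    case 2
    then show ?thesis using mid[OF 2] by simp
  next
    case 3
    then have "depth (nest (D + 2) 1 n) k = k - (D + 2 - n)"
      using depth[OF nest.prems(2)] n by simp
    then show ?thesis using right[OF 3] by simp
  qed
next
  case (insert D l B)
  have PP: "B \<in> PP (D + 1)" and l: "l \<in> {1..D + 1 + 1}"
    using insert.hyps XX_even_PP by auto
  obtain Y where Y: "Y \<in> vspan B" "X = iota l ` Y \<or> X = iota l ` Y \<union> {l, Suc l}"
    using vspan_II[OF PP l insert.prems(1)] .
  have fin: "finite Y" using EE_finite vspan_subset_EE[OF PP Y(1)] by blast
  show ?case
  proof (cases "k = Suc l")
    case True
    then have "\<bar>height X k\<bar> \<le> \<bar>height Y l\<bar> + 2"
      using Y(2) height_iota_new[OF fin, of l k] height_iota[of l Y k]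
      by (auto simp: minus_one_power_cases)
    then show ?thesis using insert.IH[OF Y(1), of l] insert.hyps depth_II[OF PP, of l k] True by simp
  next
    case False
    have "collapse l k \<in> {1..D + 2}" using insert.hyps insert.prems False by (auto simp: collapse_def)
    moreover have "height X k = height Y (collapse l k)"
      using Y(2) False height_iota_new[OF fin, of l k] height_iota[of l Y k] by auto
    ultimately show ?thesis using insert.IH[OF Y(1)] False depth_II[OF PP, of l k] by simp
  qed
qed

definition weight :: "nat \<Rightarrow> nat set \<Rightarrow> int" where
  "weight N X = (\<Sum>k\<in>{1..N + 1}. \<bar>height X k\<bar>)"

lemma abs_height_floor_sum:
  assumes "B \<in> XX D" "even D" "k \<in> {1..D + 2}"
  shows "\<bar>height (floor_sum (D + 1) B) k\<bar> = 2 * int (depth B k) + 1"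
  using height_floor_sum[OF assms] by (simp add: abs_mult)

lemma weight_less:
  assumes "B \<in> XX D" "even D" "X \<in> vspan B" "X \<noteq> floor_sum (D + 1) B"
  shows "weight (D + 1) X < weight (D + 1) (floor_sum (D + 1) B)"
proof -
  have PP: "B \<in> PP (D + 1)" using XX_even_PP assms by blast
  have le: "\<bar>height X k\<bar> \<le> \<bar>height (floor_sum (D + 1) B) k\<bar>" if "k \<in> {1..D + 2}" for k
    using height_bound[OF assms(1-3) that] abs_height_floor_sum[OF assms(1,2) that] by simp
  have "X \<in> EE (D + 1)" "floor_sum (D + 1) B \<in> EE (D + 1)"
    using vspan_subset_EE[OF PP] XX_even_floor_sum_in_vspan[OF assms(1,2)] assms(3) by blast+
  then obtain k where "k \<in> {1..D + 2}" "\<bar>height X k\<bar> \<noteq> \<bar>height (floor_sum (D + 1) B) k\<bar>"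
    using EE_eqI[of X "D + 1" "floor_sum (D + 1) B"] assms(4) by auto
  then have "\<exists>k\<in>{1..D + 2}. \<bar>height X k\<bar> < \<bar>height (floor_sum (D + 1) B) k\<bar>"
    using le by force
  then show ?thesis unfolding weight_def by (intro sum_strict_mono_ex1) (use le in auto)
qed

section \<open>Peaks of the depth, injectivity and surjectivity\<close>

lemma nest_no_peak:
  assumes "even D" "n \<le> D div 2" "l \<in> {1..D}"
    "depth (nest (D + 2) 1 n) (l + 1) = depth (nest (D + 2) 1 n) l + 1"
  shows "depth (nest (D + 2) 1 n) (l + 2) \<noteq> depth (nest (D + 2) 1 n) l"
  using assms depth_nest[OF assms(1,2), of l] depth_nest[OF assms(1,2), of "l + 1"]
    depth_nest[OF assms(1,2), of "l + 2"]
  by auto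

text \<open>Induction over the construction. If the outermost insertion is at the peak, it is the
  one sought; insertion next to the peak would force a step in the wrong direction; insertion
  further away leaves the peak in the smaller member, and \<open>II_commute\<close> exchanges the
  two insertions.\<close>

lemma peak_conv_II:
  assumes "B \<in> XX D" "even D" "l \<in> {1..D}"
    and "depth B (l + 1) = depth B l + 1" "depth B (l + 2) = depth B l"
  shows "\<exists>C\<in>XX (D - 2). B = II l C"
  using assms
proof (induction arbitrary: l rule: XX_even_induct)
  case (nest D n)
  then show ?case using nest_no_peak by blast
next
  case (insert D k B)
  have PP: "B \<in> PP (D + 1)" using insert.hyps XX_even_PP by blast
  note dep = depth_II[OF PP, of k]
  consider "l = k" | "l = k + 1" | "k = l + 1" | "l + 2 \<le> k" | "k + 2 \<le> l" by linarith
  then show ?case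
  proof cases
    case 1
    then show ?thesis using insert.hyps by auto
  next
    case 2
    then show ?thesis using insert.prems dep[of l] dep[of "l + 1"] by (simp add: collapse_def)
  next
    case 3
    then show ?thesis using insert.prems dep[of l] dep[of "l + 1"] dep[of "l + 2"]
      by (simp add: collapse_def)
  next
    case 4
    then have "l \<in> {1..D}" "D \<noteq> 0" using insert.prems insert.hyps by auto
    then obtain C where C: "C \<in> XX (D - 2)" "B = II l C"
      using insert.IH[of l] insert.prems(2,3) unfolding dep using 4
      by (auto simp: collapse_def)
    have "D - 2 + 2 = D" using \<open>D \<noteq> 0\<close> insert.hyps by presburger
    moreover have "1 \<le> k - 2" "k - 2 \<le> D" using 4 \<open>l \<in> {1..D}\<close> insert.hyps by auto
    ultimately have "II (k - 2) C \<in> XX D" using II_in_XX[OF C(1), of "k - 2"] by simp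
    then show ?thesis unfolding C(2) II_commute[OF 4] by auto
  next
    case 5
    then have "l - 2 \<in> {1..D}" "D \<noteq> 0" using insert.prems insert.hyps by auto
    moreover have "collapse k l = l - 2" "collapse k (l + 1) = l - 2 + 1" "collapse k (l + 2) = l - 2 + 2"
      using 5 insert.hyps by (auto simp: collapse_def)
    ultimately obtain C where C: "C \<in> XX (D - 2)" "B = II (l - 2) C"
      using insert.IH[of "l - 2"] insert.prems(2,3) unfolding dep using 5 by auto
    have "D - 2 + 2 = D" using \<open>D \<noteq> 0\<close> insert.hyps by presburger
    then have "II k C \<in> XX D" using II_in_XX[OF C(1), of k] 5 insert.hyps insert.prems by auto
    moreover have "II k B = II l (II k C)" unfolding C(2) II_commute[OF 5] ..
    ultimately show ?thesis by auto
  qed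
qed

text \<open>The depth shows whether there is a peak. A nest has none and is known from its depth at
  1; otherwise both members are insertions at the same peak, and undoing them leaves equal
  depths.\<close>

lemma depth_inj:
  assumes "B \<in> XX D" "even D" "B' \<in> XX D" "\<And>k. k \<in> {1..D + 2} \<Longrightarrow> depth B k = depth B' k"
  shows "B = B'"
  using assms
proof (induction arbitrary: B' rule: XX_even_induct)
  case (nest D n)
  from nest.prems(1) nest.hyps(1) show ?case
  proof (cases rule: XX_even_cases)
    case (nest n')
    then show ?thesis
      using nest.prems(2)[of 1] depth_nest[OF nest.hyps, of 1] depth_nest[OF nest.hyps(1), of n' 1]
        nest.hyps by simp
  next
    case (insert D' l C)
    have PP: "C \<in> PP (D' + 1)" using insert XX_even_PP by blast
    have "depth B' (l + 1) = depth B' l + 1" "depth B' (l + 2) = depth B' l"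
      using depth_II[OF PP, of l] insert by (simp_all add: collapse_def)
    then show ?thesis
      using nest_no_peak[OF nest.hyps, of l] nest.prems(2)[of l] nest.prems(2)[of "l + 1"]
        nest.prems(2)[of "l + 2"] insert by auto
  qed
next
  case (insert D l B)
  have PP: "B \<in> PP (D + 1)" using insert.hyps XX_even_PP by blast
  have "depth B' (l + 1) = depth B' l + 1" "depth B' (l + 2) = depth B' l"
    using depth_II[OF PP, of l] insert.hyps insert.prems(2)[of l] insert.prems(2)[of "l + 1"]
      insert.prems(2)[of "l + 2"] by (simp_all add: collapse_def)
  then obtain C where C: "C \<in> XX D" "B' = II l C"
    using peak_conv_II[OF insert.prems(1), of l] insert.hyps by auto
  have PPC: "C \<in> PP (D + 1)" using C insert.hyps XX_even_PP by blast
  \<comment> \<open>An old position \<open>k\<close> is the collapse of \<open>k\<close> or of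
    \<open>k + 2\<close>, where the new pair adds nothing to the depth.\<close>
  have "depth B k = depth C k" if k: "k \<in> {1..D + 2}" for k
  proof (cases "k \<le> l")
    case True
    then show ?thesis using insert.prems(2)[of k] k unfolding C(2) depth_II[OF PP] depth_II[OF PPC]
      by (simp add: collapse_def)
  next
    case False
    then show ?thesis using insert.prems(2)[of "k + 2"] k unfolding C(2) depth_II[OF PP] depth_II[OF PPC]
      by (simp add: collapse_def)
  qed
  then show ?case using insert.IH[OF C(1)] C(2) by simp
qed

lemma floor_sum_inj:
  assumes "even D"
  shows "inj_on (floor_sum (D + 1)) (XX D)"
proof (rule inj_onI)
  fix B B' assume B: "B \<in> XX D" "B' \<in> XX D" "floor_sum (D + 1) B = floor_sum (D + 1) B'"
  have "depth B k = depth B' k" if "k \<in> {1..D + 2}" for k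
    using abs_height_floor_sum[OF B(1) assms that] abs_height_floor_sum[OF B(2) assms that] B(3) by simp
  then show "B = B'" using depth_inj B assms by blast
qed

text \<open>After an ascent the value is positive, hence not stationary, and without a peak it
  cannot descend; so once ascending, \<open>G\<close> ascends up to \<open>M\<close>. Before the
  first ascent \<open>m\<close> it descends to 0 and stays there.\<close>

lemma no_peak_shape:
  fixes G :: "nat \<Rightarrow> nat"
  assumes step: "\<And>k. 1 \<le> k \<Longrightarrow> k < M \<Longrightarrow>
      G (k + 1) = G k + 1 \<or> G k = G (k + 1) + 1 \<or> G k = 0 \<and> G (k + 1) = 0"
    and no_peak: "\<And>k. 1 \<le> k \<Longrightarrow> k + 2 \<le> M \<Longrightarrow> G (k + 1) = G k + 1 \<Longrightarrow> G (k + 2) \<noteq> G k"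
    and ends: "G 1 = G M" and M: "even M" "1 < M"
  shows "2 * G 1 < M" "1 \<le> k \<Longrightarrow> k \<le> M \<Longrightarrow> G k = (G 1 + 1 - k) + (k + G 1 - M)"
proof -
  have "\<exists>m. 1 \<le> m \<and> m \<le> M \<and> (m < M \<longrightarrow> G (m + 1) = G m + 1) \<and>
      (\<forall>k. 1 \<le> k \<longrightarrow> k < m \<longrightarrow> G (k + 1) \<noteq> G k + 1)"
  proof (cases "\<exists>k\<ge>1. k < M \<and> G (k + 1) = G k + 1")
    case True
    let ?Q = "\<lambda>k. 1 \<le> k \<and> k < M \<and> G (k + 1) = G k + 1"
    have "\<exists>k. ?Q k" using True by blast
    then obtain k where k: "?Q k" "\<And>j. j < k \<Longrightarrow> \<not> ?Q j" unfolding exists_least_iff[of ?Q] by blast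
    then have "G (j + 1) \<noteq> G j + 1" if "1 \<le> j" "j < k" for j
      using that by (meson less_trans)
    then show ?thesis using k(1) by (intro exI[of _ k]) simp
  next
    case False
    then show ?thesis using M by (intro exI[of _ M]) auto
  qed
  then obtain m where m: "1 \<le> m" "m \<le> M" "m < M \<longrightarrow> G (m + 1) = G m + 1"
    "\<And>k. 1 \<le> k \<Longrightarrow> k < m \<Longrightarrow> G (k + 1) \<noteq> G k + 1" by blast
  have left: "G k = G 1 + 1 - k" if "1 \<le> k" "k \<le> m" for k
    using that
  proof (induction k rule: dec_induct)
    case base
    then show ?case by simp
  next
    case (step k)
    then show ?case using assms(1)[of k] m(2) m(4)[of k] by auto
  qed
  have right: "G k = G m + (k - m) \<and> (k < M \<longrightarrow> G (k + 1) = G k + 1)" if "m \<le> k" "k \<le> M" for k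
    using that
  proof (induction k rule: dec_induct)
    case base
    then show ?case using m(3) by simp
  next
    case (step k)
    then have "G (k + 1) = G k + 1" "G k = G m + (k - m)" by auto
    then show ?case using assms(1)[of "k + 1"] no_peak[of k] step.hyps step.prems m(1)
      by (auto simp: Suc_diff_le)
  qed
  have eq: "G 1 = (G 1 + 1 - m) + (M - m)" using left[of m] right[of M] m ends by simp
  \<comment> \<open>A valley that does not reach 0 before \<open>m\<close>, with equal ends, would
    have flanks of equal length, which makes \<open>M\<close> odd.\<close>
  have "G 1 + 1 \<le> m"
  proof (rule ccontr)
    assume "\<not> G 1 + 1 \<le> m"
    then have "M + 1 = 2 * m" using eq m by linarith
    then show False using M by presburger
  qed
  then have 1: "G m = 0" "G 1 = M - m" "m \<ge> G 1 + 1" using eq left[of m] m by auto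
  then show "2 * G 1 < M" using m by linarith
  show "G k = (G 1 + 1 - k) + (k + G 1 - M)" if "1 \<le> k" "k \<le> M"
    using left[of k] right[of k] that 1 m by (cases "k \<le> m") auto
qed

lemma floor_sum_surj:
  assumes "even D" "X \<in> EE (D + 1)"
  shows "\<exists>B\<in>XX D. floor_sum (D + 1) B = X"
  using assms
proof (induction D arbitrary: X rule: less_induct)
  case (less D)
  note EE = less.prems(2)
  have fin: "finite X" using EE_finite[OF EE] .
  \<comment> \<open>By \<open>abs_height_floor_sum\<close> this is the only possible depth of a
    preimage of \<open>X\<close>.\<close>
  define G where "G k = nat ((\<bar>height X k\<bar> - 1) div 2)" for k
  have G: "\<bar>height X k\<bar> = 2 * int (G k) + 1" for k
  proof -
    obtain c where "height X k = 2 * c + 1" using odd_height[of X k] by (rule oddE)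
    then show ?thesis unfolding G_def by (cases "c \<ge> 0") auto
  qed
  show ?case
  proof (cases "\<exists>l\<in>{1..D}. G (l + 1) = G l + 1 \<and> G (l + 2) = G l")
    case True
    then obtain l where l: "l \<in> {1..D}" "G (l + 1) = G l + 1" "G (l + 2) = G l" by blast
    define D' where "D' = D - 2"
    have D: "D = D' + 2" "even D'" "D' < D"
      using l(1) less.prems(1) unfolding D'_def by (auto, presburger+)
    define Y where "Y = iota l -` X"
    \<comment> \<open>Around the peak the steps \<open>l\<close> and \<open>l + 1\<close> go in
      opposite directions; as their parities differ, both points are in \<open>X\<close> or both are
      outside.\<close>
    have "l \<in> X \<longleftrightarrow> Suc l \<in> X"
      using G[of l] G[of "l + 1"] G[of "l + 2"] l(2,3) height_Suc[OF fin, of l] height_Suc[OF fin, of "Suc l"]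
      by (auto simp: minus_one_power_cases split: if_splits)
    moreover have img: "iota l ` Y = X - {l, Suc l}"
    proof
      show "iota l ` Y \<subseteq> X - {l, Suc l}" unfolding Y_def by auto
      show "X - {l, Suc l} \<subseteq> iota l ` Y"
      proof
        fix x assume x: "x \<in> X - {l, Suc l}"
        then obtain y where "x = iota l y" using not_new_iff_iota[of x l] by auto
        then show "x \<in> iota l ` Y" using x unfolding Y_def by simp
      qed
    qed
    ultimately have X: "X = iota l ` Y \<and> l \<notin> X \<or> X = iota l ` Y \<union> {l, Suc l} \<and> l \<in> X" by auto
    have finY: "finite Y" using finite_vimageI[OF fin inj_iota] unfolding Y_def .
    have "card (iota l ` Y) = card Y"
      by (rule card_image[OF inj_on_subset[OF inj_iota subset_UNIV]])
    moreover have "card (iota l ` Y \<union> {l, Suc l}) = card (iota l ` Y) + card {l, Suc l}"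
      using finY by (intro card_Un_disjoint) auto
    ultimately have "even (card Y)" using X EE by (auto simp: EE_def)
    moreover have "Y \<subseteq> {1..D' + 1}"
    proof
      fix y assume "y \<in> Y"
      then have "iota l y \<in> {1..D + 1}" using EE by (auto simp: Y_def EE_def)
      then show "y \<in> {1..D' + 1}" using l(1) D(1) by (auto simp: iota_def split: if_splits)
    qed
    ultimately have "Y \<in> EE (D' + 1)" by (simp add: EE_def)
    then obtain B where B: "B \<in> XX D'" "floor_sum (D' + 1) B = Y"
      using less.IH[OF D(3,2)] by blast
    have PP: "B \<in> PP (D' + 1)" using B(1) D(2) XX_even_PP by blast
    have II: "II l B \<in> XX D" using II_in_XX[OF B(1), of l] l(1) D(1) by simp
    have h: "height X k = height Y (collapse l k)" if "k \<noteq> Suc l" for k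
      using X that height_iota[of l Y k] height_iota_new[OF finY, of l k] by auto
    have d: "2 * int (depth B k) + 1 = \<bar>height Y k\<bar>" if "k \<in> {1..D' + 2}" for k
      using abs_height_floor_sum[OF B(1) D(2) that] B(2) by simp
    have "\<bar>height (floor_sum (D + 1) (II l B)) k\<bar> = \<bar>height X k\<bar>" if k: "k \<in> {1..D + 1 + 1}" for k
    proof -
      have *: "\<bar>height (floor_sum (D + 1) (II l B)) k\<bar>
          = 2 * int (depth B (collapse l k) + (if k = Suc l then 1 else 0)) + 1"
        using abs_height_floor_sum[OF II less.prems(1), of k] k unfolding depth_II[OF PP] by simp
      show ?thesis
      proof (cases "k = Suc l")
        case True
        then have "\<bar>height X k\<bar> = \<bar>height X l\<bar> + 2" using G[of l] G[of "l + 1"] l(2) by simp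
        then show ?thesis using * True d[of l] h[of l] l(1) D(1) by simp
      next
        case False
        then have "collapse l k \<in> {1..D' + 2}" using k l(1) D(1) by (auto simp: collapse_def)
        then show ?thesis using * False d h by simp
      qed
    qed
    moreover have "floor_sum (D + 1) (II l B) \<in> EE (D + 1)"
      using vspan_subset_EE[OF XX_even_PP[OF less.prems(1) II]]
        XX_even_floor_sum_in_vspan[OF II less.prems(1)] by blast
    ultimately have "floor_sum (D + 1) (II l B) = X" using EE_eqI[OF _ EE] by blast
    then show ?thesis using II by blast
  next
    case False
    define n where "n = G 1"
    \<comment> \<open>The absolute height is stationary only where the path passes between 1 and -1,
      which is the third alternative.\<close>
    have step: "G (k + 1) = G k + 1 \<or> G k = G (k + 1) + 1 \<or> G k = 0 \<and> G (k + 1) = 0" for k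
      using G[of k] G[of "k + 1"] height_step[OF fin, of k] by auto
    have ends: "G 1 = G (D + 2)"
      using height_ends[OF EE] less.prems(1) G[of 1] G[of "D + 2"] by simp
    have no_peak: "G (k + 2) \<noteq> G k" if "1 \<le> k" "k + 2 \<le> D + 2" "G (k + 1) = G k + 1" for k
      using False that by auto
    note shape = no_peak_shape[of "D + 2" G, OF step no_peak ends]
    have n: "n \<le> D div 2" using shape(1) less.prems(1) by (auto simp: n_def elim!: evenE)
    define B where "B = nest (D + 2) 1 n"
    have B: "B \<in> XX D" unfolding B_def using nest_in_XX less.prems(1) n .
    have "\<bar>height (floor_sum (D + 1) B) k\<bar> = \<bar>height X k\<bar>" if "k \<in> {1..D + 1 + 1}" for k
    proof -
      have "depth B k = G k"
        using shape(2)[of k] that depth_nest[OF less.prems(1) n, of k] less.prems(1)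
        unfolding B_def n_def by simp
      then show ?thesis using abs_height_floor_sum[OF B less.prems(1), of k] that G[of k] by simp
    qed
    moreover have "floor_sum (D + 1) B \<in> EE (D + 1)"
      using vspan_subset_EE[OF XX_even_PP[OF less.prems(1) B]]
        XX_even_floor_sum_in_vspan[OF B less.prems(1)] by blast
    ultimately have "floor_sum (D + 1) B = X" using EE_eqI[OF _ EE] by blast
    then show ?thesis using B by blast
  qed
qed

lemma floor_sum_bij:
  assumes "even D"
  shows "bij_betw (floor_sum (D + 1)) (XX D) (EE (D + 1))"
  unfolding bij_betw_def
proof (intro conjI floor_sum_inj[OF assms] set_eqI iffI)
  fix X assume "X \<in> floor_sum (D + 1) ` XX D"
  then show "X \<in> EE (D + 1)"
    using vspan_subset_EE XX_even_PP[OF assms] XX_even_floor_sum_in_vspan[OF _ assms] by blast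
next
  fix X assume "X \<in> EE (D + 1)"
  then show "X \<in> floor_sum (D + 1) ` XX D" using floor_sum_surj[OF assms] by blast
qed

section \<open>The even part and gamma\<close>

lemma covers_ends:
  assumes "p \<in> E2 N"
  shows "covers p 1 \<longleftrightarrow> even (Max p - Min p)" "covers p (Suc N) \<longleftrightarrow> even (Max p - Min p)"
proof -
  obtain a b where "p = {a, b}" "a < b" "1 \<le> a" "b \<le> N" using assms by (rule E2_cases)
  then show "covers p 1 \<longleftrightarrow> even (Max p - Min p)" "covers p (Suc N) \<longleftrightarrow> even (Max p - Min p)"
    by (auto simp: covers_pair max_def min_def)
qed

text \<open>Positions 1 and N + 1 are the two sides of the cut, and the intervals through the cut
  are those of the pairs with even difference.\<close>

lemma depth_ends:
  assumes "B \<in> PP N"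
  shows "depth B 1 = card (even_part B)" "depth B (Suc N) = card (even_part B)"
  unfolding depth_def even_part_PP[OF assms] using covers_ends PP_D(3)[OF assms]
  by (auto intro!: arg_cong[of _ _ card])

text \<open>At position 1 the absolute height is both |2 gamma + 1| and twice the size of the even
  part plus 1. Resolving the absolute value gives the two cases t and -t-1 in the definition of the
  pieces.\<close>

lemma gamma_floor_sum:
  assumes "B \<in> XX D" "even D"
  shows "int (card (even_part B)) =
    (if gamma (floor_sum (D + 1) B) \<ge> 0 then gamma (floor_sum (D + 1) B)
     else - gamma (floor_sum (D + 1) B) - 1)"
proof -
  have PP: "B \<in> PP (D + 1)" using assms XX_even_PP by blast
  have "floor_sum (D + 1) B \<in> EE (D + 1)"
    using vspan_subset_EE[OF PP] XX_even_floor_sum_in_vspan[OF assms] by blast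
  then have "height (floor_sum (D + 1) B) 1 = - (2 * gamma (floor_sum (D + 1) B) + 1)"
    using height_ends(1) assms(2) by simp
  moreover have "\<bar>height (floor_sum (D + 1) B) 1\<bar> = 2 * int (card (even_part B)) + 1"
    using abs_height_floor_sum[OF assms, of 1] depth_ends(1)[OF PP] by simp
  ultimately show ?thesis by auto
qed

section \<open>Triangularity\<close>

text \<open>Both bijections have the same total weight, that of \<open>E\<close>, but a bijection
  differing from \<open>e\<close> somewhere would have a strictly smaller total.\<close>

lemma triangular_unique:
  fixes W :: "'b \<Rightarrow> int"
  assumes "finite A" and e: "bij_betw e A E"
    and less: "\<And>a x. a \<in> A \<Longrightarrow> x \<in> S a \<Longrightarrow> x \<noteq> e a \<Longrightarrow> W x < W (e a)"
    and f: "bij_betw f A E" "\<And>a. a \<in> A \<Longrightarrow> f a \<in> S a" and "a \<in> A"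
  shows "f a = e a"
proof -
  have sum: "(\<Sum>a\<in>A. W (f a)) = (\<Sum>a\<in>A. W (e a))"
    using sum.reindex_bij_betw[OF e, of W] sum.reindex_bij_betw[OF f(1), of W] by simp
  have "W (f a) \<le> W (e a)" if "a \<in> A" for a
    using less[OF that f(2)[OF that]] by (cases "f a = e a") auto
  then have "W (f a) = W (e a)"
    using sum_mono_inv[OF sum] assms(1) \<open>a \<in> A\<close> by blast
  then show ?thesis using less[OF \<open>a \<in> A\<close> f(2)[OF \<open>a \<in> A\<close>]] by auto
qed

text \<open>\<open>W\<close> grows strictly along every generating pair of distinct elements, hence
  along their chains, which gives antisymmetry. Reflexivity comes from \<open>e a \<in> S a\<close>,
  so the transitive closure is enough.\<close>

lemma triangular_partial_order:
  fixes W :: "'b \<Rightarrow> int"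
  assumes e: "bij_betw e A E" "\<And>a. a \<in> A \<Longrightarrow> e a \<in> S a"
    and less: "\<And>a x. a \<in> A \<Longrightarrow> x \<in> S a \<Longrightarrow> x \<noteq> e a \<Longrightarrow> W x < W (e a)"
  shows "partial_order_on E ({(x, y). x \<in> E \<and> y \<in> E \<and> x \<in> S (inv_into A e y)}\<^sup>+)"
    (is "partial_order_on E (?R\<^sup>+)")
proof -
  have inv: "inv_into A e y \<in> A" "e (inv_into A e y) = y" if "y \<in> E" for y
    using that e(1) by (auto simp: bij_betw_def inv_into_into f_inv_into_f)
  have R: "x = y \<or> W x < W y" if "(x, y) \<in> ?R" for x y
    using that less[of "inv_into A e y" x] inv[of y] by auto
  have R_trancl: "x = y \<or> W x < W y" if "(x, y) \<in> ?R\<^sup>+" for x y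
    using that by (induction rule: trancl_induct) (use R in fastforce)+
  have "(x, x) \<in> ?R\<^sup>+" if "x \<in> E" for x
    using that e(2)[of "inv_into A e x"] inv[of x] by auto
  moreover have "?R\<^sup>+ \<subseteq> E \<times> E" by (rule trancl_subset_Sigma) auto
  moreover have "antisym (?R\<^sup>+)"
  proof (rule antisymI)
    fix x y assume "(x, y) \<in> ?R\<^sup>+" "(y, x) \<in> ?R\<^sup>+"
    then show "x = y" using R_trancl[of x y] R_trancl[of y x] by force
  qed
  ultimately show ?thesis
    by (auto simp: partial_order_on_def preorder_on_def refl_on_def)
qed

lemma bij_betw_restrict:
  assumes "bij_betw f A E" "A' = {a \<in> A. f a \<in> E'}" "E' \<subseteq> E"
  shows "bij_betw f A' E'"
  using assms unfolding bij_betw_def inj_on_def by blast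

section \<open>From even to odd\<close>

text \<open>For unpaired \<open>N\<close> both branches give \<open>B\<close>; for \<open>B\<close>
  in an even collection with \<open>N\<close> paired, the test asks whether the pair of
  \<open>N\<close> occurs in the vector.\<close>

definition drop_last :: "nat \<Rightarrow> nat set set \<Rightarrow> nat set set" where
  "drop_last N B = (if N \<in> floor_sum N B then B else {p \<in> B. N \<notin> p})"

lemma drop_last_subset: "drop_last N B \<subseteq> B"
  by (auto simp: drop_last_def)

lemma PP_subset: "B \<in> PP N \<Longrightarrow> C \<subseteq> B \<Longrightarrow> C \<in> PP N"
  using pairwise_subset[of disjnt B C] by (auto simp: PP_def)

lemma PP_mem:
  assumes "B \<in> PP N" "p \<in> B" "x \<in> p"
  shows "1 \<le> x" "x \<le> N"
proof -
  have "p \<subseteq> {1..N}" using assms(2) PP_D(3)[OF assms(1)] by (auto simp: E2_def)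
  then show "1 \<le> x" "x \<le> N" using assms(3) by auto
qed

text \<open>For these \<open>l\<close> the last point is the transported old one, so the tests on
  both sides agree. At \<open>l = N + 1\<close> the last point is new; that is
  \<open>drop_last_II_last\<close>.\<close>

lemma drop_last_II:
  assumes "B \<in> PP N" "l \<in> {1..N}"
  shows "drop_last (N + 2) (II l B) = II l (drop_last N B)"
proof -
  have N: "N + 2 = iota l N" "N + 2 \<noteq> l" "N + 2 \<noteq> Suc l" using assms(2) by (auto simp: iota_def)
  have "N + 2 \<in> floor_sum (N + 2) (II l B) \<longleftrightarrow> N \<in> floor_sum N B"
    using floor_sum_II[OF assms(1), of l] assms(2) N inj_iota[of l] by (auto simp: inj_def)
  moreover have "{p \<in> II l B. N + 2 \<notin> p} = II l {p \<in> B. N \<notin> p}"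
    unfolding II_alt using N inj_iota[of l] by (auto simp: inj_def)
  ultimately show ?thesis by (simp add: drop_last_def)
qed

lemma II_last:
  assumes "B \<in> PP N"
  shows "II (N + 1) B = insert {N + 1, N + 2} B"
proof -
  have "iota (N + 1) ` p = p" if "p \<in> B" for p
  proof -
    have "iota (N + 1) x = x" if "x \<in> p" for x
      using PP_mem[OF assms \<open>p \<in> B\<close> that] by (simp add: iota_def)
    then show ?thesis by simp
  qed
  then have "(\<lambda>p. iota (N + 1) ` p) ` B = B" by simp
  then show ?thesis by (simp add: II_alt)
qed

text \<open>The new last point lies in the interval of the new pair and in those of the even pairs
  of \<open>B\<close>; the parity of this count decides.\<close>

lemma drop_last_II_last:
  assumes "B \<in> PP N"
  shows "drop_last (N + 2) (II (N + 1) B)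
    = (if even (card (even_part B)) then insert {N + 1, N + 2} B else B)"
proof -
  have "N + 2 \<in> floor_sum (N + 2) (II (N + 1) B) \<longleftrightarrow> even (card (even_part B))"
    using floor_sum_II[OF assms, of "N + 1"] depth_ends(2)[OF assms] mem_floor_sum[OF assms]
    by (auto simp: iota_def)
  moreover have "{p \<in> II (N + 1) B. N + 2 \<notin> p} = B"
    using PP_mem(2)[OF assms, of _ "N + 2"] unfolding II_last[OF assms] by auto
  ultimately show ?thesis using II_last[OF assms] by (simp add: drop_last_def)
qed

lemma card_even_part_nest:
  assumes "even D" "n \<le> D div 2"
  shows "card (even_part (nest (D + 2) 1 n)) = n"
  using even_nest_card[OF even_nest_nest[OF assms]] .

lemma drop_last_nest:
  assumes "even D" "n \<le> D div 2"
  shows "drop_last (D + 1) (nest (D + 2) 1 n) = (if odd n then nest (D + 2) 1 n else nest (D + 2) 2 n)"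
proof -
  have PP: "nest (D + 2) 1 n \<in> PP (D + 1)" using nest_PP assms .
  have n: "2 * n < D + 2" using assms by auto
  have all: "D + 1 \<in> {D + 2 - r, r} \<or> covers {D + 2 - r, r} (D + 1)" if "r \<in> {1..n}" for r
    using that n assms by (subst pair_conv_nest) auto
  have "{p \<in> nest (D + 2) 1 n. D + 1 \<in> p \<or> covers p (D + 1)} = nest (D + 2) 1 n"
    unfolding nest_def using all by blast
  moreover have "card (nest (D + 2) 1 n) = n"
    unfolding nest_def using card_image[OF nest_inj[OF n]] by simp
  ultimately have "D + 1 \<in> floor_sum (D + 1) (nest (D + 2) 1 n) \<longleftrightarrow> odd n"
    unfolding mem_floor_sum[OF PP] by simp
  moreover have "{p \<in> nest (D + 2) 1 n. D + 1 \<notin> p} = nest (D + 2) 2 n"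
  proof -
    have "D + 1 \<notin> {D + 2 - r, r} \<longleftrightarrow> 2 \<le> r" if "r \<in> {1..n}" for r using that n by auto
    then have "{p \<in> nest (D + 2) 1 n. D + 1 \<notin> p} = (\<lambda>r. {D + 2 - r, r}) ` {r \<in> {1..n}. 2 \<le> r}"
      unfolding nest_def by blast
    also have "{r \<in> {1..n}. 2 \<le> r} = {2..n}" by auto
    finally show ?thesis by (simp add: nest_def)
  qed
  ultimately show ?thesis by (simp add: drop_last_def)
qed

text \<open>The recursion for odd index \<open>D + 1\<close> inserts only at places up to
  \<open>D + 1\<close>, one fewer than the even recursion. The families built on the smaller nests
  make up for the insertions at the missing place \<open>D + 2\<close>; the others are nests of
  \<open>Pr (D + 2)\<close> after dropping.\<close>

lemma Pr_odd:
  assumes "even D"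
  shows "Pr (D + 1) = drop_last (D + 3) ` (Pr (D + 2) \<union> II (D + 2) ` Pr D)"
proof -
  have 1: "drop_last (D + 3) (nest (D + 4) 1 n) = (if odd n then nest (D + 4) 1 n else nest (D + 4) 2 n)"
    if "n \<le> (D + 2) div 2" for n
  proof -
    have "D + 2 + 1 = D + 3" "D + 2 + 2 = D + 4" by simp_all
    then show ?thesis using drop_last_nest[of "D + 2" n] that assms by (simp only: even_add even_numeral)
  qed
  have 2: "drop_last (D + 3) (II (D + 2) (nest (D + 2) 1 n))
      = (if even n then insert {D + 2, D + 3} (nest (D + 2) 1 n) else nest (D + 2) 1 n)"
    if "n \<le> D div 2" for n
  proof -
    have "D + 1 + 2 = D + 3" "D + 1 + 1 = D + 2" by simp_all
    then show ?thesis
      using drop_last_II_last[OF nest_PP[OF assms that]] card_even_part_nest[OF assms that]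
      by (simp only:)
  qed
  have e: "nest c 2 0 = {}" for c by (simp add: nest_def)
  have A: "drop_last (D + 3) ` Pr (D + 2) =
      {{}} \<union> {nest (D + 4) 2 t | t. even t \<and> t \<in> {2..(D + 2) div 2}}
      \<union> {nest (D + 4) 1 (t - 1) | t. even t \<and> t \<in> {2..(D + 4) div 2}}" (is "?L = ?R")
  proof -
    have "?L = (\<lambda>n. if odd n then nest (D + 4) 1 n else nest (D + 4) 2 n) ` {..(D + 2) div 2}"
    proof -
      have "D + 2 + 2 = D + 4" by simp
      then have Pr: "Pr (D + 2) = (\<lambda>n. nest (D + 4) 1 n) ` {..(D + 2) div 2}"
        using Pr_even[of "D + 2"] assms by (simp only: even_add even_numeral)
      show ?thesis unfolding Pr image_image by (intro image_cong refl 1) simp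
    qed
    also have "\<dots> = ?R"
    proof (intro set_eqI iffI)
      fix S assume "S \<in> (\<lambda>n. if odd n then nest (D + 4) 1 n else nest (D + 4) 2 n) ` {..(D + 2) div 2}"
      then obtain n where n: "n \<le> (D + 2) div 2"
        "S = (if odd n then nest (D + 4) 1 n else nest (D + 4) 2 n)" by auto
      have "n = 0 \<or> odd n \<or> even n \<and> 2 \<le> n" by presburger
      then consider "n = 0" | "odd n" | "even n" "2 \<le> n" by blast
      then show "S \<in> ?R"
      proof cases
        case 1
        then show ?thesis using n e by simp
      next
        case 2
        then have "S = nest (D + 4) 1 (Suc n - 1)" "even (Suc n)" "Suc n \<in> {2..(D + 4) div 2}"
          using n by (auto elim!: oddE)
        then show ?thesis by blast
      next
        case 3
        then show ?thesis using n by auto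
      qed
    next
      fix S assume "S \<in> ?R"
      then consider "S = {}" | t where "S = nest (D + 4) 2 t" "even t" "t \<in> {2..(D + 2) div 2}"
        | t where "S = nest (D + 4) 1 (t - 1)" "even t" "t \<in> {2..(D + 4) div 2}" by blast
      then show "S \<in> (\<lambda>n. if odd n then nest (D + 4) 1 n else nest (D + 4) 2 n) ` {..(D + 2) div 2}"
      proof cases
        case 1
        then show ?thesis using e by (intro image_eqI[of _ _ 0]) auto
      next
        case (2 t)
        then show ?thesis by (intro image_eqI[of _ _ t]) auto
      next
        case (3 t)
        then show ?thesis by (intro image_eqI[of _ _ "t - 1"]) auto
      qed
    qed
    finally show ?thesis .
  qed
  have B: "drop_last (D + 3) ` II (D + 2) ` Pr D =
      {{{D + 2, D + 3}}} \<union> {nest (D + 2) 1 (t - 1) | t. even t \<and> t \<in> {2..(D + 2) div 2}}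
      \<union> {insert {D + 2, D + 3} (nest (D + 2) 1 t) | t. even t \<and> t \<in> {2..D div 2}}" (is "?L = ?R")
  proof -
    let ?f = "\<lambda>n. if even n then insert {D + 2, D + 3} (nest (D + 2) 1 n) else nest (D + 2) 1 n"
    have "?L = ?f ` {..D div 2}"
      unfolding Pr_even[OF assms] image_image by (intro image_cong refl 2) simp
    also have "\<dots> = ?R"
    proof (intro set_eqI iffI)
      fix S assume "S \<in> ?f ` {..D div 2}"
      then obtain n where n: "n \<le> D div 2" "S = ?f n" by auto
      have "n = 0 \<or> odd n \<or> even n \<and> 2 \<le> n" by presburger
      then consider "n = 0" | "odd n" | "even n" "2 \<le> n" by blast
      then show "S \<in> ?R"
      proof cases
        case 1
        then show ?thesis using n by simp
      next
        case 2
        then have "S = nest (D + 2) 1 (Suc n - 1)" "even (Suc n)" "Suc n \<in> {2..(D + 2) div 2}"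
          using n by (auto elim!: oddE)
        then show ?thesis by blast
      next
        case 3
        then show ?thesis using n by auto
      qed
    next
      fix S assume "S \<in> ?R"
      then consider "S = {{D + 2, D + 3}}"
        | t where "S = nest (D + 2) 1 (t - 1)" "even t" "t \<in> {2..(D + 2) div 2}"
        | t where "S = insert {D + 2, D + 3} (nest (D + 2) 1 t)" "even t" "t \<in> {2..D div 2}" by blast
      then show "S \<in> ?f ` {..D div 2}"
      proof cases
        case 1
        then show ?thesis by (intro image_eqI[of _ _ 0]) auto
      next
        case (2 t)
        then show ?thesis by (intro image_eqI[of _ _ "t - 1"]) auto
      next
        case (3 t)
        then show ?thesis by (intro image_eqI[of _ _ t]) auto
      qed
    qed
    finally show ?thesis .
  qed
  have n: "D + 1 + 1 = D + 2" "D + 1 + 2 = D + 3" "D + 1 + 3 = D + 4" "D + 1 - 1 = D" by simp_all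
  have "Pr (D + 1) = ({{}} \<union> {nest (D + 4) 2 t | t. even t \<and> t \<in> {2..(D + 2) div 2}}
      \<union> {nest (D + 4) 1 (t - 1) | t. even t \<and> t \<in> {2..(D + 4) div 2}}) \<union>
      ({{{D + 2, D + 3}}} \<union> {nest (D + 2) 1 (t - 1) | t. even t \<and> t \<in> {2..(D + 2) div 2}}
      \<union> {insert {D + 2, D + 3} (nest (D + 2) 1 t) | t. even t \<and> t \<in> {2..D div 2}})"
    using assms unfolding Pr_def n by (simp only: if_False even_add odd_one add_is_0 one_neq_zero simp_thms) blast
  then show ?thesis unfolding image_Un A B .
qed

text \<open>Dropping commutes with all insertions except the one at the last place, so the
  recursions match up to that one, and \<open>Pr_odd\<close> accounts for it.\<close>

lemma XX_odd:
  assumes "even D"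
  shows "XX (D + 1) = drop_last (D + 3) ` XX (D + 2)"
  using assms
proof (induction D rule: less_induct)
  case (less D)
  show ?case
  proof (cases "D = 0")
    case True
    \<comment> \<open>The member \<open>{{1, 2}}\<close> added to \<open>Pr 1\<close> is the
      insertion at 1 into the empty set.\<close>
    have "drop_last 3 (II 1 {}) = II 1 (drop_last 1 {})"
      using drop_last_II[of "{}" 1 1] by (simp add: PP_def numeral_3_eq_3)
    then have 1: "drop_last 3 (II 1 {}) = {{1, 2}}" by (simp add: drop_last_def II_def numeral_2_eq_2)
    have "{1..2::nat} = {1, 2}" "XX 0 = {{}}" "Pr 0 = {{}}" by (auto simp: Pr_def)
    then have "XX 2 = Pr 2 \<union> (\<Union>k\<in>{1, 2}. II k ` {{}})" "II 2 ` Pr 0 = {II 2 {}}"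
      using XX_Suc_Suc[of 0] by (simp_all only: add_0 image_insert image_empty)
    then have "XX 2 = Pr 2 \<union> II 2 ` Pr 0 \<union> {II 1 {}}" by (simp only:) blast
    then have "drop_last 3 ` XX 2 = drop_last 3 ` (Pr 2 \<union> II 2 ` Pr 0) \<union> {{{1, 2}}}"
      by (simp only: image_Un 1 image_insert image_empty)
    then show ?thesis using Pr_odd[of 0] True by (simp add: numeral_eq_Suc)
  next
    case False
    define E where "E = D - 2"
    have D: "D = E + 2" "even E" "E < D" using False less.prems unfolding E_def by presburger+
    have IH: "XX (E + 1) = drop_last (E + 3) ` XX (E + 2)" using less.IH[OF D(3,2)] .
    have "E + 2 + 1 = E + 3" "even (E + 2)" using D(2) by simp_all
    then have PP: "B \<in> PP (E + 3)" if "B \<in> XX (E + 2)" for B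
      using XX_even_PP[of "E + 2" B] that by (simp only:)
    have swap: "II k ` XX (E + 1) = drop_last (E + 5) ` II k ` XX (E + 2)" if "k \<in> {1..E + 3}" for k
    proof -
      have "II k (drop_last (E + 3) B) = drop_last (E + 5) (II k B)" if "B \<in> XX (E + 2)" for B
        using drop_last_II[OF PP[OF that] \<open>k \<in> _\<close>] by (simp add: numeral_eq_Suc)
      then show ?thesis unfolding IH image_image by (intro image_cong refl)
    qed
    have "XX (E + 3) = Pr (E + 3) \<union> (\<Union>k\<in>{1..E + 3}. II k ` XX (E + 1))"
      using XX_Suc_Suc[of "E + 1"] by (simp add: numeral_eq_Suc)
    also have "Pr (E + 3) = drop_last (E + 5) ` (Pr (E + 4) \<union> II (E + 4) ` Pr (E + 2))"
      using Pr_odd[OF less.prems] unfolding D(1) by (simp add: numeral_eq_Suc)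
    also have "(\<Union>k\<in>{1..E + 3}. II k ` XX (E + 1)) = drop_last (E + 5) ` (\<Union>k\<in>{1..E + 3}. II k ` XX (E + 2))"
      unfolding image_UN using swap by simp
    also have "drop_last (E + 5) ` (Pr (E + 4) \<union> II (E + 4) ` Pr (E + 2))
        \<union> drop_last (E + 5) ` (\<Union>k\<in>{1..E + 3}. II k ` XX (E + 2)) = drop_last (E + 5) ` XX (E + 4)"
    proof -
      \<comment> \<open>A last-place insertion into \<open>II k C\<close> is also an insertion at
        \<open>k\<close>; only those into \<open>Pr (E + 2)\<close> remain to be listed.\<close>
      have "II (E + 4) ` XX (E + 2) \<subseteq> II (E + 4) ` Pr (E + 2) \<union> (\<Union>k\<in>{1..E + 3}. II k ` XX (E + 2))"
      proof
        fix S assume "S \<in> II (E + 4) ` XX (E + 2)"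
        then obtain B where B: "B \<in> XX (E + 2)" "S = II (E + 4) B" by blast
        show "S \<in> II (E + 4) ` Pr (E + 2) \<union> (\<Union>k\<in>{1..E + 3}. II k ` XX (E + 2))"
        proof (cases "B \<in> Pr (E + 2)")
          case True
          then show ?thesis using B by blast
        next
          case False
          then obtain k C where k: "k \<in> {1..E + 2}" "C \<in> XX E" "B = II k C"
            using B(1) unfolding XX_Suc_Suc by blast
          then have "S = II k (II (E + 4 - 2) C)" unfolding B(2) k(3) by (intro II_commute) simp
          moreover have "II (E + 4 - 2) C \<in> XX (E + 2)" using II_in_XX[OF k(2), of "E + 2"] by simp
          moreover have "k \<in> {1..E + 3}" using k(1) by simp
          ultimately show ?thesis by blast
        qed
      qed
      moreover have "II (E + 4) ` Pr (E + 2) \<subseteq> II (E + 4) ` XX (E + 2)" unfolding XX_Suc_Suc by blast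
      moreover have "XX (E + 4) = Pr (E + 4) \<union> (II (E + 4) ` XX (E + 2) \<union> (\<Union>k\<in>{1..E + 3}. II k ` XX (E + 2)))"
      proof -
        have "E + 2 + 2 = E + 4" "{1..E + 4} = insert (E + 4) {1..E + 3}" by auto
        then show ?thesis using XX_Suc_Suc[of "E + 2"] by (simp only: UN_insert)
      qed
      moreover have "S \<union> (L \<union> U) = S \<union> M \<union> U" if "L \<subseteq> M \<union> U" "M \<subseteq> L"
        for S L M U :: "nat set set set"
        using that by blast
      ultimately have "XX (E + 4) = Pr (E + 4) \<union> II (E + 4) ` Pr (E + 2) \<union> (\<Union>k\<in>{1..E + 3}. II k ` XX (E + 2))"
        by simp
      then show ?thesis by (simp only: image_Un)
    qed
    finally show ?thesis unfolding D(1) by (simp add: numeral_eq_Suc)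
  qed
qed

section \<open>The element \<open>u\<^sub>B\<close>\<close>

lemma PP_pair:
  assumes "B \<in> PP N" "p \<in> B" "x \<in> p"
  obtains y where "p = {x, y}" "x \<noteq> y"
proof -
  have "p \<in> E2 N" using assms PP_D(3) by blast
  then obtain a b where "p = {a, b}" "a < b" by (rule E2_cases)
  then show ?thesis using assms(3) that[of b] that[of a] by (auto simp: insert_commute)
qed

text \<open>The existence of the \<open>a r\<close>, \<open>b r\<close> in \<open>is_u\<close> for
  an abstract noncrossing matching \<open>R\<close>: split off the block from \<open>p\<close> to
  its mate, or the single point \<open>u\<close>, and continue to the right.\<close>

lemma tiling:
  fixes R :: "nat \<Rightarrow> nat \<Rightarrow> bool"
  assumes sym: "\<And>x y. R x y \<Longrightarrow> R y x"
    and unique: "\<And>x y z. R x y \<Longrightarrow> R x z \<Longrightarrow> y = z"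
    and irrefl: "\<And>x. \<not> R x x"
    and noncrossing: "\<And>a b x y. R a b \<Longrightarrow> R x y \<Longrightarrow> a < x \<Longrightarrow> x < b \<Longrightarrow> a < y \<and> y < b"
    and u: "\<And>a b. R a b \<Longrightarrow> u \<notin> {a..b}"
    and closed: "\<And>x. x \<in> {p..q} - {u} \<Longrightarrow> \<exists>y\<in>{p..q}. R x y"
  shows "\<exists>(m::nat) a b. (\<forall>r\<in>{1..m}. a r < b r \<and> R (a r) (b r) \<and> p \<le> a r) \<and>
    (\<forall>r\<in>{1..<m}. b r < a (r + 1)) \<and> (\<Union>r\<in>{1..m}. {a r..b r}) = {p..q} - {u}"
  using closed
proof (induction "Suc q - p" arbitrary: p rule: less_induct)
  case less
  consider "q < p" | "p \<le> q" "p = u" | "p \<le> q" "p \<noteq> u" by linarith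
  then show ?case
  proof cases
    case 1
    then show ?thesis by (intro exI[of _ 0]) auto
  next
    case 2
    have mate: "\<exists>y\<in>{p + 1..q}. R x y" if x: "x \<in> {p + 1..q} - {u}" for x
    proof -
      obtain y where y: "y \<in> {p..q}" "R x y" using less.prems[of x] x by auto
      have "y \<noteq> u" using u[OF sym[OF y(2)]] x 2 by auto
      then show ?thesis using y 2 by force
    qed
    have "Suc q - (p + 1) < Suc q - p" using 2 by simp
    from less.hyps[OF this mate] obtain m :: nat and a b where mab:
      "\<forall>r\<in>{1..m}. a r < b r \<and> R (a r) (b r) \<and> p + 1 \<le> a r"
      "\<forall>r\<in>{1..<m}. b r < a (r + 1)" "(\<Union>r\<in>{1..m}. {a r..b r}) = {p + 1..q} - {u}"
      by blast
    moreover have "{p + 1..q} - {u} = {p..q} - {u}" using 2 by auto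
    moreover have "\<forall>r\<in>{1..m}. a r < b r \<and> R (a r) (b r) \<and> p \<le> a r" using mab(1) by auto
    ultimately show ?thesis by (intro exI[of _ m] exI[of _ a] exI[of _ b]) simp
  next
    case 3
    then obtain y where y: "y \<in> {p..q}" "R p y" using less.prems[of p] by auto
    have py: "p < y" using y irrefl by (metis atLeastAtMost_iff le_neq_implies_less)
    \<comment> \<open>A mate inside the block is impossible: the ends \<open>p\<close> and
      \<open>y\<close> are matched with each other, and the arc between them is not crossed.\<close>
    have mate: "\<exists>z\<in>{y + 1..q}. R x z" if x: "x \<in> {y + 1..q} - {u}" for x
    proof -
      obtain z where z: "z \<in> {p..q}" "R x z" using less.prems[of x] x py by auto
      have "z \<noteq> p" using unique[OF y(2), of x] sym[OF z(2)] x by auto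
      moreover have "z \<noteq> y" using unique[OF sym[OF y(2)], of x] sym[OF z(2)] x py by auto
      moreover have "\<not> (p < z \<and> z < y)" using noncrossing[OF y(2) sym[OF z(2)]] x by auto
      ultimately show ?thesis using z by force
    qed
    have "Suc q - (y + 1) < Suc q - p" using y py by auto
    from less.hyps[OF this mate] obtain m :: nat and a b where
      *: "\<forall>r\<in>{1..m}. a r < b r \<and> R (a r) (b r) \<and> y + 1 \<le> a r"
      "\<forall>r\<in>{1..<m}. b r < a (r + 1)" "(\<Union>r\<in>{1..m}. {a r..b r}) = {y + 1..q} - {u}"
      by blast
    note mab = bspec[OF *(1)] bspec[OF *(2)] *(3)
    define a' where "a' r = (if r = 1 then p else a (r - 1))" for r
    define b' where "b' r = (if r = 1 then y else b (r - 1))" for r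
    have split: "{1..m + 1} = insert 1 (Suc ` {1..m})"
      by (auto simp: image_Suc_atLeastAtMost)
    have "a' r < b' r \<and> R (a' r) (b' r) \<and> p \<le> a' r" if "r \<in> {1..m + 1}" for r
    proof (cases "r = 1")
      case True
      then show ?thesis using y py by (simp add: a'_def b'_def)
    next
      case False
      then have "r - 1 \<in> {1..m}" using that by auto
      then show ?thesis using mab(1)[of "r - 1"] False py by (simp add: a'_def b'_def)
    qed
    moreover have "b' r < a' (r + 1)" if "r \<in> {1..<m + 1}" for r
    proof (cases "r = 1")
      case True
      then show ?thesis using mab(1)[of 1] that by (simp add: a'_def b'_def)
    next
      case False
      then have "r - 1 \<in> {1..<m}" using that by auto
      moreover have "r - 1 + 1 = r" "r + 1 \<noteq> 1" using that by auto
      ultimately show ?thesis using mab(2)[of "r - 1"] False by (simp only: a'_def b'_def if_False add_diff_cancel_right')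
    qed
    moreover have "(\<Union>r\<in>{1..m + 1}. {a' r..b' r}) = {p..q} - {u}"
    proof -
      have "(\<Union>r\<in>Suc ` {1..m}. {a' r..b' r}) = (\<Union>r\<in>{1..m}. {a r..b r})"
        unfolding image_image by (intro SUP_cong refl) (simp add: a'_def b'_def)
      then have "(\<Union>r\<in>{1..m + 1}. {a' r..b' r}) = {p..y} \<union> ({y + 1..q} - {u})"
        unfolding split mab(3)[symmetric] by (simp add: a'_def b'_def)
      also have "\<dots> = {p..q} - {u}" using u[OF y(2)] y(1) by auto
      finally show ?thesis .
    qed
    ultimately show ?thesis by blast
  qed
qed

text \<open>\<open>is_u\<close> quantifies over the sequence; expressing its first and last terms
  through the even part makes the interval to be tiled independent of the choice.\<close>

lemma nest_extremes:
  fixes i :: "nat \<Rightarrow> nat"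
  assumes "strict_mono_on {1..2 * s} i" "1 \<le> s" "E = (\<lambda>r. {i (2 * s + 1 - r), i r}) ` {1..s}"
  shows "\<Union>E = i ` {1..2 * s}" "Min (\<Union>E) = i 1" "Max (\<Union>E) = i (2 * s)"
proof -
  show img: "\<Union>E = i ` {1..2 * s}"
  proof
    have "i (2 * s + 1 - r) \<in> i ` {1..2 * s} \<and> i r \<in> i ` {1..2 * s}" if "r \<in> {1..s}" for r
      using that by (intro conjI imageI) auto
    then show "\<Union>E \<subseteq> i ` {1..2 * s}" unfolding assms(3) by blast
    show "i ` {1..2 * s} \<subseteq> \<Union>E"
    proof
      fix x assume "x \<in> i ` {1..2 * s}"
      then obtain r where r: "r \<in> {1..2 * s}" "x = i r" by blast
      then have "x \<in> {i (2 * s + 1 - t), i t}" "t \<in> {1..s}" if "t = (if r \<le> s then r else 2 * s + 1 - r)" for t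
        using that by (auto split: if_splits)
      then show "x \<in> \<Union>E" unfolding assms(3) by blast
    qed
  qed
  have mono: "i a \<le> i b" if "a \<in> {1..2 * s}" "b \<in> {1..2 * s}" "a \<le> b" for a b
    using strict_mono_on_leD[OF assms(1)] that by blast
  show "Min (\<Union>E) = i 1" unfolding img using assms(2) mono by (intro Min_eqI) auto
  show "Max (\<Union>E) = i (2 * s)" unfolding img using assms(2) mono by (intro Max_eqI) auto
qed

lemma i_max_nest:
  fixes s :: nat
  assumes "strict_mono_on {1..2 * s} i" "1 \<le> s" "C \<in> PP N"
    and "even_part C = (\<lambda>r. {i (2 * s + 1 - r), i r}) ` {1..s}"
  shows "i_max C = i (2 * s)"
proof -
  have "first {i (2 * s + 1 - r), i r} = i (2 * s + 1 - r)" if "r \<in> {1..s}" for r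
  proof -
    have lt: "i r < i (2 * s + 1 - r)"
      using that by (intro strict_mono_onD[OF assms(1)]) auto
    have "{i (2 * s + 1 - r), i r} \<in> even_part C" using assms(4) that by blast
    then have "even (Max {i (2 * s + 1 - r), i r} - Min {i (2 * s + 1 - r), i r})"
      unfolding even_part_PP[OF assms(3)] by blast
    then have "even (i (2 * s + 1 - r) - i r)" using lt by (simp add: max_def min_def)
    then show ?thesis using first_second_pair(1)[OF lt] by (simp add: insert_commute)
  qed
  then have img: "first ` even_part C = (\<lambda>r. i (2 * s + 1 - r)) ` {1..s}"
    unfolding assms(4) image_image by (intro image_cong) auto
  show ?thesis unfolding i_max_def img
  proof (intro Max_eqI)
    show "i (2 * s) \<in> (\<lambda>r. i (2 * s + 1 - r)) ` {1..s}"
      using assms(2) by (intro image_eqI[of _ _ 1]) auto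
    fix x assume "x \<in> (\<lambda>r. i (2 * s + 1 - r)) ` {1..s}"
    then show "x \<le> i (2 * s)" by (auto intro!: strict_mono_on_leD[OF assms(1)])
  qed simp
qed

lemma pair_covers:
  fixes a b :: nat
  assumes "a < b" "odd (Max {a, b} - Min {a, b})"
  shows "covers {a, b} x \<longleftrightarrow> a < x \<and> x \<le> b"
  using assms by (simp add: covers_pair max_def min_def)

text \<open>An odd interval containing \<open>u\<close> would have to contain the partner
  \<open>N\<close> as well, so \<open>u\<close> lies in no block. Every other point of the interval
  is paired inside it, and \<open>tiling\<close> applies.\<close>

lemma u_of_eq:
  fixes s :: nat
  assumes PP: "B \<in> PP N" and lam: "laminar N B" and N: "N = NN D"
    and uN: "{u, N} \<in> B" "u < N" and C: "C = B - {{u, N}}"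
    and i: "strict_mono_on {1..2 * s} i" "1 \<le> s"
    and ev: "even_part C = (\<lambda>r. {i (2 * s + 1 - r), i r}) ` {1..s}"
    and u: "if odd (i (2 * s)) then i (2 * s) < u else u < i 1"
  shows "u_of D C = u"
proof -
  have CB: "C \<subseteq> B" and PPC: "C \<in> PP N" using C PP PP_subset by auto
  define R where "R x y \<longleftrightarrow> {x, y} \<in> odd_part C" for x y
  have R: "R x y \<longleftrightarrow> {x, y} \<in> C \<and> odd (Max {x, y} - Min {x, y})" for x y
    unfolding R_def odd_part_PP[OF PPC] by blast
  have notin: "u \<notin> p" "N \<notin> p" if "p \<in> C" for p
    using that C PP_unique[OF PP _ uN(1), of p] by blast+
  have sym: "R x y \<Longrightarrow> R y x" for x y by (simp add: R_def insert_commute)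
  have irrefl: "\<not> R x x" for x by (simp add: R)
  have unique: "y = z" if "R x y" "R x z" for x y z
  proof -
    have "{x, y} = {x, z}" using PP_unique[OF PPC, of "{x, y}" "{x, z}" x] that R by blast
    then show ?thesis by (auto simp: doubleton_eq_iff)
  qed
  have bounds: "1 \<le> x" "x \<le> N" if "R x y" for x y
    using PP_mem[OF PPC, of "{x, y}" x] that R by auto
  have same: "covers q x \<longleftrightarrow> covers q y" if "p \<in> B" "q \<in> B" "p \<noteq> q" "x \<in> p" "y \<in> p" for p q x y
    using lam that unfolding laminar_def by blast
  have u_out: "u \<notin> {a..b}" if ab: "R a b" for a b
  proof
    assume "u \<in> {a..b}"
    moreover have "u \<noteq> a" "N \<noteq> b" using notin[of "{a, b}"] ab R by auto
    ultimately have "a < u" "u \<le> b" "a < b" by auto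
    then have "covers {a, b} u" using pair_covers[of a b u] ab R by auto
    then have "covers {a, b} N"
      using same[OF uN(1), of "{a, b}" u N] notin[of "{a, b}"] ab R CB by blast
    then have "N \<le> b" using pair_covers[of a b N] ab R \<open>a < b\<close> by auto
    then show False using bounds(2)[OF sym[OF ab]] \<open>N \<noteq> b\<close> by simp
  qed
  have noncrossing: "a < y \<and> y < b" if ab: "R a b" and xy: "R x y" and "a < x" "x < b" for a b x y
  proof -
    have cov: "covers {a, b} z \<longleftrightarrow> a < z \<and> z \<le> b" for z
      using pair_covers[of a b z] ab R that by auto
    have ne: "{x, y} \<noteq> {a, b}" using that by (auto simp: doubleton_eq_iff)
    then have "covers {a, b} y"
      using same[of "{x, y}" "{a, b}" x y] ab xy that R CB cov by auto
    moreover have "y \<noteq> b" using ne unique[OF sym[OF xy], of a] sym[OF ab] by auto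
    ultimately show ?thesis using cov by auto
  qed
  have supp_C: "x \<in> supp C" if "x \<in> supp B" "x \<noteq> u" "x \<noteq> N" for x
    using that C unfolding supp_def by auto
  have inside: "x \<in> supp C" if ab: "R a b" and x: "x \<in> {a..b}" for a b x
  proof (cases "x = a")
    case True
    then show ?thesis using ab R by (auto simp: supp_def)
  next
    case False
    then have "covers {a, b} x" using pair_covers[of a b x] ab R x by auto
    then have "x \<in> supp B"
      using lam x bounds[OF ab] bounds[OF sym[OF ab]] ab R CB unfolding laminar_def by force
    moreover have "x \<noteq> u" using u_out[OF ab] x by blast
    moreover have "x \<noteq> N" using x bounds[OF sym[OF ab]] notin[of "{a, b}"] ab R by force
    ultimately show ?thesis using supp_C by blast
  qed
  note ext = nest_extremes[OF i ev]
  define i0 i1 where "i0 = i 1" and "i1 = i (2 * s)"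
  have i01: "i0 < i1" unfolding i0_def i1_def using i(2) by (intro strict_mono_onD[OF i(1)]) auto
  define q0 where "q0 = {i0, i1}"
  have q0_ev: "q0 \<in> even_part C"
    unfolding ev q0_def i0_def i1_def using i(2) by (intro image_eqI[of _ _ 1]) (auto simp: insert_commute)
  have q0: "q0 \<in> C" "even (Max q0 - Min q0)" using q0_ev unfolding even_part_PP[OF PPC] by auto
  \<comment> \<open>The interval of the outermost even pair contains everything outside
    \<open>[i0, i1]\<close>, so by laminarity these points below \<open>N\<close> are paired in
    \<open>B\<close>.\<close>
  have cov0: "covers q0 x \<longleftrightarrow> x \<le> i0 \<or> i1 < x" for x
    using q0(2) i01 unfolding q0_def by (auto simp: covers_pair max_def min_def)
  have ev_in: "i0 \<le> x \<and> x \<le> i1" if "p \<in> even_part C" "x \<in> p" for p x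
  proof -
    have "x \<in> i ` {1..2 * s}" using ext(1) that by blast
    then show ?thesis unfolding i0_def i1_def using strict_mono_on_leD[OF i(1)] by auto
  qed
  have outer: "\<exists>y. R x y \<and> (x < i0 \<and> 1 \<le> y \<and> y < i0 \<or> i1 < x \<and> i1 < y \<and> y < N)"
    if x: "1 \<le> x" "x < N" "x \<noteq> u" "x < i0 \<or> i1 < x" for x
  proof -
    have "x \<in> supp B" using lam x cov0[of x] q0(1) CB unfolding laminar_def by force
    then have "x \<in> supp C" using supp_C x by simp
    then obtain p where p: "p \<in> C" "x \<in> p" by (auto simp: supp_def)
    obtain y where y: "p = {x, y}" "x \<noteq> y" using PP_pair[OF PPC p] .
    have odd: "odd (Max p - Min p)"
      using ev_in[of p x] p x(4) unfolding even_part_PP[OF PPC] by force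
    then have Rxy: "R x y" using p y R by simp
    have ne: "p \<noteq> q0" using odd q0(2) by auto
    have "y < i0 \<or> i1 < y"
    proof -
      have "y \<noteq> i0" using PP_unique[OF PPC p(1) q0(1), of y] y(1) ne by (auto simp: q0_def)
      moreover have "covers q0 x \<longleftrightarrow> covers q0 y"
        by (rule same[OF subsetD[OF CB p(1)] subsetD[OF CB q0(1)] ne]) (simp_all add: y(1))
      then have "y \<le> i0 \<or> i1 < y" unfolding cov0 using x(4) by linarith
      ultimately show ?thesis by linarith
    qed
    \<comment> \<open>\<open>i1\<close> belongs to an even pair, so no odd interval passes over it;
      this keeps the mate of \<open>x\<close> on the same side.\<close>
    moreover have no: "\<not> (a < i1 \<and> i1 \<le> b)" if "p = {a, b}" "a < b" for a b
    proof -
      have "\<not> covers p i1"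
        using lam q0 odd p(1) CB unfolding laminar_def q0_def by blast
      then show ?thesis using pair_covers[of a b i1] odd that by auto
    qed
    moreover have "y < N" using bounds(2)[OF sym[OF Rxy]] notin[OF p(1)] y(1) by force
    moreover have "1 \<le> y" using bounds(1)[OF sym[OF Rxy]] .
    ultimately have "x < i0 \<and> y < i0 \<or> i1 < x \<and> i1 < y"
      using no[of x y, OF y(1)] no[of y x, OF y(1)[unfolded insert_commute[of x y]]] x(4) i01 by linarith
    then show ?thesis using Rxy \<open>1 \<le> y\<close> \<open>y < N\<close> by auto
  qed
  define J where "J = (if odd i1 then {i1 + 1..N - 1} else {1..i0 - 1})"
  have u1: "1 \<le> u" using PP_mem(1)[OF PP uN(1), of u] by simp
  have i1N: "i1 < N" using notin(2)[OF q0(1)] PP_mem(2)[OF PPC q0(1), of i1] by (force simp: q0_def)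
  have uJ: "u \<in> J" using u u1 uN(2) unfolding J_def i0_def i1_def by auto
  have is_u: "is_u D C u"
  proof -
    define p q where "p = (if odd i1 then i1 + 1 else 1)" and "q = (if odd i1 then N - 1 else i0 - 1)"
    then have pq: "J = {p..q}" by (simp add: J_def)
    have closed: "\<exists>y\<in>{p..q}. R x y" if "x \<in> {p..q} - {u}" for x
    proof -
      have x: "x \<in> J" "x \<noteq> u" using that pq by auto
      then have "1 \<le> x" "x < N" "x < i0 \<or> i1 < x" using i01 i1N unfolding J_def by (auto split: if_splits)
      then obtain y where "R x y" "x < i0 \<and> 1 \<le> y \<and> y < i0 \<or> i1 < x \<and> i1 < y \<and> y < N"
        using outer[of x] x(2) by blast
      then have "y \<in> J" using x(1) i01 unfolding J_def by (auto split: if_splits)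
      then show ?thesis using \<open>R x y\<close> pq by blast
    qed
    have "\<exists>(m::nat) a b. (\<forall>r\<in>{1..m}. a r < b r \<and> R (a r) (b r) \<and> p \<le> a r) \<and>
      (\<forall>r\<in>{1..<m}. b r < a (r + 1)) \<and> (\<Union>r\<in>{1..m}. {a r..b r}) = {p..q} - {u}"
    proof (rule tiling[of R u p q])
      show "R x y \<Longrightarrow> R y x" for x y by (rule sym)
      show "R x y \<Longrightarrow> R x z \<Longrightarrow> y = z" for x y z by (rule unique)
      show "\<not> R x x" for x by (rule irrefl)
      show "R a b \<Longrightarrow> R x y \<Longrightarrow> a < x \<Longrightarrow> x < b \<Longrightarrow> a < y \<and> y < b" for a b x y by (rule noncrossing)
      show "R a b \<Longrightarrow> u \<notin> {a..b}" for a b by (rule u_out)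
      show "x \<in> {p..q} - {u} \<Longrightarrow> \<exists>y\<in>{p..q}. R x y" for x by (rule closed)
    qed
    then obtain m :: nat and a b where mab: "\<forall>r\<in>{1..m}. a r < b r \<and> R (a r) (b r) \<and> p \<le> a r"
      "\<forall>r\<in>{1..<m}. b r < a (r + 1)" "(\<Union>r\<in>{1..m}. {a r..b r}) = {p..q} - {u}"
      by blast
    have "(if odd (i (2 * s)) then {i (2 * s) + 1..NN D - 1} else {1..i 1 - 1})
        = (\<Union>r\<in>{1..m}. {a r..b r}) \<union> {u}"
    proof -
      have "(if odd (i (2 * s)) then {i (2 * s) + 1..NN D - 1} else {1..i 1 - 1}) = J"
        unfolding J_def N i0_def i1_def ..
      also have "J = {p..q} - {u} \<union> {u}" using uJ unfolding pq by blast
      finally show ?thesis unfolding mab(3) .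
    qed
    moreover have "u \<notin> (\<Union>r\<in>{1..m}. {a r..b r})" unfolding mab(3) by simp
    ultimately show ?thesis unfolding is_u_def using i ev mab(1,2) unfolding R_def
      by (intro exI[of _ s] exI[of _ i] exI[of _ m] exI[of _ a] exI[of _ b]) simp
  qed
  have "u' = u" if u': "is_u D C u'" for u'
  proof (rule ccontr)
    assume ne: "u' \<noteq> u"
    from u' obtain s' m :: nat and i' a b where s': "1 \<le> s'" "strict_mono_on {1..2 * s'} i'"
      "even_part C = (\<lambda>r. {i' (2 * s' + 1 - r), i' r}) ` {1..s'}"
      and ab: "\<forall>r\<in>{1..m}. a r < b r \<and> {a r, b r} \<in> odd_part C"
      and J': "(if odd (i' (2 * s')) then {i' (2 * s') + 1..NN D - 1} else {1..i' 1 - 1})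
         = (\<Union>r\<in>{1..m}. {a r..b r}) \<union> {u'}"
      unfolding is_u_def by (elim exE conjE)
    \<comment> \<open>Another sequence for the same even part has the same ends, so it yields the
      same \<open>J\<close>; a different \<open>u'\<close> would put \<open>u\<close> into a
      block.\<close>
    have ends: "i' 1 = i0" "i' (2 * s') = i1"
      using nest_extremes[OF s'(2,1,3)] ext unfolding i0_def i1_def by simp_all
    have "J = (\<Union>r\<in>{1..m}. {a r..b r}) \<union> {u'}" using J' unfolding J_def N ends .
    then obtain r where r: "r \<in> {1..m}" "u \<in> {a r..b r}" using uJ ne by blast
    then show False using u_out[of "a r" "b r"] ab unfolding R_def by blast
  qed
  then show ?thesis unfolding u_of_def using is_u by (rule the_equality[rotated])
qed

section \<open>The odd case\<close>

text \<open>The intervals through \<open>N\<close> are those of the even pairs together with that of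
  \<open>{x, N}\<close>, which is an additional one exactly when its difference is odd.\<close>

lemma last_in_floor_sum_iff:
  assumes "B \<in> PP N" "{x, N} \<in> B" "x < N"
  shows "N \<in> floor_sum N B \<longleftrightarrow> (odd (N - x) \<longleftrightarrow> even (card (even_part B)))"
proof -
  have fin: "finite (even_part B)" using PP_D(1)[OF assms(1)] by (simp add: even_part_def)
  have N: "N \<in> {1..N}" using assms(3) by simp
  have par: "even (Max {x, N} - Min {x, N}) \<longleftrightarrow> even (N - x)" using assms(3) by (simp add: max_def min_def)
  have iff: "N \<in> p \<or> covers p N \<longleftrightarrow> p \<in> insert {x, N} (even_part B)" if p: "p \<in> B" for p
  proof (cases "p = {x, N}")
    case True
    then show ?thesis by simp
  next
    case False
    then have "N \<notin> p" using PP_unique[OF assms(1) p assms(2), of N] by blast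
    have "p \<in> E2 N" using p PP_D(3)[OF assms(1)] by blast
    then obtain a b where ab: "p = {a, b}" "a < b" "b \<le> N" by (rule E2_cases)
    then have "b < N" using \<open>N \<notin> p\<close> by auto
    then have "covers p N \<longleftrightarrow> even (Max p - Min p)" using ab by (auto simp: covers_pair max_def min_def)
    then show ?thesis using \<open>N \<notin> p\<close> False p unfolding even_part_PP[OF assms(1)] by auto
  qed
  have "{p \<in> B. N \<in> p \<or> covers p N} = insert {x, N} (even_part B)"
    using iff assms(2) unfolding even_part_PP[OF assms(1)] by blast
  moreover have "{x, N} \<in> even_part B \<longleftrightarrow> even (N - x)"
    unfolding even_part_PP[OF assms(1)] using par assms(2) by simp
  ultimately have "N \<in> floor_sum N B \<longleftrightarrow> odd (card (insert {x, N} (even_part B)))"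
    using N unfolding mem_floor_sum[OF assms(1)] by simp
  then show ?thesis
    using fin \<open>{x, N} \<in> even_part B \<longleftrightarrow> even (N - x)\<close>
    by (cases "{x, N} \<in> even_part B") (simp_all add: insert_absorb)
qed

lemma last_mate:
  assumes "B \<in> PP N" "N \<in> supp B"
  obtains x where "{x, N} \<in> B" "1 \<le> x" "x < N"
proof -
  obtain p where p: "p \<in> B" "N \<in> p" using assms(2) by (auto simp: supp_def)
  obtain x where x: "p = {N, x}" "N \<noteq> x" using PP_pair[OF assms(1) p] .
  have "{x, N} \<in> B" "1 \<le> x" "x \<le> N"
    using x p PP_mem[OF assms(1) p(1), of x] by (auto simp: insert_commute)
  then show ?thesis using that[of x] x(2) by simp
qed

text \<open>The interval of an even pair passes through the cut and contains \<open>N\<close>, which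
  laminarity would force to be paired.\<close>

lemma no_even_part_if_last_free:
  assumes "B \<in> PP N" "laminar N B" "N \<notin> supp B" "1 \<le> N"
  shows "even_part B = {}"
proof (rule ccontr)
  assume "even_part B \<noteq> {}"
  then obtain p where p: "p \<in> B" "even (Max p - Min p)" unfolding even_part_PP[OF assms(1)] by blast
  then have "N \<notin> p" using assms(3) by (auto simp: supp_def)
  have "p \<in> E2 N" using p PP_D(3)[OF assms(1)] by blast
  then obtain a b where ab: "p = {a, b}" "a < b" "b \<le> N" by (rule E2_cases)
  then have "b < N" using \<open>N \<notin> p\<close> by auto
  then have "covers p N" using ab p(2) by (auto simp: covers_pair max_def min_def)
  then show False using assms(2-4) p(1) unfolding laminar_def by force
qed

lemma vsum_remove:
  assumes "finite B" "p \<in> B"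
  shows "vsum f B = vadd (f p) (vsum f (B - {p}))"
  unfolding vsum_def using assms by (rule vadd.remove)

text \<open>If the pair \<open>{u, N}\<close> is dropped, then \<open>u = u\<^sub>C\<close>, and the correction term of \<open>eps\<close> restores
  the interval of the dropped pair.\<close>

lemma drop_last_data:
  fixes D :: nat
  assumes D: "odd D" and B: "B \<in> XX (D + 1)"
  defines "N \<equiv> D + 2" and "C \<equiv> drop_last (D + 2) B"
  defines "X \<equiv> floor_sum (D + 2) B"
  shows "eps D C = X" and "N \<in> supp C \<longleftrightarrow> N \<in> X"
    and "N \<in> X \<Longrightarrow> card (even_part C) = 0 \<and> gamma X = 0
      \<or> card (even_part C) > 0 \<and> i_max C \<noteq> N \<and> gamma X = int (card (even_part C))
      \<or> card (even_part C) > 0 \<and> i_max C = N \<and> gamma X = - int (card (even_part C)) - 1"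
    and "N \<notin> X \<Longrightarrow> card (even_part C) = 0 \<and> gamma X = 0
      \<or> card (even_part C) > 0 \<and> odd (i_max C) \<and> gamma X = - int (card (even_part C)) - 1
      \<or> card (even_part C) > 0 \<and> even (i_max C) \<and> gamma X = int (card (even_part C)) + 1"
proof -
  have NN: "NN D = N" using D by (simp add: N_def NN_def)
  have N2: "D + 1 + 1 = N" by (simp add: N_def)
  have even: "even (D + 1)" using D by simp
  have PP: "B \<in> PP N" using XX_even_PP[OF even B] unfolding N2 .
  have lam: "laminar N B" using XX_even_laminar[OF B even] unfolding N2 .
  have CB: "C \<subseteq> B" unfolding C_def by (rule drop_last_subset)
  have PPC: "C \<in> PP N" using PP_subset[OF PP CB] .
  have CX: "C \<in> XX D"
  proof -
    have "D - 1 + 1 = D" "D - 1 + 3 = D + 2" "D - 1 + 2 = D + 1" "even (D - 1)" using D by (auto elim!: oddE)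
    then show ?thesis using XX_odd[of "D - 1"] B unfolding C_def by (simp only: imageI)
  qed
  have X_span: "X \<in> vspan B"
    using XX_even_floor_sum_in_vspan[OF B even] unfolding N2 X_def N_def .
  have X_supp: "X \<subseteq> supp B" using X_span unfolding vspan_PP[OF PP] supp_def by blast
  have X_EE: "X \<in> EE N" using vspan_subset_EE[OF PP X_span] .
  have X_N: "X = floor_sum N B" unfolding X_def N_def ..
  have even_gam: "even (gamma X)" using even_gamma[OF X_EE] .
  have gam: "int (card (even_part B)) = (if gamma X \<ge> 0 then gamma X else - gamma X - 1)"
    using gamma_floor_sum[OF B even] unfolding N2 X_N .
  obtain i n where i: "even_nest i n B" using XX_even_nest[OF B even] by blast
  have n: "card (even_part B) = n" using even_nest_card[OF i] .
  have mono: "strict_mono_on {1..2 * n} i"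
    and ev: "even_part B = (\<lambda>r. {i (2 * n + 1 - r), i r}) ` {1..n}"
    and par: "r \<in> {1..n} \<Longrightarrow> (even (i r) \<longleftrightarrow> even r) \<and> (even (i (2 * n + 1 - r)) \<longleftrightarrow> even r)" for r
    using i unfolding even_nest_def by blast+
  \<comment> \<open>As gamma is even, the parity of \<open>n\<close> decides between the two cases
    of \<open>gam\<close>.\<close>
  have gam_even: "gamma X = int n" if "even n" using gam even_gam that unfolding n by presburger
  have gam_odd: "gamma X = - int n - 1" if "odd n" using gam even_gam that unfolding n by presburger
  have C_keep: "C = B" if "N \<in> X \<or> N \<notin> supp B"
    using that unfolding C_def drop_last_def X_N N_def supp_def by auto
  have floor_C: "vsum (floor2 (NN D)) C = X" if "C = B" using that unfolding NN X_N by simp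
  have keep: "eps D C = X \<and> (N \<in> supp C \<longleftrightarrow> N \<in> X)" if "N \<in> X \<or> N \<notin> supp B"
  proof -
    have CeqB: "C = B" using C_keep[OF that] .
    \<comment> \<open>A kept member without \<open>N\<close> in its support has empty even part,
      whereas \<open>t - 1\<close> and \<open>- t - 1\<close> are odd.\<close>
    have "C \<notin> Xplus_piece D t" if t: "even t" "t \<noteq> 0" for t
    proof
      assume C: "C \<in> Xplus_piece D t"
      then have "N \<notin> supp B" using CeqB NN by (simp add: Xplus_piece_def Xplus_def)
      then have "even_part B = {}" using no_even_part_if_last_free[OF PP lam] by (simp add: N_def)
      then show False using C t CeqB by (auto simp: Xplus_piece_def split: if_splits)
    qed
    then have "underline D C = {}" unfolding underline_def by force
    then have "eps D C = X" unfolding eps_def floor_C[OF CeqB] by (simp add: vadd_def)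
    then show ?thesis using that X_supp CeqB by blast
  qed
  have drop: "eps D C = X \<and> N \<notin> supp C \<and> (card (even_part C) = 0 \<and> gamma X = 0
      \<or> card (even_part C) > 0 \<and> odd (i_max C) \<and> gamma X = - int (card (even_part C)) - 1
      \<or> card (even_part C) > 0 \<and> even (i_max C) \<and> gamma X = int (card (even_part C)) + 1)"
    if NX: "N \<notin> X" and NB: "N \<in> supp B"
  proof -
    obtain u where u: "{u, N} \<in> B" "1 \<le> u" "u < N" using last_mate[OF PP NB] .
    have C: "C = B - {{u, N}}"
    proof -
      have "N \<in> p \<longleftrightarrow> p = {u, N}" if "p \<in> B" for p using PP_unique[OF PP that u(1), of N] by blast
      then show ?thesis using NX unfolding C_def drop_last_def X_N N_def by auto
    qed
    have NC: "N \<notin> supp C" using C PP_unique[OF PP _ u(1), of _ N] unfolding supp_def by blast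
    have Xplus: "C \<in> Xplus D" using CX NC NN by (simp add: Xplus_def)
    have sum: "X = vadd (vsum (floor2 N) C) (floor2 N {u, N})"
      using vsum_remove[OF PP_D(1)[OF PP] u(1)] unfolding X_N C by (simp add: vadd.commute)
    have par_uN: "even (Max {u, N} - Min {u, N}) \<longleftrightarrow> even (N - u)" using u(3) by (simp add: max_def min_def)
    have ev_C: "even_part C = even_part B - {{u, N}}"
      unfolding even_part_PP[OF PPC] even_part_PP[OF PP] using C by blast
    show ?thesis
    proof (cases "odd (N - u)")
      case True
      \<comment> \<open>The dropped pair has odd difference: \<open>n\<close> is odd, the even part
        is unchanged, and \<open>u\<close> lies beyond its largest element, which is odd.\<close>
      then have "odd n" using NX last_in_floor_sum_iff[OF PP u(1,3)] unfolding X_N n by simp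
      then have n1: "1 \<le> n" by (cases n) auto
      have ev_C': "even_part C = (\<lambda>r. {i (2 * n + 1 - r), i r}) ` {1..n}"
        using True par_uN unfolding ev_C ev[symmetric] even_part_PP[OF PP] by blast
      have card_C: "card (even_part C) = n" using ev_C' ev n by simp
      have i_max: "i_max C = i (2 * n)" using i_max_nest[OF mono n1 PPC ev_C'] .
      have odd_max: "odd (i (2 * n))" using par[of 1] n1 by simp
      have top: "{i (2 * n), i 1} \<in> even_part C" unfolding ev_C' using n1 by (intro image_eqI[of _ _ 1]) auto
      then have "i (2 * n) \<noteq> u"
        using PP_unique[OF PP _ u(1), of "{i (2 * n), i 1}" u] C unfolding even_part_PP[OF PPC] by auto
      moreover have "\<not> covers {u, N} (i (2 * n))"
      proof -
        have "{i (2 * n), i 1} \<in> B" "even (Max {i (2 * n), i 1} - Min {i (2 * n), i 1})"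
          using top C unfolding even_part_PP[OF PPC] by blast+
        then show ?thesis using lam u(1) True par_uN unfolding laminar_def by blast
      qed
      moreover have "i (2 * n) \<le> N"
        using PP_mem(2)[OF PPC, of "{i (2 * n), i 1}"] top unfolding even_part_PP[OF PPC] by blast
      ultimately have "i (2 * n) < u" using pair_covers[OF u(3)] True par_uN by auto
      then have u_of: "u_of D C = u"
        using u_of_eq[OF PP lam NN[symmetric] u(1,3) C mono n1 ev_C'] odd_max by simp
      define t where "t = - int n - 1"
      have "even t" "t < 0" "C \<in> Xplus_piece D t"
        using \<open>odd n\<close> Xplus card_C i_max odd_max unfolding t_def by (auto simp: Xplus_piece_def)
      then have "underline D C = {u..N}" unfolding underline_def u_of NN using D by auto
      moreover have "floor2 N {u, N} = {u..N}"
        using u(3) True by (simp add: floor2_def first_second_pair)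
      ultimately have "eps D C = X" unfolding eps_def NN sum by simp
      then show ?thesis using NC card_C n1 i_max odd_max gam_odd[OF \<open>odd n\<close>] by simp
    next
      case False
      \<comment> \<open>The dropped pair has even difference: \<open>n\<close> is even, and as the
        pair contains \<open>N\<close> it is the outermost one of the even part. Its removal cuts
        off both ends of the sequence \<open>i\<close>.\<close>
      then have "even n" using NX last_in_floor_sum_iff[OF PP u(1,3)] unfolding X_N n by simp
      have uN_ev: "{u, N} \<in> even_part B" using u(1) False par_uN unfolding even_part_PP[OF PP] by blast
      then have "n \<noteq> 0" using ev by auto
      then have n2: "2 \<le> n" using \<open>even n\<close> by (cases "n = 1") auto
      then have n1: "1 \<le> n" by simp
      note ext = nest_extremes[OF mono n1 ev]
      have "\<Union>(even_part B) \<subseteq> {1..N}"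
        using PP_D(3)[OF PP] unfolding even_part_PP[OF PP] E2_def by blast
      moreover from this have "finite (\<Union>(even_part B))" by (rule finite_subset) simp
      moreover have "N \<in> \<Union>(even_part B)" using uN_ev by blast
      ultimately have "Max (\<Union>(even_part B)) = N" by (intro Max_eqI) auto
      then have iN: "i (2 * n) = N" using ext(3) by simp
      have "{i (2 * n), i 1} \<in> even_part B" unfolding ev using n1 by (intro image_eqI[of _ _ 1]) auto
      then have "{i (2 * n), i 1} = {u, N}"
        using PP_unique[OF PP _ u(1), of "{i (2 * n), i 1}" N] iN unfolding even_part_PP[OF PP] by auto
      then have iu: "i 1 = u" using iN u(3) by (auto simp: doubleton_eq_iff)
      define j where "j r = i (r + 1)" for r
      define s where "s = n - 1"
      have s: "1 \<le> s" "n = s + 1" using n2 by (auto simp: s_def)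
      have mono_j: "strict_mono_on {1..2 * s} j"
        unfolding j_def using s by (intro strict_mono_onI strict_mono_onD[OF mono]) auto
      have inj: "inj_on (\<lambda>r. {i (2 * n + 1 - r), i r}) {1..n}"
        using n unfolding ev by (intro eq_card_imp_inj_on) auto
      have ev_C': "even_part C = (\<lambda>r. {j (2 * s + 1 - r), j r}) ` {1..s}"
      proof -
        have "even_part C = (\<lambda>r. {i (2 * n + 1 - r), i r}) ` ({1..n} - {1})"
        proof -
          have "{{u, N}} = (\<lambda>r. {i (2 * n + 1 - r), i r}) ` {1}" using iN iu by (simp add: insert_commute)
          then show ?thesis
            unfolding ev_C ev using inj_on_image_set_diff[OF inj, of "{1..n}" "{1}"] n1 by auto
        qed
        also have "{1..n} - {1} = Suc ` {1..s}" using s by (auto simp: image_Suc_atLeastAtMost)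
        also have "(\<lambda>r. {i (2 * n + 1 - r), i r}) ` Suc ` {1..s} = (\<lambda>r. {j (2 * s + 1 - r), j r}) ` {1..s}"
          unfolding image_image
        proof (intro image_cong refl)
          fix r assume "r \<in> {1..s}"
          then have "2 * n + 1 - Suc r = 2 * s + 1 - r + 1" using s by (simp add: Suc_diff_le)
          then show "{i (2 * n + 1 - Suc r), i (Suc r)} = {j (2 * s + 1 - r), j r}"
            unfolding j_def by (simp only: Suc_eq_plus1)
        qed
        finally show ?thesis .
      qed
      have card_C: "card (even_part C) = s"
        using uN_ev n s PP_D(1)[OF PP] unfolding ev_C by (simp add: even_part_def)
      have i_max: "i_max C = j (2 * s)" using i_max_nest[OF mono_j s(1) PPC ev_C'] .
      have even_max: "even (j (2 * s))"
      proof -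
        have "2 * s + 1 = 2 * n + 1 - 2" using s by simp
        then show ?thesis using par[of 2] n2 unfolding j_def by simp
      qed
      have "u < j 1" unfolding j_def iu[symmetric] using n2 by (intro strict_mono_onD[OF mono]) auto
      then have u_of: "u_of D C = u"
        using u_of_eq[OF PP lam NN[symmetric] u(1,3) C mono_j s(1) ev_C'] even_max by simp
      \<comment> \<open>\<open>underline\<close> tests negative \<open>t\<close> first, so these
        must be excluded before the positive branch applies.\<close>
      have "C \<notin> Xplus_piece D t" if "t < 0" for t
        using that i_max even_max by (auto simp: Xplus_piece_def)
      moreover define t where "t = int n"
      have "even t" "t > 0" "C \<in> Xplus_piece D t"
        using \<open>even n\<close> Xplus card_C i_max even_max s unfolding t_def by (auto simp: Xplus_piece_def)
      ultimately have "underline D C = {N} \<union> {1..u}" unfolding underline_def u_of NN using D by auto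
      moreover have "floor2 N {u, N} = {N} \<union> {1..u}"
        using u(3) False by (simp add: floor2_def first_second_pair)
      ultimately have "eps D C = X" unfolding eps_def NN sum by simp
      then show ?thesis using NC card_C s i_max even_max gam_even[OF \<open>even n\<close>] by simp
    qed
  qed
  show "eps D C = X" using keep drop by blast
  show "N \<in> supp C \<longleftrightarrow> N \<in> X" using keep drop by blast
  show "card (even_part C) = 0 \<and> gamma X = 0
      \<or> card (even_part C) > 0 \<and> odd (i_max C) \<and> gamma X = - int (card (even_part C)) - 1
      \<or> card (even_part C) > 0 \<and> even (i_max C) \<and> gamma X = int (card (even_part C)) + 1" if "N \<notin> X"
  proof (cases "N \<in> supp B")
    case True
    then show ?thesis using drop that by blast
  next
    case False
    then have "even_part C = {}"
      using C_keep no_even_part_if_last_free[OF PP lam] by (simp add: N_def)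
    then show ?thesis using False C_keep gam even_gam by (auto split: if_splits)
  qed
  show "card (even_part C) = 0 \<and> gamma X = 0
      \<or> card (even_part C) > 0 \<and> i_max C \<noteq> N \<and> gamma X = int (card (even_part C))
      \<or> card (even_part C) > 0 \<and> i_max C = N \<and> gamma X = - int (card (even_part C)) - 1" if NX: "N \<in> X"
  proof -
    have CeqB: "C = B" using C_keep NX by blast
    obtain x where x: "{x, N} \<in> B" "1 \<le> x" "x < N" using last_mate[OF PP] X_supp NX by blast
    have par_xN: "even (Max {x, N} - Min {x, N}) \<longleftrightarrow> even (N - x)" using x(3) by (simp add: max_def min_def)
    have iff: "odd (N - x) \<longleftrightarrow> even n" using NX last_in_floor_sum_iff[OF PP x(1,3)] unfolding X_N n by simp
    show ?thesis
    proof (cases "n = 0")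
      case True
      then show ?thesis using gam_even CeqB n by simp
    next
      case False
      then have n1: "1 \<le> n" by simp
      note ext = nest_extremes[OF mono n1 ev]
      have i_max: "i_max C = Max (\<Union>(even_part B))"
        using i_max_nest[OF mono n1 PP ev] ext(3) CeqB by simp
      have sub: "\<Union>(even_part B) \<subseteq> {1..N}"
        using PP_D(3)[OF PP] unfolding even_part_PP[OF PP] E2_def by blast
      then have fin: "finite (\<Union>(even_part B))" using finite_subset by blast
      have "\<Union>(even_part B) \<noteq> {}" unfolding ext(1) using n1 by auto
      then have "i_max C \<in> \<Union>(even_part B)" unfolding i_max using fin by (rule Max_in[rotated])
      then obtain p where p: "p \<in> B" "even (Max p - Min p)" "i_max C \<in> p"
        unfolding even_part_PP[OF PP] by blast
      show ?thesis
      proof (cases "even n")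
        case True
        then have "i_max C \<noteq> N" using PP_unique[OF PP p(1) x(1), of N] p(2,3) par_xN iff by auto
        then show ?thesis using gam_even[OF True] False CeqB n by simp
      next
        case odd: False
        then have "{x, N} \<in> even_part B" using x(1) par_xN iff unfolding even_part_PP[OF PP] by blast
        then have "N \<in> \<Union>(even_part B)" by blast
        then have "i_max C = N" unfolding i_max using fin sub by (intro Max_eqI) auto
        then show ?thesis using gam_odd[OF odd] False CeqB n by simp
      qed
    qed
  qed
qed

section \<open>Both parities together\<close>

lemma XX_odd_conv_drop_last:
  assumes "odd D"
  shows "XX D = drop_last (D + 2) ` XX (D + 1)"
proof -
  have "D - 1 + 1 = D" "D - 1 + 3 = D + 2" "D - 1 + 2 = D + 1" "even (D - 1)"
    using assms by (auto elim!: oddE)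
  then show ?thesis using XX_odd[of "D - 1"] by (simp only:)
qed

lemma finite_XX: "finite (XX D)"
proof -
  have "PP (NN D) \<subseteq> Pow (Pow {1..NN D})" by (auto simp: PP_def E2_def)
  then show ?thesis
    using XX_subset_PP[of D] by (meson finite_Pow_iff finite_atLeastAtMost finite_subset)
qed

text \<open>For odd \<open>D\<close> the facts are transported along \<open>drop_last\<close>:
  composed with it, \<open>eps D\<close> is the map of the even case, and the smaller span inherits
  the weight comparison from the larger one.\<close>

lemma eps_properties:
  shows eps_bij: "bij_betw (eps D) (XX D) (EE (NN D))"
    and eps_in_vspan: "B \<in> XX D \<Longrightarrow> eps D B \<in> vspan B"
    and weight_less_eps: "B \<in> XX D \<Longrightarrow> X \<in> vspan B \<Longrightarrow> X \<noteq> eps D B \<Longrightarrow> weight (NN D) X < weight (NN D) (eps D B)"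
proof -
  have "bij_betw (eps D) (XX D) (EE (NN D)) \<and> (\<forall>B\<in>XX D. eps D B \<in> vspan B \<and>
    (\<forall>X\<in>vspan B. X \<noteq> eps D B \<longrightarrow> weight (NN D) X < weight (NN D) (eps D B)))"
  proof (cases "even D")
    case True
    then have "NN D = D + 1" "eps D = floor_sum (D + 1)" by (auto simp: NN_def eps_even)
    then show ?thesis
      using floor_sum_bij[OF True] XX_even_floor_sum_in_vspan[OF _ True] weight_less[OF _ True]
      by (simp only:) blast
  next
    case False
    have even: "even (D + 1)" and N: "NN D = D + 2" "D + 1 + 1 = D + 2"
      using False by (simp_all add: NN_def)
    let ?f = "drop_last (D + 2)"
    have eps: "eps D (?f B) = floor_sum (D + 2) B" if "B \<in> XX (D + 1)" for B
      using drop_last_data(1)[OF False that] .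
    have bij: "bij_betw (floor_sum (D + 2)) (XX (D + 1)) (EE (D + 2))"
      using floor_sum_bij[OF even] unfolding N(2) .
    have "inj_on (eps D) (?f ` XX (D + 1))"
      using bij eps by (auto simp: bij_betw_def inj_on_def)
    moreover have "eps D ` ?f ` XX (D + 1) = EE (D + 2)"
      using bij eps by (simp add: bij_betw_def image_image)
    moreover have "eps D (?f B) \<in> vspan (?f B)" "\<And>X. X \<in> vspan (?f B) \<Longrightarrow> X \<noteq> eps D (?f B) \<Longrightarrow>
      weight (D + 2) X < weight (D + 2) (eps D (?f B))" if B: "B \<in> XX (D + 1)" for B
    proof -
      have PP: "B \<in> PP (D + 2)" using XX_even_PP[OF even B] unfolding N(2) .
      have sub: "?f B \<subseteq> B" by (rule drop_last_subset)
      note PPf = PP_subset[OF PP sub]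
      have "floor_sum (D + 2) B \<in> vspan B"
        using XX_even_floor_sum_in_vspan[OF B even] unfolding N(2) .
      then obtain P where P: "P \<subseteq> B" "floor_sum (D + 2) B = \<Union>P" unfolding vspan_PP[OF PP] by blast
      \<comment> \<open>If \<open>N\<close> is not in the vector, no pair of \<open>P\<close>
        contains \<open>N\<close>, so dropping spares \<open>P\<close>.\<close>
      then have "P \<subseteq> ?f B" by (auto simp: drop_last_def)
      then show "eps D (?f B) \<in> vspan (?f B)" unfolding eps[OF B] vspan_PP[OF PPf] P(2) by blast
      fix X assume X: "X \<in> vspan (?f B)" "X \<noteq> eps D (?f B)"
      then have "X \<in> vspan B" using sub unfolding vspan_PP[OF PPf] vspan_PP[OF PP] by blast
      then show "weight (D + 2) X < weight (D + 2) (eps D (?f B))"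
        using weight_less[OF B even, of X] X(2) unfolding eps[OF B] N(2) by blast
    qed
    ultimately show ?thesis unfolding XX_odd_conv_drop_last[OF False] N(1) bij_betw_def by blast
  qed
  then show "bij_betw (eps D) (XX D) (EE (NN D))" "B \<in> XX D \<Longrightarrow> eps D B \<in> vspan B"
    "B \<in> XX D \<Longrightarrow> X \<in> vspan B \<Longrightarrow> X \<noteq> eps D B \<Longrightarrow> weight (NN D) X < weight (NN D) (eps D B)"
    by blast+
qed

text \<open>The size of the even part is even for nonnegative gamma and odd for negative gamma, so
  it recovers gamma with its sign.\<close>

lemma eps_bij_even_piece:
  assumes "even D" "even t"
  shows "bij_betw (eps D) (Xeven D t) (Eeven D t)"
proof (rule bij_betw_restrict[OF eps_bij])
  have "B \<in> Xeven D t \<longleftrightarrow> eps D B \<in> Eeven D t" if B: "B \<in> XX D" for B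
  proof -
    have EE: "eps D B \<in> EE (NN D)" using bij_betw_apply[OF eps_bij B] .
    have "int (card (even_part B)) = (if gamma (eps D B) \<ge> 0 then gamma (eps D B) else - gamma (eps D B) - 1)"
      using gamma_floor_sum[OF B assms(1)] unfolding eps_even[OF assms(1)] .
    moreover have "even (gamma (eps D B))" using even_gamma[OF EE] .
    ultimately have "int (card (even_part B)) = (if t \<ge> 0 then t else - t - 1) \<longleftrightarrow> gamma (eps D B) = t"
      using assms(2) by presburger
    then show ?thesis using B EE by (simp add: Xeven_def Eeven_def)
  qed
  then show "Xeven D t = {B \<in> XX D. eps D B \<in> Eeven D t}" unfolding Xeven_def by blast
qed (auto simp: Eeven_def)

lemma supp_iff_mem_eps:
  assumes "odd D" "B \<in> XX D"
  shows "NN D \<in> supp B \<longleftrightarrow> NN D \<in> eps D B"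
proof -
  have "NN D = D + 2" using assms(1) by (simp add: NN_def)
  then show ?thesis
    using assms drop_last_data(1,2)[OF assms(1)] unfolding XX_odd_conv_drop_last[OF assms(1)] by auto
qed

lemma eps_bij_signed:
  assumes "odd D"
  shows "bij_betw (eps D) (Xplus D) (Eplus D)" "bij_betw (eps D) (Xminus D) (Eminus D)"
proof -
  have EE: "eps D B \<in> EE (NN D)" if "B \<in> XX D" for B using bij_betw_apply[OF eps_bij that] .
  have "Xplus D = {B \<in> XX D. eps D B \<in> Eplus D}" "Xminus D = {B \<in> XX D. eps D B \<in> Eminus D}"
    using supp_iff_mem_eps[OF assms] EE by (auto simp: Xplus_def Xminus_def Eplus_def Eminus_def)
  moreover have "Eplus D \<subseteq> EE (NN D)" "Eminus D \<subseteq> EE (NN D)" by (auto simp: Eplus_def Eminus_def)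
  ultimately show "bij_betw (eps D) (Xplus D) (Eplus D)" "bij_betw (eps D) (Xminus D) (Eminus D)"
    by (simp_all only: bij_betw_restrict[OF eps_bij refl])
qed

text \<open>Evenness of \<open>t\<close> excludes 1 and -1, which would ask for an empty even part
  just as \<open>t = 0\<close> does.\<close>

lemma plus_piece_index:
  fixes c :: nat and g t :: int
  assumes "c = 0 \<and> g = 0 \<or> c > 0 \<and> \<not> P \<and> g = - int c - 1 \<or> c > 0 \<and> P \<and> g = int c + 1" "even t"
  shows "(if t = 0 then c = 0 else if t > 0 then int c = t - 1 \<and> P else int c = - t - 1 \<and> \<not> P) \<longleftrightarrow> g = t"
proof -
  have "t \<noteq> 1" "t \<noteq> - 1" using assms(2) by auto
  then show ?thesis using assms(1) by (elim disjE) auto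
qed

lemma minus_piece_index:
  fixes c :: nat and g t :: int
  assumes "c = 0 \<and> g = 0 \<or> c > 0 \<and> \<not> P \<and> g = int c \<or> c > 0 \<and> P \<and> g = - int c - 1" "even t"
  shows "(if t = 0 then c = 0 else if t > 0 then int c = t \<and> \<not> P else int c = - t - 1 \<and> P) \<longleftrightarrow> g = t"
proof -
  have "t \<noteq> 1" "t \<noteq> - 1" using assms(2) by auto
  then show ?thesis using assms(1) by (elim disjE) auto
qed

lemma eps_bij_signed_pieces:
  assumes D: "odd D" and t: "even t"
  shows "bij_betw (eps D) (Xplus_piece D t) (Eplus_piece D t)"
    "bij_betw (eps D) (Xminus_piece D t) (Eminus_piece D t)"
proof -
  have N: "NN D = D + 2" using D by (simp add: NN_def)
  have EE: "eps D C \<in> EE (D + 2)" if "C \<in> XX D" for C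
    using bij_betw_apply[OF eps_bij that] unfolding N .
  have "(C \<in> Xplus_piece D t \<longleftrightarrow> eps D C \<in> Eplus_piece D t) \<and>
      (C \<in> Xminus_piece D t \<longleftrightarrow> eps D C \<in> Eminus_piece D t)" if C: "C \<in> XX D" for C
  proof -
    obtain B where B: "B \<in> XX (D + 1)" "C = drop_last (D + 2) B"
      using C unfolding XX_odd_conv_drop_last[OF D] by blast
    note data = drop_last_data[OF D B(1), folded B(2)]
    show ?thesis
    proof (cases "D + 2 \<in> eps D C")
      case True
      then have "(if t = 0 then card (even_part C) = 0
          else if t > 0 then int (card (even_part C)) = t \<and> i_max C \<noteq> D + 2
          else int (card (even_part C)) = - t - 1 \<and> i_max C = D + 2) \<longleftrightarrow> gamma (eps D C) = t"
        using minus_piece_index[OF _ t, of "card (even_part C)" "gamma (eps D C)" "i_max C = D + 2"] data(3)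
        unfolding data(1) by blast
      then show ?thesis using True data(1,2) C EE[OF C]
        by (auto simp: Xplus_piece_def Xminus_piece_def Xplus_def Xminus_def
            Eplus_piece_def Eminus_piece_def Eplus_def Eminus_def N)
    next
      case False
      then have "(if t = 0 then card (even_part C) = 0
          else if t > 0 then int (card (even_part C)) = t - 1 \<and> even (i_max C)
          else int (card (even_part C)) = - t - 1 \<and> odd (i_max C)) \<longleftrightarrow> gamma (eps D C) = t"
        using plus_piece_index[OF _ t, of "card (even_part C)" "gamma (eps D C)" "even (i_max C)"] data(4)
        unfolding data(1) by blast
      then show ?thesis using False data(1,2) C EE[OF C]
        by (auto simp: Xplus_piece_def Xminus_piece_def Xplus_def Xminus_def
            Eplus_piece_def Eminus_piece_def Eplus_def Eminus_def N)
    qed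
  qed
  moreover have "Xplus_piece D t \<subseteq> XX D" "Xminus_piece D t \<subseteq> XX D"
    by (auto simp: Xplus_piece_def Xminus_piece_def Xplus_def Xminus_def)
  ultimately have "Xplus_piece D t = {B \<in> XX D. eps D B \<in> Eplus_piece D t}"
    "Xminus_piece D t = {B \<in> XX D. eps D B \<in> Eminus_piece D t}"
    by blast+
  moreover have "Eplus_piece D t \<subseteq> EE (NN D)" "Eminus_piece D t \<subseteq> EE (NN D)"
    by (auto simp: Eplus_piece_def Eminus_piece_def Eplus_def Eminus_def)
  ultimately show "bij_betw (eps D) (Xplus_piece D t) (Eplus_piece D t)"
    "bij_betw (eps D) (Xminus_piece D t) (Eminus_piece D t)"
    by (simp_all only: bij_betw_restrict[OF eps_bij refl])
qed

theorem theorem1p18: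
  fixes D :: nat
  shows
    "(\<exists>!e'. e' \<in> extensional (XX D) \<and> bij_betw e' (XX D) (EE (NN D))
           \<and> (\<forall>B\<in>XX D. e' B \<in> vspan B))
     \<and> (\<forall>e'. bij_betw e' (XX D) (EE (NN D)) \<and> (\<forall>B\<in>XX D. e' B \<in> vspan B)
           \<longrightarrow> (\<forall>B\<in>XX D. e' B = eps D B))
     \<and> bij_betw (eps D) (XX D) (EE (NN D))
     \<and> partial_order_on (EE (NN D)) (leD D)
     \<and> (even D \<longrightarrow> (\<forall>t::int. even t \<longrightarrow> bij_betw (eps D) (Xeven D t) (Eeven D t)))
     \<and> (odd D \<longrightarrow>
          (\<forall>t::int. even t \<longrightarrow>
             bij_betw (eps D) (Xplus_piece D t) (Eplus_piece D t)
             \<and> bij_betw (eps D) (Xminus_piece D t) (Eminus_piece D t))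
          \<and> bij_betw (eps D) (Xplus D) (Eplus D)
          \<and> bij_betw (eps D) (Xminus D) (Eminus D))"
proof (intro conjI)
  have unique: "\<forall>B\<in>XX D. e' B = eps D B"
    if "bij_betw e' (XX D) (EE (NN D))" "\<forall>B\<in>XX D. e' B \<in> vspan B" for e'
    using triangular_unique[of "XX D" "eps D" "EE (NN D)" vspan "weight (NN D)" e',
        OF finite_XX eps_bij weight_less_eps] that by blast
  show "\<forall>e'. bij_betw e' (XX D) (EE (NN D)) \<and> (\<forall>B\<in>XX D. e' B \<in> vspan B)
      \<longrightarrow> (\<forall>B\<in>XX D. e' B = eps D B)"
    using unique by blast
  show "\<exists>!e'. e' \<in> extensional (XX D) \<and> bij_betw e' (XX D) (EE (NN D))
      \<and> (\<forall>B\<in>XX D. e' B \<in> vspan B)"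
  \<comment> \<open>Functions are total, so uniqueness on \<open>XX D\<close> refers to the
    representative that is \<open>undefined\<close> elsewhere.\<close>
  proof (rule ex1I[of _ "restrict (eps D) (XX D)"])
    have "bij_betw (restrict (eps D) (XX D)) (XX D) (EE (NN D))"
      using eps_bij bij_betw_cong[of "XX D" "restrict (eps D) (XX D)" "eps D"] by simp
    then show "restrict (eps D) (XX D) \<in> extensional (XX D)
        \<and> bij_betw (restrict (eps D) (XX D)) (XX D) (EE (NN D))
        \<and> (\<forall>B\<in>XX D. restrict (eps D) (XX D) B \<in> vspan B)"
      using eps_in_vspan by simp
  next
    fix e' assume e': "e' \<in> extensional (XX D) \<and> bij_betw e' (XX D) (EE (NN D))
      \<and> (\<forall>B\<in>XX D. e' B \<in> vspan B)"
    then have "\<forall>B\<in>XX D. e' B = eps D B" using unique by blast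
    then show "e' = restrict (eps D) (XX D)"
      using e' by (intro extensionalityI[of _ "XX D"]) auto
  qed
  show "bij_betw (eps D) (XX D) (EE (NN D))" by (rule eps_bij)
  show "partial_order_on (EE (NN D)) (leD D)"
    unfolding leD_def by (rule triangular_partial_order[where S = vspan and e = "eps D" and A = "XX D" and W = "weight (NN D)", OF eps_bij eps_in_vspan weight_less_eps])
  show "even D \<longrightarrow> (\<forall>t::int. even t \<longrightarrow> bij_betw (eps D) (Xeven D t) (Eeven D t))"
    using eps_bij_even_piece by blast
  show "odd D \<longrightarrow>
      (\<forall>t::int. even t \<longrightarrow>
         bij_betw (eps D) (Xplus_piece D t) (Eplus_piece D t)
         \<and> bij_betw (eps D) (Xminus_piece D t) (Eminus_piece D t))
      \<and> bij_betw (eps D) (Xplus D) (Eplus D)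
      \<and> bij_betw (eps D) (Xminus D) (Eminus D)"
    using eps_bij_signed_pieces eps_bij_signed by blast
qed

end
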